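(* Let $n\ge1$, let $m$ be a non-negative integer, let $\alpha>0$, let $0<q<p<\infty$, and let $u:\mathbb{C}^n\to\mathbb{C}$ and $\psi:\mathbb{C}^n\to\mathbb{C}^n$ be entire. Then the following statements are equivalent. (i) $uC_\psi:\mathcal{F}^p_{(m,\alpha)}\to\mathcal{F}^q_{(m,\alpha)}$ is bounded; (ii) $uC_\psi:\mathcal{F}^p_{(m,\alpha)}\to\mathcal{F}^q_{(m,\alpha)}$ is compact; (iii) $B_{(m,\psi)}(|u|^q)\in L^{\frac{p}{p-q}}$. We further have the norm estimate $$\|uC_\psi\|\simeq\|B_{(m,\psi)}(|u|^q)\|_{L^{\frac{p}{p-q}}}^{1/q}.$$
   Context: $dV$ is Lebesgue measure on $\mathbb{C}^n$, $\langle z,w\rangle=\sum_j z_j\overline{w_j}$, $|z|=\sqrt{\langle z,z\rangle}$, $L^p=L^p(\mathbb{C}^n,dV)$. For $0<p<\infty$ put $\|f\|_p^p=(\frac{\alpha p}{2\pi})^n\int_{\mathbb{C}^n}|f(z)|^pe^{-\frac{\alpha p}{2}|z|^2}dV(z)$. The Fock--Sobolev space $\mathcal{F}^p_{(m,\alpha)}$ of order $m$ consists of the entire functions $f$ on $\mathbb{C}^n$ with $\sum_{\beta_1+\dots+\beta_n\le m}\|\partial^\beta f\|_p<\infty$. It is equipped throughout with the equivalent (quasi-)norm $\|f\|_{(p,m)}=\big(C_{(p,m,n)}\int_{\mathbb{C}^n}|z|^{mp}|f(z)|^pe^{-\frac{\alpha p}{2}|z|^2}dV(z)\big)^{1/p}$,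 where $C_{(p,m,n)}=(\frac{\alpha p}{2})^{\frac{mp}{2}+n}\frac{\Gamma(n)}{\pi^n\Gamma(\frac{mp}{2}+n)}$. The weighted composition operator is $uC_\psi f=u\cdot(f\circ\psi)$. With $k_w(z)=e^{\alpha\langle z,w\rangle-\frac{\alpha}{2}|w|^2}$, for $0<q<\infty$, $$B_{(m,\psi)}(|u|^q)(w)=\int_{\mathbb{C}^n}\frac{|k_w(\psi(z))|^q}{(1+|\psi(z)|)^{mq}}|u(z)|^q|z|^{qm}e^{-\frac{\alpha q}{2}|z|^2}dV(z).$$ $U\simeq V$ means $U\le CV$ and $V\le CU$ with a constant $C$ independent of $u,\psi$. *)

theory Defs
  imports "HOL-Analysis.Analysis"
begin

text \<open>
  The space \<open>\<complex>\<^sup>n\<close> is \<^typ>\<open>complex ^ 'n\<close> with \<open>n = CARD('n) \<ge> 1\<close>; its \<^const>\<open>norm\<close> is the Euclidean one and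
  \<^term>\<open>lborel\<close> is Lebesgue measure \<open>dV\<close> (all integrands below are Borel).
  Integrals of nonnegative functions, and hence norms, are taken in \<^typ>\<open>ennreal\<close>.
\<close>

text \<open>Powers of extended nonnegative reals, for exponents \<open>r > 0\<close> only.\<close>

definition epow :: "ennreal \<Rightarrow> real \<Rightarrow> ennreal" where
  "epow x r = (if x = \<infinity> then \<infinity> else ennreal (enn2real x powr r))"

text \<open>Complex Frechet differentiability: the real derivative exists and is \<open>\<complex>\<close>-linear.\<close>

definition entire :: "(complex ^ 'n \<Rightarrow> complex) \<Rightarrow> bool" where
  "entire f \<longleftrightarrow> (\<forall>z. \<exists>D. (f has_derivative D) (at z) \<and> (\<forall>c v. D (c *s v) = c * D v))"

definition entire_map :: "(complex ^ 'n \<Rightarrow> complex ^ 'n) \<Rightarrow> bool" where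
  "entire_map \<psi> \<longleftrightarrow> (\<forall>j. entire (\<lambda>z. \<psi> z $ j))"

definition herm :: "complex ^ 'n \<Rightarrow> complex ^ 'n \<Rightarrow> complex" where
  "herm z w = (\<Sum>j\<in>UNIV. z $ j * cnj (w $ j))"

definition cpartial :: "'n \<Rightarrow> (complex ^ 'n \<Rightarrow> complex) \<Rightarrow> complex ^ 'n \<Rightarrow> complex" where
  "cpartial j f z = deriv (\<lambda>t. f (z + axis j t)) 0"

text \<open>
  \<open>\<partial>\<^sup>\<beta> f\<close> for a multi-index \<open>\<beta>\<close>. The index type carries no order, so the coordinates are enumerated
  in an arbitrary fixed order; for entire \<open>f\<close> the partial derivatives commute.
\<close>

definition multi_deriv ::
    "('n::finite \<Rightarrow> nat) \<Rightarrow> (complex ^ 'n \<Rightarrow> complex) \<Rightarrow> complex ^ 'n \<Rightarrow> complex" where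
  "multi_deriv \<beta> f =
     foldr (\<lambda>j. cpartial j ^^ \<beta> j) (SOME js. distinct js \<and> set js = (UNIV :: 'n set)) f"

definition fock_norm :: "real \<Rightarrow> real \<Rightarrow> (complex ^ 'n \<Rightarrow> complex) \<Rightarrow> ennreal" where
  "fock_norm \<alpha> p f =
     epow (ennreal ((\<alpha> * p / (2 * pi)) ^ CARD('n)) *
           (\<integral>\<^sup>+ z. ennreal (norm (f z) powr p * exp (- (\<alpha> * p / 2) * (norm z)\<^sup>2)) \<partial>lborel)) (1 / p)"

definition fock_sobolev :: "nat \<Rightarrow> real \<Rightarrow> real \<Rightarrow> (complex ^ 'n \<Rightarrow> complex) set" where
  "fock_sobolev m \<alpha> p =
     {f. entire f \<and>
         (\<Sum>\<beta> | (\<Sum>j\<in>UNIV. \<beta> j) \<le> m. fock_norm \<alpha> p (multi_deriv \<beta> f)) < \<infinity>}"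

text \<open>The index set of this sum is finite, so the sum is the intended one.\<close>

lemma finite_multi_indices: "finite {\<beta> :: 'n::finite \<Rightarrow> nat. (\<Sum>j\<in>UNIV. \<beta> j) \<le> m}"
proof (rule finite_subset)
  show "{\<beta> :: 'n \<Rightarrow> nat. (\<Sum>j\<in>UNIV. \<beta> j) \<le> m} \<subseteq> PiE UNIV (\<lambda>_. {..m})"
  proof
    fix \<beta> :: "'n \<Rightarrow> nat"
    assume "\<beta> \<in> {\<beta>. (\<Sum>j\<in>UNIV. \<beta> j) \<le> m}"
    moreover have "\<beta> i \<le> (\<Sum>j\<in>UNIV. \<beta> j)" for i
      by (rule member_le_sum) auto
    ultimately show "\<beta> \<in> PiE UNIV (\<lambda>_. {..m})"
      by (auto simp: PiE_def intro: le_trans)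
  qed
qed (simp add: finite_PiE)

text \<open>
  \<open>|z|\<^sup>m\<^sup>p\<close> is written \<open>(|z|\<^sup>m)\<^sup>p\<close>, which is \<open>1\<close> for \<open>m = 0\<close> even at \<open>z = 0\<close>
  (whereas \<open>0 powr 0 = 0\<close>).
\<close>

definition fs_const :: "real \<Rightarrow> real \<Rightarrow> nat \<Rightarrow> nat \<Rightarrow> real" where
  "fs_const \<alpha> p m n =
     (\<alpha> * p / 2) powr (real m * p / 2 + real n) *
     (Gamma (real n) / (pi ^ n * Gamma (real m * p / 2 + real n)))"

definition fs_norm :: "nat \<Rightarrow> real \<Rightarrow> real \<Rightarrow> (complex ^ 'n \<Rightarrow> complex) \<Rightarrow> ennreal" where
  "fs_norm m \<alpha> p f =
     epow (ennreal (fs_const \<alpha> p m CARD('n)) *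
           (\<integral>\<^sup>+ z. ennreal ((norm z ^ m) powr p * norm (f z) powr p *
                           exp (- (\<alpha> * p / 2) * (norm z)\<^sup>2)) \<partial>lborel)) (1 / p)"

definition wcomp ::
    "(complex ^ 'n \<Rightarrow> complex) \<Rightarrow> (complex ^ 'n \<Rightarrow> complex ^ 'n) \<Rightarrow>
     (complex ^ 'n \<Rightarrow> complex) \<Rightarrow> complex ^ 'n \<Rightarrow> complex" where
  "wcomp u \<psi> f = (\<lambda>z. u z * f (\<psi> z))"

text \<open>
  Boundedness, compactness and norm of an operator from the Fock--Sobolev space with exponent \<open>p\<close>
  to the one with exponent \<open>q\<close>, both of order \<open>m\<close>, with respect to \<^const>\<open>fs_norm\<close>.
  The space is metrizable also for exponents below \<open>1\<close>, so relative compactness of the images of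
  bounded sets is expressed by sequences.
\<close>

definition fs_bounded ::
    "nat \<Rightarrow> real \<Rightarrow> real \<Rightarrow> real \<Rightarrow>
     ((complex ^ 'n \<Rightarrow> complex) \<Rightarrow> complex ^ 'n \<Rightarrow> complex) \<Rightarrow> bool" where
  "fs_bounded m \<alpha> p q T \<longleftrightarrow>
     (\<forall>f\<in>fock_sobolev m \<alpha> p. T f \<in> fock_sobolev m \<alpha> q) \<and>
     (\<exists>C::real. \<forall>f\<in>fock_sobolev m \<alpha> p. fs_norm m \<alpha> q (T f) \<le> ennreal C * fs_norm m \<alpha> p f)"

definition fs_compact ::
    "nat \<Rightarrow> real \<Rightarrow> real \<Rightarrow> real \<Rightarrow>
     ((complex ^ 'n \<Rightarrow> complex) \<Rightarrow> complex ^ 'n \<Rightarrow> complex) \<Rightarrow> bool" where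
  "fs_compact m \<alpha> p q T \<longleftrightarrow>
     (\<forall>f\<in>fock_sobolev m \<alpha> p. T f \<in> fock_sobolev m \<alpha> q) \<and>
     (\<forall>F. (\<forall>k. F k \<in> fock_sobolev m \<alpha> p) \<and>
          (\<exists>R::real. \<forall>k. fs_norm m \<alpha> p (F k) \<le> ennreal R) \<longrightarrow>
          (\<exists>r g. strict_mono (r :: nat \<Rightarrow> nat) \<and> g \<in> fock_sobolev m \<alpha> q \<and>
                 (\<lambda>k. fs_norm m \<alpha> q (\<lambda>z. T (F (r k)) z - g z)) \<longlonglongrightarrow> 0))"

definition fs_opnorm ::
    "nat \<Rightarrow> real \<Rightarrow> real \<Rightarrow> real \<Rightarrow>
     ((complex ^ 'n \<Rightarrow> complex) \<Rightarrow> complex ^ 'n \<Rightarrow> complex) \<Rightarrow> ennreal" where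
  "fs_opnorm m \<alpha> p q T =
     (SUP f\<in>{f \<in> fock_sobolev m \<alpha> p. fs_norm m \<alpha> p f \<le> 1}. fs_norm m \<alpha> q (T f))"

definition fock_kernel :: "real \<Rightarrow> complex ^ 'n \<Rightarrow> complex ^ 'n \<Rightarrow> complex" where
  "fock_kernel \<alpha> w z = exp (of_real \<alpha> * herm z w - of_real (\<alpha> / 2 * (norm w)\<^sup>2))"

text \<open>The transform \<open>B\<^bsub>(m,\<psi>)\<^esub>(v)\<close>, to be applied to \<open>v = |u|\<^sup>q\<close>.\<close>

definition fs_berezin ::
    "nat \<Rightarrow> real \<Rightarrow> real \<Rightarrow> (complex ^ 'n \<Rightarrow> complex ^ 'n) \<Rightarrow> (complex ^ 'n \<Rightarrow> real) \<Rightarrow>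
     complex ^ 'n \<Rightarrow> ennreal" where
  "fs_berezin m \<alpha> q \<psi> v w =
     (\<integral>\<^sup>+ z. ennreal (norm (fock_kernel \<alpha> w (\<psi> z)) powr q / (1 + norm (\<psi> z)) powr (real m * q) *
                     v z * (norm z ^ m) powr q * exp (- (\<alpha> * q / 2) * (norm z)\<^sup>2)) \<partial>lborel)"

definition Lr_norm :: "real \<Rightarrow> (complex ^ 'n \<Rightarrow> ennreal) \<Rightarrow> ennreal" where
  "Lr_norm r g = epow (\<integral>\<^sup>+ w. epow (g w) r \<partial>lborel) (1 / r)"

definition in_Lr :: "real \<Rightarrow> (complex ^ 'n \<Rightarrow> ennreal) \<Rightarrow> bool" where
  "in_Lr r g \<longleftrightarrow> g \<in> borel_measurable lborel \<and> Lr_norm r g < \<infinity>"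

end

theory Submission
  imports Defs "HOL-Complex_Analysis.Great_Picard" "HOL-Real_Asymp.Real_Asymp"
begin

text \<open>
  Write \<open>G f z = (1 + |z|)\<^sup>m |f z| exp (- \<alpha> |z|\<^sup>2 / 2)\<close>; this is \<open>fock_mod\<close>. The norm of \<open>f\<close> is
  equivalent to the \<open>L\<^sup>p\<close> norm of \<open>G f\<close> (\<open>fs_norm_equiv\<close>), and the Fock--Sobolev space consists
  of exactly the entire functions with \<open>G f\<close> in \<open>L\<^sup>p\<close> (\<open>fock_sobolev_eq\<close>). The latter holds
  because at scale \<open>1 / (1 + |z|)\<close> the Gaussian is almost constant, so that the Cauchy estimates
  trade a derivative for a factor \<open>1 + |z|\<close>; conversely a short step towards the origin gains an
  arbitrarily small factor from the Gaussian at the cost of the derivatives.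

  With \<open>\<nu>\<close> the image under \<open>\<psi>\<close> of the measure with density \<open>wdens\<close>, the \<open>q\<close>-th power of the norm
  of \<open>u\<cdot>(f \<circ> \<psi>)\<close> is the integral of \<open>(G f)\<^sup>q\<close> against \<open>\<nu>\<close>, up to a constant, and the transform
  is \<open>B w = \<integral> exp (- \<alpha> q |w - \<zeta>|\<^sup>2 / 2) d\<nu> \<zeta>\<close>. The theorem is therefore a statement about
  the embedding into \<open>L\<^sup>q(\<nu>)\<close>.

  Sufficiency rests on the mean value inequality (\<open>fock_mod_mean_le\<close>): \<open>(G f \<zeta>)\<^sup>q\<close> is at most a
  constant times a Gaussian mean of \<open>(G f)\<^sup>q\<close> around \<open>\<zeta>\<close>. Integrating against \<open>\<nu>\<close> yields the
  integral of \<open>(G f)\<^sup>q B\<close>, and Hoelder's inequality with exponents \<open>p / q\<close> and \<open>r = p / (p - q)\<close>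
  bounds it. The same bound gives compactness: a bounded sequence has a locally uniformly
  convergent subsequence (\<open>fock_mass_Montel\<close>), whose differences to the limit are small on a large
  ball, while outside of it the norm of \<open>B\<close> in \<open>L\<^sup>r\<close> is small. Conversely a compact map is
  bounded.

  For necessity, let \<open>\<phi> \<ge> 0\<close> vary slowly, in that \<open>\<phi> w \<le> exp (\<delta> |w - v|) \<phi> v\<close>. Sums of
  normalized reproducing kernels over separated points \<open>w\<close>, with the coefficients \<open>\<phi> w\<close>, have
  \<open>G \<le> A \<phi>\<close>; and near each of the points \<open>G \<ge> c \<phi>\<close>, since the other kernels are damped by a Gaussian, which
  beats the growth of \<open>\<phi>\<close>. Boundedly many such sums together bound \<open>\<phi>\<close> from below on a ball
  (\<open>test_functions\<close>), so boundedness of the operator bounds the integral of \<open>\<phi>\<^sup>q\<close> against \<open>\<nu>\<close> by the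
  \<open>q\<close>-th power of the \<open>L\<^sup>p\<close> norm of \<open>\<phi>\<close>. The exponential mean \<open>E\<close> of \<open>\<nu>\<close> dominates \<open>B\<close>, and the choice of
  \<open>\<phi>\<close> as a slowly varying majorant of \<open>E\<^sup>r\<^sup>/\<^sup>p\<close> turns this into a bound of the integral of \<open>E\<^sup>r\<close> by a
  smaller power of itself (\<open>exponential_mean_Lr_le\<close>). Truncating \<open>\<nu>\<close> makes these integrals finite.
\<close>

section \<open>Powers of extended nonnegative reals\<close>

lemma epow_ennreal: "0 \<le> x \<Longrightarrow> epow (ennreal x) r = ennreal (x powr r)"
  by (simp add: epow_def)

lemma epow_top [simp]: "epow \<infinity> r = \<infinity>" "epow top r = top"
  by (simp_all add: epow_def)

lemma epow_0 [simp]: "epow 0 r = 0"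
  by (simp add: epow_def)

lemma epow_mono: "0 < r \<Longrightarrow> x \<le> y \<Longrightarrow> epow x r \<le> epow y r"
  by (cases x; cases y) (auto simp: epow_def top_unique intro!: ennreal_leI powr_mono2)

lemma epow_epow: "epow (epow x r) s = epow x (r * s)"
  by (cases x) (auto simp: epow_def powr_powr)

lemma epow_1 [simp]: "epow x 1 = x"
  by (cases x) (auto simp: epow_def)

lemma epow_mult: "0 < r \<Longrightarrow> epow (x * y) r = epow x r * epow y r"
  by (cases x; cases y)
     (auto simp: epow_def ennreal_mult_eq_top_iff enn2real_mult powr_mult ennreal_mult[symmetric]
        ennreal_top_mult ennreal_mult_top)

lemma epow_less_top_iff: "epow x r < top \<longleftrightarrow> x < top"
  by (cases x) (auto simp: epow_def)

lemma epow_eq_0_iff: "epow x r = 0 \<longleftrightarrow> x = 0"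
  by (cases x) (auto simp: epow_def)

lemma measurable_epow [measurable]: "(\<lambda>x. epow x r) \<in> borel_measurable borel"
  unfolding epow_def by measurable

section \<open>Isometric invariance of Lebesgue measure\<close>

lemma nn_integral_lborel_translation:
  fixes f :: "'a::euclidean_space \<Rightarrow> ennreal"
  assumes [measurable]: "f \<in> borel_measurable borel"
  shows "(\<integral>\<^sup>+x. f (c + x) \<partial>lborel) = (\<integral>\<^sup>+x. f x \<partial>lborel)"
  by (subst (2) lborel_distr_plus[of c, symmetric]) (simp add: nn_integral_distr)

lemma nn_integral_lborel_reflection:
  fixes f :: "'a::euclidean_space \<Rightarrow> ennreal"
  assumes [measurable]: "f \<in> borel_measurable borel"
  shows "(\<integral>\<^sup>+x. f (c - x) \<partial>lborel) = (\<integral>\<^sup>+x. f x \<partial>lborel)"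
  by (subst (2) lborel_affine[of "-1" c]) (simp_all add: nn_integral_density nn_integral_distr)

text \<open>The unit ball is invariant under \<open>L\<close>, and a translation invariant measure is
  determined by its value on one such set; this replaces any computation with determinants.\<close>

lemma nn_integral_lborel_isometry:
  fixes L :: "'a::euclidean_space \<Rightarrow> 'a" and f :: "'a \<Rightarrow> ennreal"
  assumes lin: "linear L" and iso: "\<And>x. norm (L x) = norm x"
    and f [measurable]: "f \<in> borel_measurable borel"
  shows "(\<integral>\<^sup>+x. f (L x) \<partial>lborel) = (\<integral>\<^sup>+x. f x \<partial>lborel)"
proof -
  have bl: "bounded_linear L" using lin by (rule linear_conv_bounded_linear[THEN iffD1])
  have Lm [measurable]: "L \<in> borel_measurable borel"
    by (intro borel_measurable_continuous_onI linear_continuous_on bl)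
  have inj: "inj L"
    unfolding linear_injective_0[OF lin] using iso norm_eq_zero by metis
  have surj: "surj L" using linear_injective_imp_surjective[OF lin inj] by simp
  define b where "b = (\<lambda>x. indicator (ball (0::'a) 1) x :: ennreal)"
  have bm [measurable]: "b \<in> borel_measurable borel" unfolding b_def by (intro borel_measurable_indicator) simp
  have bL: "b (L x) = b x" for x by (simp add: b_def indicator_def iso)
  have add: "L (x + y) = L x + L y" for x y using lin by (rule linear_add)
  have sub: "L (x - y) = L x - L y" for x y using lin by (rule linear_diff)
  have bint: "(\<integral>\<^sup>+x. b x \<partial>lborel) = ennreal (unit_ball_vol (DIM('a)))"
    by (simp add: b_def emeasure_ball)
  \<comment> \<open>Both sides are translation invariant in \<open>f\<close>; convolving with the ball, which \<open>L\<close> fixes,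
     compares them by Tonelli.\<close>
  have "(\<integral>\<^sup>+x. f (L x) \<partial>lborel) * (\<integral>\<^sup>+y. b y \<partial>lborel) = (\<integral>\<^sup>+x. \<integral>\<^sup>+y. f (L x) * b y \<partial>lborel \<partial>lborel)"
    by (simp add: nn_integral_cmult nn_integral_multc)
  also have "\<dots> = (\<integral>\<^sup>+x. \<integral>\<^sup>+y. f (L x) * b (L x + y) \<partial>lborel \<partial>lborel)"
    by (rule nn_integral_cong, rule nn_integral_lborel_translation[symmetric]) simp
  also have "\<dots> = (\<integral>\<^sup>+y. \<integral>\<^sup>+x. f (L x) * b (L x + y) \<partial>lborel \<partial>lborel)"
    by (intro lborel_pair.Fubini') (auto simp: split_beta')
  also have "\<dots> = (\<integral>\<^sup>+y. \<integral>\<^sup>+x. f (L x - y) * b (L x) \<partial>lborel \<partial>lborel)"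
  proof (rule nn_integral_cong)
    fix y :: 'a
    obtain y' where y': "y = L y'" using surj by (metis surjD)
    show "(\<integral>\<^sup>+x. f (L x) * b (L x + y) \<partial>lborel) = (\<integral>\<^sup>+x. f (L x - y) * b (L x) \<partial>lborel)"
      using nn_integral_lborel_translation[of "\<lambda>x. f (L x - y) * b (L x)" y']
      by (simp add: y' add algebra_simps)
  qed
  also have "\<dots> = (\<integral>\<^sup>+x. \<integral>\<^sup>+y. f (L x - y) * b x \<partial>lborel \<partial>lborel)"
    unfolding bL by (intro lborel_pair.Fubini') (auto simp: split_beta')
  also have "\<dots> = (\<integral>\<^sup>+x. \<integral>\<^sup>+y. f y * b x \<partial>lborel \<partial>lborel)"
    by (rule nn_integral_cong) (simp add: nn_integral_multc nn_integral_lborel_reflection)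
  also have "\<dots> = (\<integral>\<^sup>+y. f y \<partial>lborel) * (\<integral>\<^sup>+x. b x \<partial>lborel)"
    by (simp add: nn_integral_cmult nn_integral_multc)
  finally have "(\<integral>\<^sup>+x. f (L x) \<partial>lborel) * ennreal (unit_ball_vol (DIM('a)))
      = (\<integral>\<^sup>+x. f x \<partial>lborel) * ennreal (unit_ball_vol (DIM('a)))"
    by (simp add: bint)
  then have "(\<integral>\<^sup>+x. f (L x) \<partial>lborel) * ennreal (unit_ball_vol (DIM('a))) / ennreal (unit_ball_vol (DIM('a)))
      = (\<integral>\<^sup>+x. f x \<partial>lborel) * ennreal (unit_ball_vol (DIM('a))) / ennreal (unit_ball_vol (DIM('a)))"
    by simp
  moreover have "unit_ball_vol (DIM('a)) > 0" by (simp add: unit_ball_vol_pos)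
  ultimately show ?thesis by (simp add: ennreal_mult_divide_eq)
qed

section \<open>Entire functions of several variables\<close>

lemma norm_vector_scalar: "norm ((c::complex) *s v) = norm c * norm v"
  by (simp add: norm_vec_def norm_mult L2_set_right_distrib)

lemma bounded_linear_vector_scalar: "bounded_linear (\<lambda>c::complex. c *s v)"
proof (rule bounded_linear_intro[where K = "norm v"])
  fix x y :: complex and r :: real
  show "(x + y) *s v = x *s v + y *s v" by (simp add: vec_eq_iff algebra_simps)
  show "(r *\<^sub>R x) *s v = r *\<^sub>R (x *s v)" by (simp add: vec_eq_iff)
  show "norm (x *s v) \<le> norm x * norm v" by (simp add: norm_vector_scalar)
qed

lemma bounded_linear_vector_scalar_left: "bounded_linear (\<lambda>v::complex^'n. c *s v)"
proof (rule bounded_linear_intro[where K = "norm c"])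
  fix x y :: "complex^'n" and r :: real
  show "c *s (x + y) = c *s x + c *s y" by (simp add: vec_eq_iff algebra_simps)
  show "c *s (r *\<^sub>R x) = r *\<^sub>R (c *s x)" by (simp add: vec_eq_iff)
  show "norm (c *s x) \<le> norm x * norm c" by (simp add: norm_vector_scalar)
qed

lemma axis_eq_scalar: "axis j (t::complex) = t *s axis j 1"
  by (simp add: vec_eq_iff axis_def)

lemma norm_axis_complex: "norm (axis j (t::complex)) = norm t"
  by (simp add: norm_vec_def axis_def L2_set_def if_distrib[of norm] if_distrib[of "\<lambda>x. x^2"] cong: if_cong)

lemma entireE:
  assumes "entire f"
  obtains D where "(f has_derivative D) (at z)" "\<And>c v. D (c *s v) = c * D v"
  using assms unfolding entire_def by blast

lemma entire_imp_isCont: "entire f \<Longrightarrow> isCont f z"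
  by (erule entireE, erule has_derivative_continuous)

lemma entire_imp_continuous_on: "entire f \<Longrightarrow> continuous_on S f"
  by (simp add: continuous_at_imp_continuous_on entire_imp_isCont)

lemma entire_measurable [measurable_dest]: "entire f \<Longrightarrow> f \<in> borel_measurable borel"
  by (simp add: borel_measurable_continuous_onI entire_imp_continuous_on)

lemma entire_slice_holomorphic:
  assumes "entire f"
  shows "(\<lambda>t. f (a + t *s v)) holomorphic_on S"
proof -
  have "(\<lambda>t. f (a + t *s v)) field_differentiable (at t)" for t
  proof -
    obtain D where D: "(f has_derivative D) (at (a + t *s v))" "\<And>c v. D (c *s v) = c * D v"
      using entireE[OF assms] by blast
    have "((\<lambda>t. a + t *s v) has_derivative (\<lambda>t. t *s v)) (at t)"
      by (auto intro!: derivative_eq_intros bounded_linear.has_derivative[OF bounded_linear_vector_scalar])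
    from has_derivative_compose[OF this D(1)] D(2)
    have "((\<lambda>t. f (a + t *s v)) has_derivative (\<lambda>t. t * D v)) (at t)" by simp
    then show ?thesis
      unfolding field_differentiable_def has_field_derivative_def
      by (intro exI[of _ "D v"]) (simp add: mult_commute_abs)
  qed
  then show ?thesis
    using holomorphic_on_def field_differentiable_at_within by blast
qed

lemma cpartial_slice: "cpartial j f z = deriv (\<lambda>t. f (z + t *s axis j 1)) 0"
  unfolding cpartial_def by (subst axis_eq_scalar) simp

text \<open>Complex linearity reduces the derivative to its values on the coordinate directions, which are
  the partial derivatives.\<close>

lemma entire_has_derivative:
  assumes "entire f"
  shows "(f has_derivative (\<lambda>v. \<Sum>j\<in>UNIV. v $ j * cpartial j f z)) (at z)"
proof -
  obtain D where D: "(f has_derivative D) (at z)" "\<And>c v. D (c *s v) = c * D v"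
    using entireE[OF assms] by blast
  have bl: "bounded_linear D" using D(1) by (rule has_derivative_bounded_linear)
  have cp: "cpartial j f z = D (axis j 1)" for j
  proof -
    have "((\<lambda>t. z + t *s axis j 1) has_derivative (\<lambda>t. t *s axis j 1)) (at (0::complex))"
      by (auto intro!: derivative_eq_intros bounded_linear.has_derivative[OF bounded_linear_vector_scalar])
    from has_derivative_compose[OF this, of f D] D
    have "((\<lambda>t. f (z + t *s axis j 1)) has_derivative (\<lambda>t. t * D (axis j 1))) (at 0)" by simp
    then have "((\<lambda>t. f (z + t *s axis j 1)) has_field_derivative D (axis j 1)) (at 0)"
      unfolding has_field_derivative_def by (simp add: mult_commute_abs)
    then show ?thesis unfolding cpartial_slice by (rule DERIV_imp_deriv)
  qed
  have "D v = (\<Sum>j\<in>UNIV. v $ j * cpartial j f z)" for v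
  proof -
    have "D v = D (\<Sum>j\<in>UNIV. v $ j *s axis j 1)" by (simp add: basis_expansion)
    also have "\<dots> = (\<Sum>j\<in>UNIV. D (v $ j *s axis j 1))"
      using bl by (intro linear_sum bounded_linear.linear)
    finally show ?thesis by (simp add: D(2) cp)
  qed
  then have "D = (\<lambda>v. \<Sum>j\<in>UNIV. v $ j * cpartial j f z)" by (rule ext)
  then show ?thesis using D(1) by simp
qed

lemma vector_derivative_unit_circle: "vector_derivative (circlepath 0 1) (at t) = 2 * pi * \<i> * cis (2 * pi * t)"
  by (simp add: circlepath_def vector_derivative_part_circlepath linepath_def cis_conv_exp mult_ac)

lemma unit_circle_eq: "circlepath 0 1 t = cis (2 * pi * t)"
  by (simp add: circlepath_def part_circlepath_def linepath_def cis_conv_exp mult_ac)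

text \<open>Cauchy's formulas on the unit circle, parametrized by \<open>[0, 1]\<close> with unit mass.\<close>

lemma holomorphic_circle_mean:
  assumes "g holomorphic_on UNIV"
  shows "((\<lambda>t. g (cis (2 * pi * t))) has_integral g 0) {0..1}"
proof -
  have "((\<lambda>u. g u / (u - 0)) has_contour_integral (2 * of_real pi * \<i> * g 0)) (circlepath 0 1)"
    by (rule Cauchy_integral_circlepath_simple) (use assms in \<open>auto intro: holomorphic_on_subset\<close>)
  then have "((\<lambda>t. g (cis (2 * pi * t)) / cis (2 * pi * t) * (2 * pi * \<i> * cis (2 * pi * t)))
      has_integral (2 * of_real pi * \<i> * g 0)) {0..1}"
    by (simp add: has_contour_integral vector_derivative_unit_circle unit_circle_eq)
  then have "((\<lambda>t. (2 * pi * \<i>) * g (cis (2 * pi * t))) has_integral (2 * of_real pi * \<i>) * g 0) {0..1}"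
    by (simp add: mult_ac)
  from has_integral_mult_right[OF this, of "inverse (2 * pi * \<i>)"]
  show ?thesis by (simp add: field_simps)
qed

lemma holomorphic_circle_deriv:
  assumes "g holomorphic_on UNIV"
  shows "((\<lambda>t. g (cis (2 * pi * t)) * cis (- (2 * pi * t))) has_integral deriv g 0) {0..1}"
proof -
  have c: "continuous_on (cball 0 1) g" and h: "g holomorphic_on ball 0 1"
    using assms by (auto intro: holomorphic_on_subset holomorphic_on_imp_continuous_on)
  have 1: "(\<lambda>u. g u / (u - 0)^2) contour_integrable_on (circlepath 0 1)"
    by (rule Cauchy_derivative_integral_circlepath[OF c h]) simp
  have 2: "deriv g 0 = 1 / (2 * of_real pi * \<i>) * contour_integral (circlepath 0 1) (\<lambda>u. g u / (u - 0)^2)"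
    by (rule DERIV_imp_deriv, rule Cauchy_derivative_integral_circlepath[OF c h]) simp
  have "((\<lambda>u. g u / (u - 0)^2) has_contour_integral (2 * of_real pi * \<i> * deriv g 0)) (circlepath 0 1)"
    using has_contour_integral_integral[OF 1] 2 by simp
  then have "((\<lambda>t. g (cis (2 * pi * t)) / (cis (2 * pi * t))^2 * (2 * pi * \<i> * cis (2 * pi * t)))
      has_integral (2 * of_real pi * \<i> * deriv g 0)) {0..1}"
    by (simp add: has_contour_integral vector_derivative_unit_circle unit_circle_eq)
  then have "((\<lambda>t. (2 * pi * \<i>) * (g (cis (2 * pi * t)) * cis (- (2 * pi * t)))) has_integral (2 * of_real pi * \<i>) * deriv g 0) {0..1}"
    by (rule has_integral_eq[rotated]) (simp add: power2_eq_square cis_inverse[symmetric] field_simps del: cis_inverse)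
  from has_integral_mult_right[OF this, of "inverse (2 * pi * \<i>)"]
  show ?thesis by (simp add: field_simps)
qed

lemma cpartial_circle_integral:
  assumes "entire f"
  shows "cpartial j f z = integral (cbox 0 1) (\<lambda>t. f (z + cis (2 * pi * t) *s axis j 1) * cis (- (2 * pi * t)))"
  using holomorphic_circle_deriv[OF entire_slice_holomorphic[OF assms, of z "axis j 1" UNIV]]
  by (simp add: cpartial_slice integral_unique)

lemma circle_shift_continuous:
  fixes f :: "complex^'n \<Rightarrow> complex"
  assumes "continuous_on UNIV f"
  shows "continuous_on (UNIV \<times> cbox 0 (1::real)) (\<lambda>(z, t). f (z + cis (2 * pi * t) *s v) * cis (- (2 * pi * t)))"
proof -
  have 1: "continuous_on S (\<lambda>x. cis (2 * pi * snd x) *s v)" for S :: "((complex^'n) \<times> real) set"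
    by (intro bounded_linear.continuous_on[OF bounded_linear_vector_scalar] continuous_intros)
  have 2: "continuous_on S (\<lambda>x. f (fst x + cis (2 * pi * snd x) *s v))" for S :: "((complex^'n) \<times> real) set"
    by (rule continuous_on_compose2[OF assms]) (auto intro!: continuous_intros 1)
  have 3: "continuous_on S (\<lambda>x. f (fst x + cis (2 * pi * snd x) *s v) * cis (- (2 * pi * snd x)))"
    for S :: "((complex^'n) \<times> real) set"
    by (intro continuous_intros 2)
  show ?thesis unfolding split_beta' by (rule 3)
qed

lemma cpartial_continuous:
  assumes "entire f"
  shows "continuous_on UNIV (cpartial j f)"
proof -
  have "continuous_on UNIV (\<lambda>z. integral (cbox 0 1) (\<lambda>t. f (z + cis (2 * pi * t) *s axis j 1) * cis (- (2 * pi * t))))"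
    by (rule integral_continuous_on_param)
       (rule circle_shift_continuous[OF entire_imp_continuous_on[OF assms]])
  moreover have "cpartial j f = (\<lambda>x. integral (cbox 0 1) (\<lambda>t. f (x + cis (2 * pi * t) *s axis j 1) * cis (- (2 * pi * t))))"
    by (rule ext) (rule cpartial_circle_integral[OF assms])
  ultimately show ?thesis by simp
qed

text \<open>A partial derivative is a circle integral of translates of \<open>f\<close>, and one differentiates
  under the integral. The derivative is complex linear, so partial derivatives are entire; and its
  coefficients are circle integrals of partial derivatives of \<open>f\<close>, so partial derivatives
  commute.\<close>

lemma cpartial_has_derivative:
  fixes f :: "complex^'n \<Rightarrow> complex"
  assumes "entire f"
  shows "(cpartial j f has_derivative (\<lambda>v. \<Sum>i\<in>UNIV. v $ i *
     integral (cbox 0 1) (\<lambda>t. cpartial i f (z + cis (2 * pi * t) *s axis j 1) * cis (- (2 * pi * t))))) (at z)"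
proof -
  define F where "F = (\<lambda>x t. \<lambda>v. (\<Sum>i\<in>UNIV. v $ i * cpartial i f (x + cis (2 * pi * t) *s axis j 1)) * cis (- (2 * pi * t)))"
  have der: "((\<lambda>x. f (x + cis (2 * pi * t) *s axis j 1) * cis (- (2 * pi * t))) has_derivative F x t) (at x)" for x t
  proof -
    have "((\<lambda>x. x + cis (2 * pi * t) *s axis j 1) has_derivative (\<lambda>x. x)) (at x)"
      by (auto intro!: derivative_eq_intros)
    from has_derivative_compose[OF this entire_has_derivative[OF assms]]
    show ?thesis unfolding F_def by (rule has_derivative_mult_left)
  qed
  have bl: "bounded_linear (F x t)" for x t using der by (rule has_derivative_bounded_linear)
  have app: "blinfun_apply (Blinfun (F x t)) = F x t" for x t by (rule bounded_linear_Blinfun_apply[OF bl])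
  have int: "(\<lambda>t. h (x + cis (2 * pi * t) *s axis j 1) * cis (- (2 * pi * t))) integrable_on cbox 0 1"
    if "continuous_on UNIV h" for h :: "complex^'n \<Rightarrow> complex" and x
    by (intro integrable_continuous continuous_intros continuous_on_compose2[OF that]
          bounded_linear.continuous_on[OF bounded_linear_vector_scalar]) auto
  have cont: "continuous_on (UNIV \<times> cbox 0 1) (\<lambda>(x, t). Blinfun (F x t))"
  proof (rule continuous_on_blinfun_componentwise)
    fix v :: "complex^'n"
    have "continuous_on (UNIV \<times> cbox 0 (1::real)) (\<lambda>x. \<Sum>i\<in>UNIV. v $ i *
        (case x of (x,t) \<Rightarrow> cpartial i f (x + cis (2 * pi * t) *s axis j 1) * cis (- (2 * pi * t))))"
      by (intro continuous_intros circle_shift_continuous cpartial_continuous[OF assms])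
    then show "continuous_on (UNIV \<times> cbox 0 1) (\<lambda>x. blinfun_apply (case x of (x, t) \<Rightarrow> Blinfun (F x t)) v)"
      unfolding split_beta' app by (simp add: F_def sum_distrib_right mult.assoc)
  qed
  have "((\<lambda>x. integral (cbox 0 1) (\<lambda>t. f (x + cis (2 * pi * t) *s axis j 1) * cis (- (2 * pi * t))))
     has_derivative integral (cbox 0 1) (\<lambda>t. Blinfun (F z t))) (at z within UNIV)"
    by (rule leibniz_rule[OF _ _ cont])
       (auto simp: app der entire_imp_continuous_on[OF assms] intro!: int[unfolded box_real])
  moreover
  have "blinfun_apply (integral (cbox 0 1) (\<lambda>t. Blinfun (F z t))) v = (\<Sum>i\<in>UNIV. v $ i *
     integral (cbox 0 1) (\<lambda>t. cpartial i f (z + cis (2 * pi * t) *s axis j 1) * cis (- (2 * pi * t))))" for v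
  proof -
    have "continuous_on (cbox 0 1) (\<lambda>t. Blinfun (F z t))"
    proof -
      have p: "continuous_on (cbox 0 (1::real)) (\<lambda>t. (z, t))"
        by (intro continuous_on_Pair continuous_on_const continuous_on_id)
      show ?thesis using continuous_on_compose2[OF cont p] by auto
    qed
    then have "(\<lambda>t. Blinfun (F z t)) integrable_on cbox 0 1" by (rule integrable_continuous)
    then have "blinfun_apply (integral (cbox 0 1) (\<lambda>t. Blinfun (F z t))) v
        = integral (cbox 0 1) (\<lambda>t. blinfun_apply (Blinfun (F z t)) v)"
      by (rule blinfun_apply_integral)
    also have "\<dots> = integral (cbox 0 1) (\<lambda>t. \<Sum>i\<in>UNIV. v $ i * (cpartial i f (z + cis (2 * pi * t) *s axis j 1) * cis (- (2 * pi * t))))"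
      unfolding app by (simp add: F_def sum_distrib_right mult.assoc)
    also have "\<dots> = (\<Sum>i\<in>UNIV. integral (cbox 0 1) (\<lambda>t. v $ i * (cpartial i f (z + cis (2 * pi * t) *s axis j 1) * cis (- (2 * pi * t)))))"
      by (rule integral_sum) (auto intro!: integrable_on_mult_right int[unfolded box_real] cpartial_continuous assms)
    also have "\<dots> = (\<Sum>i\<in>UNIV. v $ i *
     integral (cbox 0 1) (\<lambda>t. cpartial i f (z + cis (2 * pi * t) *s axis j 1) * cis (- (2 * pi * t))))"
      by simp
    finally show ?thesis .
  qed
  then have eq: "blinfun_apply (integral (cbox 0 1) (\<lambda>t. Blinfun (F z t))) = (\<lambda>v. \<Sum>i\<in>UNIV. v $ i *
     integral (cbox 0 1) (\<lambda>t. cpartial i f (z + cis (2 * pi * t) *s axis j 1) * cis (- (2 * pi * t))))"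
    by (rule ext)
  moreover have "cpartial j f = (\<lambda>x. integral (cbox 0 1) (\<lambda>t. f (x + cis (2 * pi * t) *s axis j 1) * cis (- (2 * pi * t))))"
    by (rule ext) (rule cpartial_circle_integral[OF assms])
  ultimately show ?thesis by simp
qed

lemma entire_cpartial:
  fixes f :: "complex^'n \<Rightarrow> complex"
  assumes "entire f" shows "entire (cpartial j f)"
  unfolding entire_def
proof
  fix z :: "complex^'n"
  show "\<exists>D. (cpartial j f has_derivative D) (at z) \<and> (\<forall>c v. D (c *s v) = c * D v)"
    by (rule exI, rule conjI, rule cpartial_has_derivative[OF assms]) (auto simp: sum_distrib_left mult.assoc)
qed

lemma cpartial_commute:
  fixes f :: "complex^'n \<Rightarrow> complex"
  assumes "entire f"
  shows "cpartial i (cpartial j f) = cpartial j (cpartial i f)"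
proof
  fix z
  have eq: "(\<Sum>k\<in>UNIV. (axis i 1 :: complex^'n) $ k * X k) = X i" for X :: "'n \<Rightarrow> complex"
    by (simp add: axis_def if_distrib[of "\<lambda>x. x * _"] cong: if_cong)
  have "(\<lambda>v. \<Sum>k\<in>UNIV. v $ k * cpartial k (cpartial j f) z) =
     (\<lambda>v. \<Sum>i\<in>UNIV. v $ i *
     integral (cbox 0 1) (\<lambda>t. cpartial i f (z + cis (2 * pi * t) *s axis j 1) * cis (- (2 * pi * t))))"
    by (rule has_derivative_unique[OF entire_has_derivative[OF entire_cpartial[OF assms]] cpartial_has_derivative[OF assms]])
  from fun_cong[OF this, of "axis i 1"]
  have "cpartial i (cpartial j f) z =
     integral (cbox 0 1) (\<lambda>t. cpartial i f (z + cis (2 * pi * t) *s axis j 1) * cis (- (2 * pi * t)))"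
    unfolding eq .
  then show "cpartial i (cpartial j f) z = cpartial j (cpartial i f) z"
    by (metis cpartial_circle_integral[OF entire_cpartial[OF assms]])
qed

lemma cpartial_bound:
  assumes "entire f" "0 < r" "\<And>t. norm t = r \<Longrightarrow> norm (f (z + axis j t)) \<le> B"
  shows "norm (cpartial j f z) \<le> B / r"
proof -
  have h: "(\<lambda>t. f (z + axis j t)) holomorphic_on UNIV"
    using entire_slice_holomorphic[OF assms(1), of z "axis j 1"] by (simp flip: axis_eq_scalar)
  have "norm ((deriv ^^ 1) (\<lambda>t. f (z + t *s axis j 1)) 0) \<le> fact 1 * B / r ^ 1"
    by (rule Cauchy_inequality)
       (use assms in \<open>auto simp flip: axis_eq_scalar intro: holomorphic_on_subset[OF h] holomorphic_on_imp_continuous_on[OF holomorphic_on_subset[OF h]]\<close>)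
  then show ?thesis by (simp add: cpartial_slice)
qed

lemma entire_const: "entire (\<lambda>z. c)"
  unfolding entire_def by (auto intro!: exI[of _ "\<lambda>_. 0"])

lemma entire_add: "entire f \<Longrightarrow> entire g \<Longrightarrow> entire (\<lambda>z. f z + g z)"
  unfolding entire_def
proof
  fix z
  assume f: "\<forall>z. \<exists>D. (f has_derivative D) (at z) \<and> (\<forall>c v. D (c *s v) = c * D v)"
    and g: "\<forall>z. \<exists>D. (g has_derivative D) (at z) \<and> (\<forall>c v. D (c *s v) = c * D v)"
  obtain D E where "(f has_derivative D) (at z)" "\<forall>c v. D (c *s v) = c * D v"
    "(g has_derivative E) (at z)" "\<forall>c v. E (c *s v) = c * E v" using f g by blast
  then show "\<exists>D. ((\<lambda>z. f z + g z) has_derivative D) (at z) \<and> (\<forall>c v. D (c *s v) = c * D v)"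
    by (intro exI[of _ "\<lambda>h. D h + E h"]) (auto intro!: has_derivative_add simp: algebra_simps)
qed

lemma entire_sum: "finite A \<Longrightarrow> (\<And>i. i \<in> A \<Longrightarrow> entire (f i)) \<Longrightarrow> entire (\<lambda>z. \<Sum>i\<in>A. f i z)"
  by (induction A rule: finite_induct) (auto intro: entire_const entire_add)

lemma entire_mult: "entire f \<Longrightarrow> entire g \<Longrightarrow> entire (\<lambda>z. f z * g z)"
  unfolding entire_def
proof
  fix z
  assume f: "\<forall>z. \<exists>D. (f has_derivative D) (at z) \<and> (\<forall>c v. D (c *s v) = c * D v)"
    and g: "\<forall>z. \<exists>D. (g has_derivative D) (at z) \<and> (\<forall>c v. D (c *s v) = c * D v)"
  obtain D E where "(f has_derivative D) (at z)" "\<forall>c v. D (c *s v) = c * D v"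
    "(g has_derivative E) (at z)" "\<forall>c v. E (c *s v) = c * E v" using f g by blast
  moreover from this have "((\<lambda>z. f z * g z) has_derivative (\<lambda>h. f z * E h + D h * g z)) (at z)"
    by (intro has_derivative_mult)
  ultimately show "\<exists>D. ((\<lambda>z. f z * g z) has_derivative D) (at z) \<and> (\<forall>c v. D (c *s v) = c * D v)"
    by (intro exI[of _ "\<lambda>h. f z * E h + D h * g z"]) (simp add: algebra_simps)
qed

lemma entire_diff: "entire f \<Longrightarrow> entire g \<Longrightarrow> entire (\<lambda>z. f z - g z)"
  using entire_add[of f "\<lambda>z. (-1) * g z"] entire_mult[OF entire_const[of "-1"], of g] by simp

lemma entire_exp: "entire f \<Longrightarrow> entire (\<lambda>z. exp (f z))"
  unfolding entire_def
proof
  fix z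
  assume f: "\<forall>z. \<exists>D. (f has_derivative D) (at z) \<and> (\<forall>c v. D (c *s v) = c * D v)"
  obtain D where D: "(f has_derivative D) (at z)" "\<forall>c v. D (c *s v) = c * D v" using f by blast
  have "((\<lambda>z. exp (f z)) has_derivative (\<lambda>h. exp (f z) * D h)) (at z)"
    by (rule has_derivative_compose[OF D(1)]) (rule DERIV_exp[unfolded has_field_derivative_def])
  then show "\<exists>D. ((\<lambda>z. exp (f z)) has_derivative D) (at z) \<and> (\<forall>c v. D (c *s v) = c * D v)"
    using D(2) by (intro exI[of _ "\<lambda>h. exp (f z) * D h"]) auto
qed

lemma entire_component: "entire (\<lambda>z. z $ j)"
  unfolding entire_def
  by (auto intro!: exI[of _ "\<lambda>v. v $ j"] bounded_linear.has_derivative[OF bounded_linear_vec_nth] has_derivative_ident)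

lemma entire_map_has_derivative:
  assumes "entire_map \<psi>"
  obtains D where "(\<psi> has_derivative D) (at z)" "\<And>c v. D (c *s v) = c *s D v"
proof -
  have "\<forall>j. \<exists>D. ((\<lambda>z. \<psi> z $ j) has_derivative D) (at z) \<and> (\<forall>c v. D (c *s v) = c * D v)"
    using assms unfolding entire_map_def entire_def by blast
  then obtain D where D: "\<And>j. ((\<lambda>z. \<psi> z $ j) has_derivative D j) (at z)" "\<And>j c v. D j (c *s v) = c * D j v"
    by metis
  have "((\<lambda>z. \<Sum>j\<in>UNIV. (\<psi> z $ j) *s axis j 1) has_derivative (\<lambda>v. \<Sum>j\<in>UNIV. D j v *s axis j 1)) (at z)"
    by (intro has_derivative_sum bounded_linear.has_derivative[OF bounded_linear_vector_scalar] D)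
  moreover have "(\<Sum>j\<in>UNIV. (\<psi> z $ j) *s axis j 1) = \<psi> z" for z
    by (rule basis_expansion)
  moreover have "(\<Sum>j\<in>UNIV. D j (c *s v) *s axis j 1) = c *s (\<Sum>j\<in>UNIV. D j v *s axis j 1)" for c v
    by (simp add: D(2) vec_eq_iff sum_distrib_left mult.assoc)
  ultimately show ?thesis using that by simp
qed

lemma entire_compose:
  assumes "entire f" "entire_map \<psi>"
  shows "entire (\<lambda>z. f (\<psi> z))"
  unfolding entire_def
proof
  fix z
  obtain E where E: "(\<psi> has_derivative E) (at z)" "\<And>c v. E (c *s v) = c *s E v"
    using entire_map_has_derivative[OF assms(2)] by blast
  obtain D where D: "(f has_derivative D) (at (\<psi> z))" "\<And>c v. D (c *s v) = c * D v"
    using entireE[OF assms(1)] by blast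
  show "\<exists>D. ((\<lambda>z. f (\<psi> z)) has_derivative D) (at z) \<and> (\<forall>c v. D (c *s v) = c * D v)"
    using has_derivative_compose[OF E(1) D(1)] E(2) D(2) by (intro exI[of _ "\<lambda>v. D (E v)"]) auto
qed

lemma entire_map_continuous: "entire_map \<psi> \<Longrightarrow> continuous_on S \<psi>"
  by (rule continuous_at_imp_continuous_on, rule ballI)
     (erule entire_map_has_derivative, erule has_derivative_continuous)

lemma entire_map_measurable [measurable_dest]: "entire_map \<psi> \<Longrightarrow> \<psi> \<in> borel_measurable borel"
  by (simp add: borel_measurable_continuous_onI entire_map_continuous)

section \<open>Mean value inequalities\<close>

lemma ball_in_sets_borel [measurable]: "ball (a::'a::metric_space) r \<in> sets borel"
  by simp

lemma holomorphic_circle_mean_le: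
  assumes "g holomorphic_on UNIV"
  shows "ennreal (norm (g 0)) \<le> (\<integral>\<^sup>+t. ennreal (indicator {0..1} t * norm (g (cis (2 * pi * t)))) \<partial>lborel)"
proof -
  let ?h = "\<lambda>t. g (cis (2 * pi * t))"
  have cont: "continuous_on S ?h" for S
    by (intro continuous_on_compose2[OF holomorphic_on_imp_continuous_on[OF assms]] continuous_intros) auto
  have hm: "?h \<in> borel_measurable borel" by (intro borel_measurable_continuous_onI cont)
  have I: "((\<lambda>t. norm (?h t)) has_integral integral {0..1} (\<lambda>t. norm (?h t))) {0..1}"
    by (intro integrable_integral integrable_continuous_real continuous_intros cont)
  have "((\<lambda>t. indicator {0..1} t * norm (?h t)) has_integral integral {0..1} (\<lambda>t. norm (?h t))) UNIV"
    using I by (subst (asm) has_integral_restrict_UNIV[symmetric])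
       (auto elim!: has_integral_eq[rotated] simp: indicator_def)
  then have "(\<integral>\<^sup>+t. ennreal (indicator {0..1} t * norm (?h t)) \<partial>lborel) = ennreal (integral {0..1} (\<lambda>t. norm (?h t)))"
    using hm by (intro nn_integral_has_integral_lborel) auto
  moreover have "norm (g 0) \<le> integral {0..1} (\<lambda>t. norm (?h t))"
    using holomorphic_circle_mean[OF assms] I
    by (metis has_integral_integrable has_integral_integrable_integral integral_norm_bound_integral integral_unique order_refl)
  ultimately show ?thesis by (simp add: ennreal_leI)
qed

text \<open>Averaging the mean value property on the circles \<open>a + cis t *s v\<close> over all \<open>v\<close> in a ball needs no
  polar coordinates: for fixed \<open>t\<close> the map \<open>v \<mapsto> cis t *s v\<close> is an isometry.\<close>

lemma entire_ball_mean_le: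
  fixes f :: "complex^'n \<Rightarrow> complex"
  assumes f: "entire f"
  shows "ennreal (norm (f a)) * emeasure lborel (ball (0::complex^'n) r)
    \<le> (\<integral>\<^sup>+w. ennreal (norm (f w)) * indicator (ball a r) w \<partial>lborel)"
proof -
  note [measurable] = entire_measurable[OF f]
  define b where "b = (\<lambda>x::complex^'n. indicator (ball 0 r) x :: ennreal)"
  have bm [measurable]: "b \<in> borel_measurable borel" unfolding b_def by (intro borel_measurable_indicator) simp
  have cm: "(\<lambda>x. cis (2 * pi * fst x) *s snd x) \<in> borel_measurable (lborel \<Otimes>\<^sub>M (lborel :: (complex^'n) measure))"
  proof -
    have "continuous_on UNIV (\<lambda>x::real \<times> (complex^'n). cis (2 * pi * fst x) *s snd x)"
      unfolding vector_scalar_mult_def by (intro continuous_intros)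
    then show ?thesis
      by (simp add: lborel_prod borel_measurable_continuous_onI)
  qed
  have cm1 [measurable]: "(\<lambda>v. cis (2 * pi * t) *s v) \<in> borel_measurable (borel :: (complex^'n) measure)" for t
    by (intro borel_measurable_continuous_onI linear_continuous_on bounded_linear_vector_scalar_left)
  have "ennreal (norm (f a)) * emeasure lborel (ball (0::complex^'n) r)
      = (\<integral>\<^sup>+v. ennreal (norm (f a)) * b v \<partial>lborel)"
    unfolding b_def by (rule nn_integral_cmult_indicator[symmetric]) simp
  also have "\<dots> \<le> (\<integral>\<^sup>+v. (\<integral>\<^sup>+t. ennreal (indicator {0..1} t * norm (f (a + cis (2 * pi * t) *s v))) \<partial>lborel) * b v \<partial>lborel)"
    using holomorphic_circle_mean_le[OF entire_slice_holomorphic[OF f, of a]]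
    by (intro nn_integral_mono mult_right_mono) simp_all
  also have "\<dots> = (\<integral>\<^sup>+v. \<integral>\<^sup>+t. ennreal (indicator {0..1} t * norm (f (a + cis (2 * pi * t) *s v))) * b v \<partial>lborel \<partial>lborel)"
  proof -
    have "(\<lambda>t. f (a + cis (2 * pi * t) *s v)) \<in> borel_measurable lborel" for v
      by (simp, intro borel_measurable_continuous_onI continuous_on_compose2[OF entire_imp_continuous_on[OF f, of UNIV]]
          continuous_intros bounded_linear.continuous_on[OF bounded_linear_vector_scalar]) auto
    note [measurable] = this
    show ?thesis by (rule nn_integral_cong, rule nn_integral_multc[symmetric]) measurable
  qed
  also have "\<dots> = (\<integral>\<^sup>+t. \<integral>\<^sup>+v. ennreal (indicator {0..1} t * norm (f (a + cis (2 * pi * t) *s v))) * b v \<partial>lborel \<partial>lborel)"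
  proof (rule lborel_pair.Fubini')
    have "(\<lambda>x. f (a + cis (2 * pi * fst x) *s snd x)) \<in> borel_measurable (lborel \<Otimes>\<^sub>M (lborel :: (complex^'n) measure))"
      using cm by measurable
    then show "(\<lambda>(t, v). ennreal (indicator {0..1} t * norm (f (a + cis (2 * pi * t) *s v))) * b v)
      \<in> borel_measurable (lborel \<Otimes>\<^sub>M lborel)"
      unfolding split_beta' by measurable
  qed
  also have "\<dots> = (\<integral>\<^sup>+t. \<integral>\<^sup>+v. ennreal (indicator {0..1} (t::real) * norm (f (a + v))) * b v \<partial>lborel \<partial>lborel)"
  proof (rule nn_integral_cong, goal_cases)
    case (1 t)
    have "b (cis (2 * pi * t) *s v) = b v" for v
      by (simp add: b_def indicator_def norm_vector_scalar)
    then show ?case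
      using nn_integral_lborel_isometry[of "\<lambda>v. cis (2 * pi * t) *s v" "\<lambda>v. ennreal (indicator {0..1} t * norm (f (a + v))) * b v"]
      by (simp add: norm_vector_scalar bounded_linear.linear[OF bounded_linear_vector_scalar_left])
  qed
  also have "\<dots> = (\<integral>\<^sup>+t. indicator {0..1} (t::real) * (\<integral>\<^sup>+v. ennreal (norm (f (a + v))) * b v \<partial>lborel) \<partial>lborel)"
    by (rule nn_integral_cong, subst nn_integral_cmult[symmetric])
       (simp_all add: ennreal_mult mult.assoc ennreal_indicator)
  also have "\<dots> = (\<integral>\<^sup>+v. ennreal (norm (f (a + v))) * b v \<partial>lborel)"
    by (simp add: nn_integral_multc)
  also have "\<dots> = (\<integral>\<^sup>+w. ennreal (norm (f w)) * indicator (ball a r) w \<partial>lborel)"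
  proof -
    have "b v = indicator (ball a r) (a + v)" for v
      by (simp add: b_def indicator_def dist_norm)
    then show ?thesis
      using nn_integral_lborel_translation[of "\<lambda>w. ennreal (norm (f w)) * indicator (ball a r) w" a]
      by (simp add: borel_measurable_times_ennreal)
  qed
  finally show ?thesis .
qed

text \<open>For exponents below \<open>1\<close> convexity is not available. Following Hardy and Littlewood, the maximum
  \<open>M\<close> of \<open>|f|\<^sup>p\<close> times a power of the distance to the boundary is compared with the mean of
  \<open>|f| = |f|\<^sup>1\<^sup>-\<^sup>p |f|\<^sup>p\<close> around the point where it is attained: there the first factor is at most a
  multiple of \<open>M\<close> to the power \<open>1 / p - 1\<close>, while \<open>|f|\<close> at the centre is one of \<open>M\<close> to the power \<open>1 / p\<close>,
  so one power of \<open>M\<close> remains.\<close>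

lemma hardy_littlewood_mean_le1:
  fixes f :: "complex^'n \<Rightarrow> complex"
  assumes f: "entire f" and p: "0 < p" "p \<le> 1" and r: "0 < r"
  shows "ennreal (norm (f a) powr p * r ^ DIM(complex^'n)) \<le>
     ennreal (2 powr (DIM(complex^'n) / p) / unit_ball_vol (DIM(complex^'n))) *
     (\<integral>\<^sup>+w. ennreal (norm (f w) powr p) * indicator (ball a r) w \<partial>lborel)"
proof -
  note [measurable] = entire_measurable[OF f]
  let ?N = "DIM(complex^'n)"
  let ?V = "unit_ball_vol (real ?N)"
  let ?I = "\<integral>\<^sup>+w. ennreal (norm (f w) powr p) * indicator (ball a r) w \<partial>lborel"
  define \<Phi> where "\<Phi> = (\<lambda>w. norm (f w) powr p * (r - dist w a) ^ ?N)"
  have V: "?V > 0" by (simp add: unit_ball_vol_pos)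
  have "continuous_on (cball a r) \<Phi>"
    unfolding \<Phi>_def using p by (intro continuous_intros continuous_on_powr' entire_imp_continuous_on[OF f]) auto
  then obtain w0 where w0: "w0 \<in> cball a r" "\<And>w. w \<in> cball a r \<Longrightarrow> \<Phi> w \<le> \<Phi> w0"
    using continuous_attains_sup[of "cball a r" \<Phi>] r by auto
  define M where "M = \<Phi> w0"
  have aM: "norm (f a) powr p * r ^ ?N \<le> M"
    using w0(2)[of a] r by (simp add: \<Phi>_def M_def)
  show ?thesis
  proof (cases "?I = \<infinity> \<or> M = 0")
    case True
    then show ?thesis
    proof
      assume I: "?I = \<infinity>"
      have "0 < 2 powr (?N / p) / ?V" using V by (intro divide_pos_pos) auto
      then have "ennreal (2 powr (?N / p) / ?V) \<noteq> 0" by (simp only: ennreal_eq_0_iff not_le)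
      then show ?thesis unfolding I by (simp only: infinity_ennreal_def ennreal_mult_top if_False top_greatest)
    next
      assume "M = 0"
      then show ?thesis using aM by (simp add: ennreal_neg)
    qed
  next
    case False
    then obtain i where i: "?I = ennreal i" "0 \<le> i" by (cases ?I) auto
    \<comment> \<open>On the ball of radius \<open>\<rho>\<close> around \<open>w0\<close> the distance to the boundary is still at least \<open>\<rho>\<close>.\<close>
    define \<rho> where "\<rho> = (r - dist w0 a) / 2"
    have M0: "M > 0" using False w0(1) by (simp add: M_def \<Phi>_def order_less_le dist_commute)
    then have \<rho>: "\<rho> > 0" using w0(1)
      by (cases "r - dist w0 a = 0") (auto simp: M_def \<Phi>_def \<rho>_def dist_commute zero_power)
    define X where "X = M / \<rho> ^ ?N"
    have X: "X > 0" using M0 \<rho> by (simp add: X_def)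
    have fw: "norm (f w) \<le> X powr ((1 - p) / p) * norm (f w) powr p \<and> w \<in> ball a r" if "w \<in> ball w0 \<rho>" for w
    proof -
      have d: "r - dist w a \<ge> \<rho>"
        using that dist_triangle[of w a w0] by (simp add: \<rho>_def dist_commute field_simps)
      then have wb: "w \<in> ball a r" using \<rho> by (simp add: dist_commute)
      have "norm (f w) powr p * \<rho> ^ ?N \<le> \<Phi> w"
        unfolding \<Phi>_def using d \<rho> by (intro mult_left_mono power_mono) auto
      also have "\<dots> \<le> M" using w0(2)[of w] wb by (simp add: M_def)
      finally have le: "norm (f w) powr p \<le> X" using \<rho> by (simp add: X_def field_simps)
      have "norm (f w) = norm (f w) powr (1 - p) * norm (f w) powr p"
        using p by (cases "norm (f w) = 0") (auto simp flip: powr_add)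
      also have "norm (f w) powr (1 - p) = (norm (f w) powr p) powr ((1 - p) / p)"
        using p by (simp add: powr_powr)
      also have "\<dots> \<le> X powr ((1 - p) / p)"
        using le p by (intro powr_mono2) auto
      finally show ?thesis using wb by (simp add: mult_right_mono)
    qed
    have "ennreal (norm (f w0) * (?V * \<rho> ^ ?N)) = ennreal (norm (f w0)) * emeasure lborel (ball (0::complex^'n) \<rho>)"
      using \<rho> V by (simp add: emeasure_ball ennreal_mult)
    also have "\<dots> \<le> (\<integral>\<^sup>+w. ennreal (norm (f w)) * indicator (ball w0 \<rho>) w \<partial>lborel)"
      by (rule entire_ball_mean_le[OF f])
    also have "\<dots> \<le> (\<integral>\<^sup>+w. ennreal (X powr ((1 - p) / p)) * (ennreal (norm (f w) powr p) * indicator (ball a r) w) \<partial>lborel)"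
      using fw by (intro nn_integral_mono) (auto simp: indicator_def ennreal_mult[symmetric] intro!: ennreal_leI simp del: mem_ball)
    also have "\<dots> = ennreal (X powr ((1 - p) / p) * i)"
      using i by (subst nn_integral_cmult)
        (auto simp: ennreal_mult intro!: borel_measurable_times_ennreal borel_measurable_indicator)
    finally have le: "norm (f w0) * (?V * \<rho> ^ ?N) \<le> X powr ((1 - p) / p) * i"
      using i by (simp add: ennreal_le_iff)
    have "2 * \<rho> = r - dist w0 a" by (simp add: \<rho>_def)
    then have "norm (f w0) powr p * (2 * \<rho>) ^ ?N = M"
      unfolding M_def \<Phi>_def by (simp only:)
    then have "norm (f w0) powr p = X / 2 ^ ?N" using \<rho> by (simp add: X_def power_mult_distrib field_simps)
    then have "norm (f w0) = (X / 2 ^ ?N) powr (1 / p)"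
      using p by (metis (no_types, lifting) nonzero_mult_div_cancel_left norm_ge_zero order_less_irrefl powr_one powr_powr times_divide_eq_right mult.right_neutral powr_one_gt_zero_iff powr_0 norm_zero)
    also have "\<dots> = X powr (1 / p) / 2 powr (?N / p)"
      using X by (simp add: powr_divide powr_powr flip: powr_realpow)
    also have "X powr (1 / p) = X powr ((1 - p) / p) * X"
    proof -
      have "X powr ((1 - p) / p) * X = X powr ((1 - p) / p) * X powr 1" using X by simp
      also have "\<dots> = X powr ((1 - p) / p + 1)" by (simp only: powr_add)
      also have "(1 - p) / p + 1 = 1 / p" using p by (simp add: field_simps)
      finally show ?thesis ..
    qed
    finally have "X powr ((1 - p) / p) * (X * ?V * \<rho> ^ ?N / 2 powr (?N / p)) \<le> X powr ((1 - p) / p) * i"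
      using le by (simp add: mult_ac)
    then have "X * ?V * \<rho> ^ ?N / 2 powr (?N / p) \<le> i"
      by (rule mult_left_le_imp_le) (use X in simp)
    then have "M \<le> 2 powr (?N / p) / ?V * i"
      using \<rho> V by (simp add: X_def field_simps)
    then have "norm (f a) powr p * r ^ ?N \<le> 2 powr (?N / p) / ?V * i" using aM by simp
    then show ?thesis using i V by (simp add: ennreal_mult[symmetric] ennreal_leI)
  qed
qed

lemma entire_power: "entire f \<Longrightarrow> entire (\<lambda>z. f z ^ k)"
  by (induction k) (auto intro: entire_const entire_mult)

text \<open>Large exponents reduce to small ones, since \<open>|f|\<^sup>p = |f\<^sup>k|\<^sup>p\<^sup>/\<^sup>k\<close> and \<open>f\<^sup>k\<close> is entire.\<close>

lemma hardy_littlewood_mean_le: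
  assumes p: "0 < (p::real)"
  obtains C where "0 < C" "\<And>(f :: complex^'n \<Rightarrow> complex) a r. entire f \<Longrightarrow> 0 < r \<Longrightarrow>
     ennreal (norm (f a) powr p * r ^ DIM(complex^'n)) \<le>
     ennreal C * (\<integral>\<^sup>+w. ennreal (norm (f w) powr p) * indicator (ball a r) w \<partial>lborel)"
proof -
  obtain k :: nat where k: "p \<le> real k" using real_arch_simple by blast
  have k0: "k > 0" using k p by (cases k) auto
  have eq: "norm (f z ^ k) powr (p / k) = norm (f z) powr p" for f :: "complex^'n \<Rightarrow> complex" and z
    using k0 by (cases "f z = 0") (auto simp: norm_power powr_powr simp flip: powr_realpow)
  show ?thesis
  proof (rule that)
    show "0 < 2 powr (DIM(complex^'n) / (p / k)) / unit_ball_vol (DIM(complex^'n))"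
      by (simp add: unit_ball_vol_pos)
    show "ennreal (norm (f a) powr p * r ^ DIM(complex^'n)) \<le>
     ennreal (2 powr (DIM(complex^'n) / (p / k)) / unit_ball_vol (DIM(complex^'n))) *
     (\<integral>\<^sup>+w. ennreal (norm (f w) powr p) * indicator (ball a r) w \<partial>lborel)"
      if "entire f" "0 < r" for f :: "complex^'n \<Rightarrow> complex" and a r
      using hardy_littlewood_mean_le1[OF entire_power[OF that(1), of k], of "p / k" r a] p k k0 that(2)
      by (simp add: eq)
  qed
qed

text \<open>The weight \<open>(1 + |z|)\<^sup>k\<close> instead of \<open>|z|\<^sup>k\<close> is comparable to a constant on unit balls, which makes
  local estimates uniform.\<close>

definition fock_mod :: "nat \<Rightarrow> real \<Rightarrow> (complex^'n \<Rightarrow> complex) \<Rightarrow> complex^'n \<Rightarrow> real" where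
  "fock_mod k \<alpha> f z = (1 + norm z) ^ k * norm (f z) * exp (- (\<alpha> / 2) * (norm z)\<^sup>2)"

lemma fock_mod_nonneg [simp]: "0 \<le> fock_mod k \<alpha> f z"
  by (simp add: fock_mod_def)

lemma gauss_measurable [measurable]:
  "(\<lambda>x::'a::real_normed_vector. exp (- c * (norm x)\<^sup>2)) \<in> borel_measurable borel"
  by (intro borel_measurable_continuous_onI continuous_intros)

lemma fock_mod_measurable [measurable (raw)]:
  "f \<in> borel_measurable borel \<Longrightarrow> fock_mod k \<alpha> f \<in> borel_measurable borel"
  unfolding fock_mod_def by (intro borel_measurable_times gauss_measurable) measurable

lemma fock_mod_continuous: "entire f \<Longrightarrow> continuous_on S (fock_mod k \<alpha> f)"
  unfolding fock_mod_def by (intro continuous_intros entire_imp_continuous_on)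

lemma Re_herm: "Re (herm z w) = z \<bullet> w"
  by (simp add: herm_def inner_vec_def inner_complex_def)

lemma entire_herm: "entire (\<lambda>z. herm z w)"
  unfolding herm_def by (intro entire_sum entire_mult entire_component entire_const finite)

lemma one_plus_norm_le: "1 + norm (z::'a::real_normed_vector) \<le> (1 + norm w) * (1 + norm (z - w))"
proof -
  have "norm z \<le> norm w + norm (z - w)" by (metis add.commute norm_triangle_sub)
  moreover have "0 \<le> norm w * norm (z - w)" by simp
  moreover have "(1 + norm w) * (1 + norm (z - w)) = 1 + norm w + norm (z - w) + norm w * norm (z - w)"
    by (simp add: algebra_simps)
  ultimately show ?thesis by linarith
qed

text \<open>Multiplying \<open>f\<close> by \<open>exp (- \<alpha> \<langle>w, a\<rangle>)\<close> changes the Gaussian \<open>exp (- \<alpha> |w|\<^sup>2 / 2)\<close> into one centred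
  at \<open>a\<close>, up to a factor independent of \<open>w\<close>; and this is comparable to a constant on the unit ball
  around \<open>a\<close>.\<close>

lemma fock_mod_mean_le:
  assumes p: "0 < (p::real)" and \<alpha>: "0 < \<alpha>"
  obtains C where "0 < C" "\<And>(f :: complex^'n \<Rightarrow> complex) a r. entire f \<Longrightarrow> 0 < r \<Longrightarrow> r \<le> 1 \<Longrightarrow>
     ennreal (fock_mod k \<alpha> f a powr p * r ^ DIM(complex^'n)) \<le>
     ennreal C * (\<integral>\<^sup>+w. ennreal (fock_mod k \<alpha> f w powr p) * indicator (ball a r) w \<partial>lborel)"
proof -
  obtain C where C: "0 < C" "\<And>(f :: complex^'n \<Rightarrow> complex) a r. entire f \<Longrightarrow> 0 < r \<Longrightarrow>
     ennreal (norm (f a) powr p * r ^ DIM(complex^'n)) \<le>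
     ennreal C * (\<integral>\<^sup>+w. ennreal (norm (f w) powr p) * indicator (ball a r) w \<partial>lborel)"
    using hardy_littlewood_mean_le[OF p] by blast
  define K where "K = 2 ^ k * exp (\<alpha> / 2)"
  show ?thesis
  proof (rule that[of "C * K powr p"])
    show "0 < C * K powr p" using C(1) by (simp add: K_def)
    fix f :: "complex^'n \<Rightarrow> complex" and a and r :: real assume f: "entire f" and r: "0 < r" "r \<le> 1"
    note [measurable] = entire_measurable[OF f]
    define g where "g = (\<lambda>w. of_real ((1 + norm a) ^ k * exp (\<alpha> / 2 * (norm a)\<^sup>2)) * (f w * exp (- (of_real \<alpha>) * herm w a)))"
    have g: "entire g" unfolding g_def by (intro entire_mult entire_const f entire_exp entire_herm)
    have gn: "norm (g w) = (1 + norm a) ^ k * norm (f w) * exp (- (\<alpha> / 2) * (norm w)\<^sup>2) * exp (\<alpha> / 2 * (norm (w - a))\<^sup>2)" for w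
    proof -
      have "norm (w - a)^2 = norm w ^2 + norm a^2 - 2 * (w \<bullet> a)"
        by (simp add: power2_norm_eq_inner inner_diff_left inner_diff_right inner_commute)
      then have e: "\<alpha> / 2 * (norm a)\<^sup>2 - \<alpha> * (w \<bullet> a) = - (\<alpha> / 2) * (norm w)\<^sup>2 + \<alpha> / 2 * (norm (w - a))\<^sup>2"
        by algebra
      have "norm (g w) = (1 + norm a) ^ k * norm (f w) * (exp (\<alpha> / 2 * (norm a)\<^sup>2) * exp (- (\<alpha> * (w \<bullet> a))))"
        by (simp add: g_def norm_mult Re_herm del: of_real_mult of_real_add of_real_power)
      also have "exp (\<alpha> / 2 * (norm a)\<^sup>2) * exp (- (\<alpha> * (w \<bullet> a))) = exp (- (\<alpha> / 2) * (norm w)\<^sup>2) * exp (\<alpha> / 2 * (norm (w - a))\<^sup>2)"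
        unfolding exp_add[symmetric] using e by simp
      finally show ?thesis by (simp add: mult_ac)
    qed
    have ga: "norm (g a) = fock_mod k \<alpha> f a" by (simp add: gn fock_mod_def)
    have gw: "norm (g w) \<le> K * fock_mod k \<alpha> f w" if "w \<in> ball a r" for w
    proof -
      have d: "norm (w - a) \<le> 1" using that r by (simp add: dist_norm norm_minus_commute)
      have "1 + norm a \<le> 2 * (1 + norm w)"
      proof -
        have "norm a \<le> norm w + 1" using d norm_triangle_sub[of a w] by (simp add: norm_minus_commute)
        then show ?thesis using norm_ge_zero[of w] by argo
      qed
      then have "(1 + norm a) ^ k \<le> 2 ^ k * (1 + norm w) ^ k"
        by (metis norm_ge_zero power_mono power_mult_distrib add_nonneg_nonneg zero_le_one)
      moreover have "exp (\<alpha> / 2 * (norm (w - a))\<^sup>2) \<le> exp (\<alpha> / 2)"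
        using d \<alpha> by (simp add: power_le_one)
      ultimately have "(1 + norm a) ^ k * exp (\<alpha> / 2 * (norm (w - a))\<^sup>2) \<le> (2 ^ k * (1 + norm w) ^ k) * exp (\<alpha> / 2)"
        by (intro mult_mono) auto
      from mult_right_mono[OF this, of "norm (f w) * exp (- (\<alpha> / 2) * (norm w)\<^sup>2)"]
      show ?thesis by (simp add: gn fock_mod_def K_def mult_ac)
    qed
    have "ennreal (fock_mod k \<alpha> f a powr p * r ^ DIM(complex^'n)) \<le>
       ennreal C * (\<integral>\<^sup>+w. ennreal (norm (g w) powr p) * indicator (ball a r) w \<partial>lborel)"
      using C(2)[OF g r(1), of a] by (simp add: ga)
    also have "\<dots> \<le> ennreal C * (\<integral>\<^sup>+w. ennreal (K powr p) * (ennreal (fock_mod k \<alpha> f w powr p) * indicator (ball a r) w) \<partial>lborel)"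
    proof (intro mult_left_mono nn_integral_mono)
      fix w
      show "ennreal (norm (g w) powr p) * indicator (ball a r) w \<le> ennreal (K powr p) * (ennreal (fock_mod k \<alpha> f w powr p) * indicator (ball a r) w)"
      proof (cases "w \<in> ball a r")
        case True
        have "norm (g w) powr p \<le> (K * fock_mod k \<alpha> f w) powr p" using gw[OF True] p by (intro powr_mono2) auto
        also have "\<dots> = K powr p * fock_mod k \<alpha> f w powr p" by (simp add: powr_mult K_def)
        finally show ?thesis using True by (simp add: ennreal_mult[symmetric] ennreal_leI)
      qed simp
    qed simp
    also have "\<dots> = ennreal (C * K powr p) * (\<integral>\<^sup>+w. ennreal (fock_mod k \<alpha> f w powr p) * indicator (ball a r) w \<partial>lborel)"
      using C(1) by (subst nn_integral_cmult)
        (auto simp: ennreal_mult mult.assoc intro!: borel_measurable_times_ennreal borel_measurable_indicator)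
    finally show "ennreal (fock_mod k \<alpha> f a powr p * r ^ DIM(complex^'n)) \<le>
     ennreal (C * K powr p) * (\<integral>\<^sup>+w. ennreal (fock_mod k \<alpha> f w powr p) * indicator (ball a r) w \<partial>lborel)" .
  qed
qed

text \<open>The means are taken over balls of radius comparable to \<open>1 / (1 + |a|)\<close> and normalized by their
  volume. A point \<open>w\<close> lies in the balls of only those \<open>a\<close> that are close to it, and these \<open>a\<close> fill a
  volume comparable to that of the balls, so Tonelli's theorem gives a bound uniform in \<open>w\<close>.\<close>

lemma local_average_integral:
  fixes h g :: "'a::euclidean_space \<Rightarrow> ennreal"
  assumes \<kappa>: "1 \<le> \<kappa>" and [measurable]: "h \<in> borel_measurable borel"
    and S: "\<And>a. a \<in> S \<Longrightarrow> \<kappa> \<le> 1 + norm a"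
    and g: "\<And>a. a \<in> S \<Longrightarrow> g a \<le> ennreal ((1 + norm a) ^ DIM('a)) * (\<integral>\<^sup>+w. h w * indicator (ball a (\<kappa> / (1 + norm a))) w \<partial>lborel)"
  shows "(\<integral>\<^sup>+a. g a * indicator S a \<partial>lborel) \<le> ennreal ((4 * \<kappa>) ^ DIM('a) * unit_ball_vol DIM('a)) * (\<integral>\<^sup>+w. h w \<partial>lborel)"
proof -
  define K where "K = (\<lambda>a w::'a. if dist a w < \<kappa> / (1 + norm a) \<and> \<kappa> \<le> 1 + norm a then ennreal ((1 + norm a) ^ DIM('a)) else 0)"
  have Km [measurable]: "(\<lambda>x. K (fst x) (snd x)) \<in> borel_measurable (lborel \<Otimes>\<^sub>M lborel)"
    unfolding K_def by measurable
  have "(\<integral>\<^sup>+a. g a * indicator S a \<partial>lborel) \<le> (\<integral>\<^sup>+a. \<integral>\<^sup>+w. K a w * h w \<partial>lborel \<partial>lborel)"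
  proof (rule nn_integral_mono)
    fix a :: 'a
    show "g a * indicator S a \<le> (\<integral>\<^sup>+w. K a w * h w \<partial>lborel)"
    proof (cases "a \<in> S")
      case True
      have "g a \<le> (\<integral>\<^sup>+w. ennreal ((1 + norm a) ^ DIM('a)) * (h w * indicator (ball a (\<kappa> / (1 + norm a))) w) \<partial>lborel)"
        using g[OF True] by (subst nn_integral_cmult) (auto intro!: borel_measurable_times_ennreal borel_measurable_indicator)
      also have "\<dots> = (\<integral>\<^sup>+w. K a w * h w \<partial>lborel)"
        using S[OF True] by (intro nn_integral_cong) (auto simp: K_def indicator_def)
      finally show ?thesis using True by simp
    qed simp
  qed
  also have "\<dots> = (\<integral>\<^sup>+w. \<integral>\<^sup>+a. K a w * h w \<partial>lborel \<partial>lborel)"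
    by (rule lborel_pair.Fubini'[symmetric]) (simp add: split_beta')
  also have "\<dots> = (\<integral>\<^sup>+w. (\<integral>\<^sup>+a. K a w \<partial>lborel) * h w \<partial>lborel)"
    by (rule nn_integral_cong, rule nn_integral_multc) (simp add: K_def)
  also have "\<dots> \<le> (\<integral>\<^sup>+w. ennreal ((4 * \<kappa>) ^ DIM('a) * unit_ball_vol DIM('a)) * h w \<partial>lborel)"
  proof (intro nn_integral_mono mult_right_mono)
    fix w :: 'a
    let ?r = "2 * \<kappa> / (1 + norm w)"
    have "K a w \<le> ennreal ((2 * (1 + norm w)) ^ DIM('a)) * indicator (ball w ?r) a" for a
    proof (cases "dist a w < \<kappa> / (1 + norm a) \<and> \<kappa> \<le> 1 + norm a")
      case True
      have "\<kappa> / (1 + norm a) \<le> 1" using True norm_ge_zero[of a] by (subst divide_le_eq_1) linarith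
      then have d: "dist a w < 1" using True by linarith
      have aw: "norm a < 1 + norm w" "norm w < 1 + norm a"
        using d norm_triangle_sub[of a w] norm_triangle_sub[of w a] by (auto simp: dist_norm norm_minus_commute)
      have "\<kappa> / (1 + norm a) = 2 * \<kappa> / (2 * (1 + norm a))"
        by (rule mult_divide_mult_cancel_left[symmetric]) simp
      also have "\<dots> \<le> ?r"
      proof (rule divide_left_mono)
        show "1 + norm w \<le> 2 * (1 + norm a)" using aw(2) norm_ge_zero[of a] by argo
        show "0 < 2 * (1 + norm a) * (1 + norm w)"
          using norm_ge_zero[of a] norm_ge_zero[of w] by (intro mult_pos_pos) linarith+
      qed (use \<kappa> in simp)
      finally have "\<kappa> / (1 + norm a) \<le> ?r" .
      then have "a \<in> ball w ?r" using True by (simp add: dist_commute)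
      moreover have "(1 + norm a) ^ DIM('a) \<le> (2 * (1 + norm w)) ^ DIM('a)"
        using aw(1) norm_ge_zero[of w] norm_ge_zero[of a] by (intro power_mono) argo+
      ultimately show ?thesis by (simp add: K_def ennreal_leI)
    qed (auto simp: K_def)
    then have "(\<integral>\<^sup>+a. K a w \<partial>lborel) \<le> (\<integral>\<^sup>+a. ennreal ((2 * (1 + norm w)) ^ DIM('a)) * indicator (ball w ?r) a \<partial>lborel)"
      by (intro nn_integral_mono)
    also have "\<dots> = ennreal ((2 * (1 + norm w)) ^ DIM('a)) * ennreal (unit_ball_vol DIM('a) * ?r ^ DIM('a))"
      using \<kappa> by (subst nn_integral_cmult_indicator) (auto simp: emeasure_ball)
    also have "\<dots> = ennreal ((2 * (1 + norm w)) ^ DIM('a) * ?r ^ DIM('a) * unit_ball_vol DIM('a))"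
      using \<kappa> by (subst ennreal_mult[symmetric]) (auto simp: mult_ac)
    also have "(2 * (1 + norm w)) ^ DIM('a) * ?r ^ DIM('a) = (4 * \<kappa>) ^ DIM('a)"
    proof -
      have "1 + norm w \<noteq> 0" using norm_ge_zero[of w] by linarith
      then have "2 * (1 + norm w) * ?r = 4 * \<kappa>" by (simp add: field_simps)
      then show ?thesis by (simp only: power_mult_distrib[symmetric])
    qed
    finally show "(\<integral>\<^sup>+a. K a w \<partial>lborel) \<le> ennreal ((4 * \<kappa>) ^ DIM('a) * unit_ball_vol DIM('a))" .
  qed simp
  also have "\<dots> = ennreal ((4 * \<kappa>) ^ DIM('a) * unit_ball_vol DIM('a)) * (\<integral>\<^sup>+w. h w \<partial>lborel)"
    by (simp add: nn_integral_cmult)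
  finally show ?thesis .
qed

section \<open>The Fock--Sobolev space as a weighted Fock space\<close>

definition fock_mass :: "nat \<Rightarrow> real \<Rightarrow> real \<Rightarrow> (complex^'n \<Rightarrow> complex) \<Rightarrow> ennreal" where
  "fock_mass k \<alpha> p f = (\<integral>\<^sup>+z. ennreal (fock_mod k \<alpha> f z powr p) \<partial>lborel)"

lemma nn_integral_le_if_cball:
  fixes h :: "'a::euclidean_space \<Rightarrow> ennreal"
  assumes [measurable]: "h \<in> borel_measurable borel"
    and le: "\<And>R::nat. (\<integral>\<^sup>+z. h z * indicator (cball 0 (real R)) z \<partial>lborel) \<le> B"
  shows "(\<integral>\<^sup>+z. h z \<partial>lborel) \<le> B"
proof -
  have [measurable]: "cball (0::'a) r \<in> sets borel" for r by simp
  have "(\<integral>\<^sup>+z. h z \<partial>lborel) = (\<integral>\<^sup>+z. (SUP R::nat. h z * indicator (cball 0 (real R)) z) \<partial>lborel)"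
  proof (rule nn_integral_cong)
    fix z :: 'a
    obtain R :: nat where R: "norm z \<le> real R" using real_arch_simple by blast
    show "h z = (SUP R::nat. h z * indicator (cball 0 (real R)) z)"
    proof (rule antisym)
      show "h z \<le> (SUP R::nat. h z * indicator (cball 0 (real R)) z)"
        by (rule SUP_upper2[of R]) (use R in simp_all)
    qed (auto intro!: SUP_least simp: indicator_def)
  qed
  also have "\<dots> = (SUP R::nat. \<integral>\<^sup>+z. h z * indicator (cball 0 (real R)) z \<partial>lborel)"
    by (rule nn_integral_monotone_convergence_SUP)
       (auto simp: incseq_def le_fun_def indicator_def borel_measurable_times_ennreal)
  also have "\<dots> \<le> B" by (rule SUP_least) (rule le)
  finally show ?thesis .
qed

lemma nn_integral_cball_finite:
  fixes g :: "'a::euclidean_space \<Rightarrow> real"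
  assumes "continuous_on UNIV g"
  shows "(\<integral>\<^sup>+z. ennreal (g z) * indicator (cball a R) z \<partial>lborel) < \<infinity>"
proof -
  have "compact (g ` cball a R)"
    by (rule compact_continuous_image[OF continuous_on_subset[OF assms]]) auto
  then obtain B where B: "\<And>z. z \<in> cball a R \<Longrightarrow> norm (g z) \<le> B"
    using compact_imp_bounded bounded_iff by (metis imageI)
  have "(\<integral>\<^sup>+z. ennreal (g z) * indicator (cball a R) z \<partial>lborel) \<le> (\<integral>\<^sup>+z. ennreal B * indicator (cball a R) z \<partial>lborel)"
    using B by (intro nn_integral_mono) (force simp: indicator_def intro!: ennreal_leI)
  also have "\<dots> = ennreal B * emeasure lborel (cball a R)" by (rule nn_integral_cmult_indicator) simp
  also have "\<dots> < \<infinity>"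
    using emeasure_lborel_cball_finite[of a R] by (simp add: ennreal_mult_less_top)
  finally show ?thesis .
qed

lemma powr_sum_le:
  fixes x :: "'i \<Rightarrow> real"
  assumes "finite A" "0 < p" "\<And>i. i \<in> A \<Longrightarrow> 0 \<le> x i"
  shows "(\<Sum>i\<in>A. x i) powr p \<le> real (card A) powr p * (\<Sum>i\<in>A. x i powr p)"
proof (cases "A = {}")
  case False
  define m where "m = Max (x ` A)"
  have "m \<in> x ` A" unfolding m_def using assms False by (intro Max_in) auto
  then obtain i where i: "i \<in> A" "m = x i" by auto
  have "(\<Sum>i\<in>A. x i) \<le> real (card A) * m"
    using sum_bounded_above[of A x m] assms by (auto simp: m_def)
  then have "(\<Sum>i\<in>A. x i) powr p \<le> (real (card A) * m) powr p"
    using assms by (intro powr_mono2) (auto intro: sum_nonneg)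
  also have "\<dots> = real (card A) powr p * x i powr p"
    using assms(3)[OF i(1)] i by (simp add: powr_mult)
  also have "\<dots> \<le> real (card A) powr p * (\<Sum>i\<in>A. x i powr p)"
    using i assms by (intro mult_left_mono member_le_sum) auto
  finally show ?thesis .
qed simp

lemma fock_mod_le_imp:
  assumes "fock_mod k \<alpha> f b \<le> Y"
  shows "norm (f b) \<le> Y * exp (\<alpha> / 2 * (norm b)\<^sup>2) / (1 + norm b) ^ k"
proof -
  have pos: "0 < (1 + norm b) ^ k" by (intro zero_less_power) (simp add: add_pos_nonneg)
  have "norm (f b) = fock_mod k \<alpha> f b * exp (\<alpha> / 2 * (norm b)\<^sup>2) / (1 + norm b) ^ k"
  proof -
    have "1 + norm b \<noteq> 0" using norm_ge_zero[of b] by linarith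
    then show ?thesis by (simp add: fock_mod_def mult.assoc flip: exp_add)
  qed
  also have "\<dots> \<le> Y * exp (\<alpha> / 2 * (norm b)\<^sup>2) / (1 + norm b) ^ k"
    using assms pos by (intro divide_right_mono mult_right_mono) auto
  finally show ?thesis .
qed

text \<open>The set \<open>E\<close> is independent of \<open>b\<close>, so the bound is uniform over the points \<open>b\<close> of a circle or a
  segment whose small balls lie in \<open>E\<close>.\<close>

lemma fock_mod_le_local_mean:
  fixes f :: "complex^'n \<Rightarrow> complex" and a b :: "complex^'n"
  assumes p: "0 < (p::real)"
    and C: "0 < C" "ennreal (fock_mod k \<alpha> f b powr p * r ^ DIM(complex^'n)) \<le>
     ennreal C * (\<integral>\<^sup>+w. ennreal (fock_mod k \<alpha> f w powr p) * indicator (ball b r) w \<partial>lborel)"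
    and r: "0 < r"
    and J: "(\<integral>\<^sup>+w. ennreal (fock_mod k \<alpha> f w powr p) * indicator E w \<partial>lborel) \<le> ennreal J" "0 \<le> J" "ball b r \<subseteq> E"
  shows "fock_mod k \<alpha> f b \<le> (C * J / r ^ DIM(complex^'n)) powr (1 / p)"
proof -
  have "ennreal (fock_mod k \<alpha> f b powr p * r ^ DIM(complex^'n)) \<le> ennreal C * ennreal J"
    by (rule order_trans[OF C(2)], intro mult_left_mono order_trans[OF _ J(1)] nn_integral_mono)
       (use J(3) in \<open>auto simp: indicator_def\<close>)
  then have "fock_mod k \<alpha> f b powr p * r ^ DIM(complex^'n) \<le> C * J"
    using C(1) J(2) by (simp add: ennreal_mult[symmetric] del: ennreal_mult)
  then have "fock_mod k \<alpha> f b powr p \<le> C * J / r ^ DIM(complex^'n)"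
    using r by (simp add: field_simps)
  then have "(fock_mod k \<alpha> f b powr p) powr (1 / p) \<le> (C * J / r ^ DIM(complex^'n)) powr (1 / p)"
    using p by (intro powr_mono2) auto
  then show ?thesis using p by (simp add: powr_powr)
qed

text \<open>Cauchy's estimate on a circle of radius comparable to \<open>1 / (1 + |a|)\<close> costs one factor
  \<open>1 + |a|\<close>, which raises the weight from \<open>k\<close> to \<open>Suc k\<close>; on this scale the Gaussian
  \<open>exp (- \<alpha> |b|\<^sup>2 / 2)\<close> changes by a bounded factor only.\<close>

lemma cpartial_fock_mod_le:
  assumes p: "0 < (p::real)" and \<alpha>: "0 < \<alpha>"
  obtains C where "0 < C" "\<And>(f :: complex^'n \<Rightarrow> complex) a j. entire f \<Longrightarrow>
     ennreal (fock_mod k \<alpha> (cpartial j f) a powr p) \<le>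
     ennreal ((1 + norm a) ^ DIM(complex^'n)) *
       (\<integral>\<^sup>+w. (ennreal C * ennreal (fock_mod (Suc k) \<alpha> f w powr p)) * indicator (ball a (1 / (1 + norm a))) w \<partial>lborel)"
proof -
  let ?N = "DIM(complex^'n)"
  obtain C where C: "0 < C" "\<And>(f :: complex^'n \<Rightarrow> complex) a r. entire f \<Longrightarrow> 0 < r \<Longrightarrow> r \<le> 1 \<Longrightarrow>
     ennreal (fock_mod (Suc k) \<alpha> f a powr p * r ^ ?N) \<le>
     ennreal C * (\<integral>\<^sup>+w. ennreal (fock_mod (Suc k) \<alpha> f w powr p) * indicator (ball a r) w \<partial>lborel)"
    using fock_mod_mean_le[OF p \<alpha>, of "Suc k"] by blast
  define K where "K = exp \<alpha> * 2 ^ (k + 2)"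
  have K: "K > 0" by (simp add: K_def)
  show ?thesis
  proof (rule that[of "K powr p * C * 2 ^ ?N"])
    show "0 < K powr p * C * 2 ^ ?N" using K C(1) by simp
    fix f :: "complex^'n \<Rightarrow> complex" and a :: "complex^'n" and j assume f: "entire f"
    note [measurable] = entire_measurable[OF f]
    let ?I = "\<integral>\<^sup>+w. ennreal (fock_mod (Suc k) \<alpha> f w powr p) * indicator (ball a (1 / (1 + norm a))) w \<partial>lborel"
    have pos: "0 < 1 + norm a" by (simp add: add_pos_nonneg)
    have goal: "ennreal (fock_mod k \<alpha> (cpartial j f) a powr p) \<le> ennreal (K powr p * C * 2 ^ ?N * (1 + norm a) ^ ?N) * ?I"
    proof (cases "?I = \<infinity>")
      case True
      have "0 < K powr p * C * 2 ^ ?N * (1 + norm a) ^ ?N" using K C(1) pos by simp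
      then have "ennreal (K powr p * C * 2 ^ ?N * (1 + norm a) ^ ?N) \<noteq> 0"
        by (simp only: ennreal_eq_0_iff not_le)
      then show ?thesis unfolding True by (simp only: infinity_ennreal_def ennreal_mult_top if_False top_greatest)
    next
      case False
      then obtain i where i: "?I = ennreal i" "0 \<le> i" by (cases ?I) auto
      \<comment> \<open>Half the radius, so that balls of radius \<open>r\<close> around the circle stay in the given ball.\<close>
      define r where "r = 1 / (2 * (1 + norm a))"
      have r: "0 < r" "r \<le> 1" "r * (1 + norm a) = 1 / 2" using pos by (auto simp: r_def field_simps)
      have rd: "1 / (1 + norm a) = 2 * r" using pos by (simp add: r_def field_simps)
      define Y where "Y = (C * i / r ^ ?N) powr (1 / p)"
      have Y0: "0 \<le> Y" by (simp add: Y_def)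
      have fb: "norm (f (a + axis j t)) \<le> Y * (exp (\<alpha> / 2 * (norm a)\<^sup>2) * exp \<alpha>) * 2 ^ Suc k / (1 + norm a) ^ Suc k"
        if t: "norm t = r" for t
      proof -
        let ?b = "a + axis j t"
        have nb: "norm (?b - a) = r" by (simp add: norm_axis_complex t)
        have "ball ?b r \<subseteq> ball a (1 / (1 + norm a))"
        proof
          fix w assume "w \<in> ball ?b r"
          then have "dist ?b w < r" by simp
          moreover have "dist a ?b = r" using nb by (simp add: dist_norm norm_minus_commute)
          ultimately have "dist a w < 2 * r" using dist_triangle[of a w ?b] by argo
          then show "w \<in> ball a (1 / (1 + norm a))" unfolding rd by simp
        qed
        then have "fock_mod (Suc k) \<alpha> f ?b \<le> Y"
          unfolding Y_def using i by (intro fock_mod_le_local_mean[OF p C(1) C(2)[OF f r(1,2)] r(1)]) auto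
        then have 1: "norm (f ?b) \<le> Y * exp (\<alpha> / 2 * (norm ?b)\<^sup>2) / (1 + norm ?b) ^ Suc k"
          by (rule fock_mod_le_imp)
        have nb1: "norm ?b \<le> norm a + r" "norm a \<le> norm ?b + r"
          using norm_triangle_sub[of ?b a] norm_triangle_sub[of a ?b] nb norm_minus_commute[of a ?b] by argo+
        have "(norm ?b)\<^sup>2 \<le> (norm a + r)\<^sup>2" using nb1 by (intro power_mono) auto
        also have "\<dots> \<le> (norm a)\<^sup>2 + 2"
        proof -
          have "r * norm a \<le> 1 / 2" using r(1,3) by (simp add: algebra_simps)
          moreover have "r\<^sup>2 \<le> 1" using r by (simp add: power_le_one)
          ultimately show ?thesis by (simp add: power2_sum algebra_simps)
        qed
        finally have "\<alpha> / 2 * (norm ?b)\<^sup>2 \<le> \<alpha> / 2 * (norm a)\<^sup>2 + \<alpha>"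
          using mult_left_mono[of "(norm ?b)\<^sup>2" "(norm a)\<^sup>2 + 2" "\<alpha> / 2"] \<alpha> by (simp add: distrib_left)
        then have e: "exp (\<alpha> / 2 * (norm ?b)\<^sup>2) \<le> exp (\<alpha> / 2 * (norm a)\<^sup>2) * exp \<alpha>"
          by (simp flip: exp_add)
        have "1 + norm a \<le> 2 * (1 + norm ?b)" using nb1(2) r(2) norm_ge_zero[of ?b] by argo
        then have d: "(1 + norm a) ^ Suc k \<le> 2 ^ Suc k * (1 + norm ?b) ^ Suc k"
          using power_mono[of "1 + norm a" "2 * (1 + norm ?b)" "Suc k"] pos unfolding power_mult_distrib by simp
        have posb: "0 < (1 + norm ?b) ^ Suc k" by (intro zero_less_power) (simp add: add_pos_nonneg)
        have posa: "0 < (1 + norm a) ^ Suc k" using pos by simp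
        have inv: "1 / (1 + norm ?b) ^ Suc k \<le> 2 ^ Suc k / (1 + norm a) ^ Suc k"
          using d posa posb by (simp add: divide_simps mult_ac del: power_Suc)
        have "Y * exp (\<alpha> / 2 * (norm ?b)\<^sup>2) / (1 + norm ?b) ^ Suc k
            = Y * exp (\<alpha> / 2 * (norm ?b)\<^sup>2) * (1 / (1 + norm ?b) ^ Suc k)" by simp
        also have "\<dots> \<le> Y * (exp (\<alpha> / 2 * (norm a)\<^sup>2) * exp \<alpha>) * (2 ^ Suc k / (1 + norm a) ^ Suc k)"
          using Y0 posb by (intro mult_mono mult_left_mono e inv) auto
        finally show ?thesis using 1 by simp
      qed
      have "norm (cpartial j f a) \<le> Y * (exp (\<alpha> / 2 * (norm a)\<^sup>2) * exp \<alpha>) * 2 ^ Suc k / (1 + norm a) ^ Suc k / r"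
        by (rule cpartial_bound[OF f r(1) fb])
      also have "\<dots> = Y * K * exp (\<alpha> / 2 * (norm a)\<^sup>2) / (1 + norm a) ^ k"
      proof -
        have "Y * (E * e) * 2 ^ Suc k / A ^ Suc k / (1 / (2 * A)) = Y * (e * 2 ^ (k + 2)) * E / A ^ k"
          if "0 < A" for A E e :: real using that by (simp add: field_simps)
        from this[OF pos] show ?thesis unfolding r_def K_def .
      qed
      finally have "fock_mod k \<alpha> (cpartial j f) a \<le> (1 + norm a) ^ k * (Y * K * exp (\<alpha> / 2 * (norm a)\<^sup>2) / (1 + norm a) ^ k) * exp (- (\<alpha> / 2) * (norm a)\<^sup>2)"
        unfolding fock_mod_def using pos by (intro mult_right_mono mult_left_mono) auto
      also have "\<dots> = Y * K"
      proof -
        have "A * (Y * K * E / A) * e = Y * K * (E * e)" if "0 < A" for A E e :: real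
          using that by simp
        from this[of "(1 + norm a) ^ k"] pos show ?thesis by (simp flip: exp_add)
      qed
      finally have "fock_mod k \<alpha> (cpartial j f) a powr p \<le> (Y * K) powr p" using p by (intro powr_mono2) auto
      also have "\<dots> = C * i / r ^ ?N * K powr p"
        using K p C(1) i r by (simp add: Y_def powr_mult powr_powr)
      also have "\<dots> = K powr p * C * 2 ^ ?N * (1 + norm a) ^ ?N * i"
      proof -
        have "C * i / (1 / (2 * A)) ^ ?N * K powr p = K powr p * C * 2 ^ ?N * A ^ ?N * i"
          for A :: real by (simp add: power_one_over power_mult_distrib mult_ac)
        then show ?thesis unfolding r_def .
      qed
      finally show ?thesis using i K C(1) pos by (simp add: ennreal_mult[symmetric] ennreal_leI)
    qed
    also have "ennreal (K powr p * C * 2 ^ ?N * (1 + norm a) ^ ?N) = ennreal ((1 + norm a) ^ ?N) * ennreal (K powr p * C * 2 ^ ?N)"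
      using K C(1) pos by (subst ennreal_mult[symmetric]) (auto simp: mult_ac)
    also have "\<dots> * ?I = ennreal ((1 + norm a) ^ ?N) *
       (\<integral>\<^sup>+w. (ennreal (K powr p * C * 2 ^ ?N) * ennreal (fock_mod (Suc k) \<alpha> f w powr p)) * indicator (ball a (1 / (1 + norm a))) w \<partial>lborel)"
      unfolding mult.assoc by (subst nn_integral_cmult) (auto intro!: borel_measurable_times_ennreal borel_measurable_indicator)
    finally show "ennreal (fock_mod k \<alpha> (cpartial j f) a powr p) \<le> ennreal ((1 + norm a) ^ ?N) *
       (\<integral>\<^sup>+w. (ennreal (K powr p * C * 2 ^ ?N) * ennreal (fock_mod (Suc k) \<alpha> f w powr p)) * indicator (ball a (1 / (1 + norm a))) w \<partial>lborel)" .
  qed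
qed

lemma fock_mass_cpartial_finite:
  fixes f :: "complex^'n \<Rightarrow> complex"
  assumes p: "0 < (p::real)" and \<alpha>: "0 < \<alpha>" and f: "entire f" and fin: "fock_mass (Suc k) \<alpha> p f < \<infinity>"
  shows "fock_mass k \<alpha> p (cpartial j f) < \<infinity>"
proof -
  let ?N = "DIM(complex^'n)"
  note [measurable] = entire_measurable[OF f]
  obtain C where C: "0 < C" "\<And>(f :: complex^'n \<Rightarrow> complex) a j. entire f \<Longrightarrow>
     ennreal (fock_mod k \<alpha> (cpartial j f) a powr p) \<le>
     ennreal ((1 + norm a) ^ ?N) *
       (\<integral>\<^sup>+w. (ennreal C * ennreal (fock_mod (Suc k) \<alpha> f w powr p)) * indicator (ball a (1 / (1 + norm a))) w \<partial>lborel)"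
    using cpartial_fock_mod_le[OF p \<alpha>, of k] by blast
  have "(\<integral>\<^sup>+a. ennreal (fock_mod k \<alpha> (cpartial j f) a powr p) * indicator UNIV a \<partial>lborel)
     \<le> ennreal ((4 * 1) ^ ?N * unit_ball_vol ?N) * (\<integral>\<^sup>+w. ennreal C * ennreal (fock_mod (Suc k) \<alpha> f w powr p) \<partial>lborel)"
    by (rule local_average_integral) (use C(2)[OF f] in auto)
  also have "\<dots> = ennreal ((4 * 1) ^ ?N * unit_ball_vol ?N) * (ennreal C * fock_mass (Suc k) \<alpha> p f)"
    unfolding fock_mass_def by (subst nn_integral_cmult) auto
  also have "\<dots> < \<infinity>" using fin by (simp add: ennreal_mult_less_top)
  finally show ?thesis by (simp add: fock_mass_def)
qed

text \<open>Moving from \<open>z\<close> towards the origin by \<open>s / |z|\<close> decreases \<open>|z|\<^sup>2\<close> by at least \<open>s\<close>, so the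
  Gaussian gains the factor \<open>exp (- \<alpha> s / 2)\<close>; the increment of \<open>f\<close> is controlled by its
  derivatives, with the factor \<open>s / |z|\<close> that lowers the weight by one.\<close>

lemma radial_step:
  fixes f :: "complex^'n \<Rightarrow> complex" and z :: "complex^'n"
  assumes f: "entire f" and \<alpha>: "0 < \<alpha>" and s: "1 \<le> s" "2 * s \<le> norm z"
    and Y0: "fock_mod (Suc k) \<alpha> f ((1 - s / (norm z)\<^sup>2) *\<^sub>R z) \<le> Y0"
    and Y: "\<And>c j. 1 - s / (norm z)\<^sup>2 \<le> c \<Longrightarrow> c \<le> 1 \<Longrightarrow> fock_mod k \<alpha> (cpartial j f) (c *\<^sub>R z) \<le> Y j"
  shows "fock_mod (Suc k) \<alpha> f z \<le> 2 ^ Suc k * exp (- (\<alpha> * s / 2)) * Y0 + s * 2 ^ Suc k * (\<Sum>j\<in>UNIV. Y j)"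
proof -
  let ?c = "1 - s / (norm z)\<^sup>2"
  let ?z = "?c *\<^sub>R z"
  have z0: "0 < norm z" using s by linarith
  have sz: "s / (norm z)\<^sup>2 \<le> 1 / 2" "0 \<le> s / (norm z)\<^sup>2"
  proof -
    have "2 * s * 1 \<le> norm z * norm z" using s by (intro mult_mono) linarith+
    then show "s / (norm z)\<^sup>2 \<le> 1 / 2" using z0 by (simp add: power2_eq_square field_simps)
    show "0 \<le> s / (norm z)\<^sup>2" using s by simp
  qed
  have c0: "1 / 2 \<le> ?c" "?c \<le> 1" using sz by argo+
  have pos: "0 < 1 + norm z" "0 < 1 + norm ?z" by (simp_all add: add_pos_nonneg)
  define E where "E = exp (\<alpha> / 2 * (norm z)\<^sup>2)"
  have E0: "0 < E" by (simp add: E_def)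
  have half: "1 + norm z \<le> 2 * (1 + norm (c *\<^sub>R z))" if "1 / 2 \<le> c" for c
  proof -
    have "1 / 2 * norm z \<le> c * norm z" using that by (intro mult_right_mono) auto
    then show ?thesis using that by simp
  qed
  have inv: "1 / (1 + norm (c *\<^sub>R z)) ^ l \<le> 2 ^ l / (1 + norm z) ^ l" if "1 / 2 \<le> c" for c l
  proof -
    have "(1 + norm z) ^ l \<le> 2 ^ l * (1 + norm (c *\<^sub>R z)) ^ l"
      using power_mono[OF half[OF that], of l] pos unfolding power_mult_distrib by simp
    moreover have "0 < (1 + norm (c *\<^sub>R z)) ^ l" by (intro zero_less_power) (simp add: add_pos_nonneg)
    moreover have "0 < (1 + norm z) ^ l" using pos by simp
    ultimately show ?thesis by (simp add: divide_simps mult_ac)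
  qed
  define B where "B = E * (2 ^ k / (1 + norm z) ^ k) * (\<Sum>j\<in>UNIV. Y j)"
  have Y_nonneg: "0 \<le> Y j" for j
    using order_trans[OF fock_mod_nonneg Y[of 1 j]] sz by simp
  have dj: "norm (cpartial j f (c *\<^sub>R z)) \<le> E * (2 ^ k / (1 + norm z) ^ k) * Y j"
    if c: "?c \<le> c" "c \<le> 1" for c j
  proof -
    have c': "1 / 2 \<le> c" using c0 c by linarith
    have "norm (c *\<^sub>R z) \<le> norm z" using c c' by (simp add: mult_left_le_one_le)
    then have "(norm (c *\<^sub>R z))\<^sup>2 \<le> (norm z)\<^sup>2" by (intro power_mono) auto
    then have e: "exp (\<alpha> / 2 * (norm (c *\<^sub>R z))\<^sup>2) \<le> E" using \<alpha> unfolding E_def by simp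
    have "norm (cpartial j f (c *\<^sub>R z)) \<le> Y j * exp (\<alpha> / 2 * (norm (c *\<^sub>R z))\<^sup>2) / (1 + norm (c *\<^sub>R z)) ^ k"
      by (rule fock_mod_le_imp[OF Y[OF c]])
    also have "\<dots> = Y j * exp (\<alpha> / 2 * (norm (c *\<^sub>R z))\<^sup>2) * (1 / (1 + norm (c *\<^sub>R z)) ^ k)" by simp
    also have "\<dots> \<le> Y j * E * (2 ^ k / (1 + norm z) ^ k)"
      using Y_nonneg E0 by (intro mult_mono mult_left_mono e inv[OF c']) auto
    finally show ?thesis by (simp add: mult_ac)
  qed
  have "norm (f z - f ?z) \<le> B * norm (z - ?z)"
  proof (rule differentiable_bound[where S = "(\<lambda>c. c *\<^sub>R z) ` {?c..1}" and f' = "\<lambda>\<zeta> v. \<Sum>j\<in>UNIV. v $ j * cpartial j f \<zeta>"])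
    show "convex ((\<lambda>c. c *\<^sub>R z) ` {?c..1})"
      by (intro convex_linear_image) (auto intro: linear_scaleR_left)
    show "(f has_derivative (\<lambda>v. \<Sum>j\<in>UNIV. v $ j * cpartial j f \<zeta>)) (at \<zeta> within (\<lambda>c. c *\<^sub>R z) ` {?c..1})" for \<zeta>
      by (rule has_derivative_at_withinI[OF entire_has_derivative[OF f]])
    show "onorm (\<lambda>v. \<Sum>j\<in>UNIV. v $ j * cpartial j f \<zeta>) \<le> B" if \<zeta>: "\<zeta> \<in> (\<lambda>c. c *\<^sub>R z) ` {?c..1}" for \<zeta>
    proof (rule onorm_le)
      fix v :: "complex^'n"
      from \<zeta> obtain c where "\<zeta> = c *\<^sub>R z" "c \<in> {?c..1}" by (rule imageE)
      then have c: "\<zeta> = c *\<^sub>R z" "?c \<le> c" "c \<le> 1" by auto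
      have "norm (\<Sum>j\<in>UNIV. v $ j * cpartial j f \<zeta>) \<le> (\<Sum>j\<in>UNIV. norm v * (E * (2 ^ k / (1 + norm z) ^ k) * Y j))"
      proof (rule sum_norm_le)
        fix j :: 'n
        show "norm (v $ j * cpartial j f \<zeta>) \<le> norm v * (E * (2 ^ k / (1 + norm z) ^ k) * Y j)"
          unfolding c(1) norm_mult
          by (rule mult_mono[OF Finite_Cartesian_Product.norm_nth_le dj[OF c(2,3)]]) auto
      qed
      also have "\<dots> = B * norm v" by (simp add: B_def sum_distrib_left sum_distrib_right sum_divide_distrib mult_ac)
      finally show "norm (\<Sum>j\<in>UNIV. v $ j * cpartial j f \<zeta>) \<le> B * norm v" .
    qed
    show "z \<in> (\<lambda>c. c *\<^sub>R z) ` {?c..1}" using c0 by (intro image_eqI[of _ _ 1]) auto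
    show "?z \<in> (\<lambda>c. c *\<^sub>R z) ` {?c..1}" using c0 by (intro image_eqI[of _ _ ?c]) auto
  qed
  also have "norm (z - ?z) = s / norm z"
  proof -
    have "z - ?z = (s / (norm z)\<^sup>2) *\<^sub>R z" by (simp add: algebra_simps)
    then have "norm (z - ?z) = s / (norm z)\<^sup>2 * norm z" using s by simp
    then show ?thesis using z0 by (simp add: power2_eq_square)
  qed
  finally have fz: "norm (f z) \<le> norm (f ?z) + B * (s / norm z)"
    using norm_triangle_sub[of "f z" "f ?z"] by linarith
  have zz: "(norm z)\<^sup>2 - (norm ?z)\<^sup>2 \<ge> s"
  proof -
    have "(norm ?z)\<^sup>2 = ?c\<^sup>2 * (norm z)\<^sup>2" using c0 by (simp add: power_mult_distrib)
    also have "\<dots> \<le> ?c * (norm z)\<^sup>2"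
    proof (rule mult_right_mono)
      have "0 \<le> ?c" using c0(1) by argo
      with c0(2) have "?c * ?c \<le> 1 * ?c" by (rule mult_right_mono)
      then show "?c\<^sup>2 \<le> ?c" by (simp only: power2_eq_square mult_1_left)
    qed simp
    also have "\<dots> = (norm z)\<^sup>2 - s" using z0 by (simp add: field_simps)
    finally show ?thesis by simp
  qed
  have fzz: "norm (f ?z) \<le> Y0 * (E * exp (- (\<alpha> * s / 2))) * (2 ^ Suc k / (1 + norm z) ^ Suc k)"
  proof -
    have "\<alpha> / 2 * s \<le> \<alpha> / 2 * ((norm z)\<^sup>2 - (norm ?z)\<^sup>2)" using zz \<alpha> by (intro mult_left_mono) auto
    then have e: "exp (\<alpha> / 2 * (norm ?z)\<^sup>2) \<le> E * exp (- (\<alpha> * s / 2))"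
      unfolding E_def exp_add[symmetric] by (simp add: algebra_simps)
    have "norm (f ?z) \<le> Y0 * exp (\<alpha> / 2 * (norm ?z)\<^sup>2) / (1 + norm ?z) ^ Suc k"
      by (rule fock_mod_le_imp[OF Y0])
    also have "\<dots> = Y0 * exp (\<alpha> / 2 * (norm ?z)\<^sup>2) * (1 / (1 + norm ?z) ^ Suc k)" by simp
    also have "\<dots> \<le> Y0 * (E * exp (- (\<alpha> * s / 2))) * (2 ^ Suc k / (1 + norm z) ^ Suc k)"
      using order_trans[OF fock_mod_nonneg Y0] E0 by (intro mult_mono mult_left_mono e inv[OF c0(1)]) auto
    finally show ?thesis .
  qed
  have EE: "E * exp (- (\<alpha> / 2) * (norm z)\<^sup>2) = 1" by (simp add: E_def flip: exp_add)
  define A where "A = 1 + norm z"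
  define e where "e = exp (- (\<alpha> / 2) * (norm z)\<^sup>2)"
  have A: "0 < A" using pos by (simp add: A_def)
  have e0: "0 \<le> e" by (simp add: e_def)
  have "fock_mod (Suc k) \<alpha> f z = A ^ Suc k * norm (f z) * e" by (simp add: fock_mod_def A_def e_def)
  also have "\<dots> \<le> A ^ Suc k * (Y0 * (E * exp (- (\<alpha> * s / 2))) * (2 ^ Suc k / A ^ Suc k) +
     E * (2 ^ k / A ^ k) * (\<Sum>j\<in>UNIV. Y j) * (s / norm z)) * e"
    using fz fzz A e0 unfolding B_def A_def by (intro mult_right_mono mult_left_mono) (auto simp del: power_Suc)
  also have "\<dots> = (E * e) * (2 ^ Suc k * exp (- (\<alpha> * s / 2)) * Y0 + A / norm z * (s * 2 ^ k * (\<Sum>j\<in>UNIV. Y j)))"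
    using A z0 by (simp add: field_simps)
  also have "E * e = 1" using EE by (simp add: e_def)
  also have "A / norm z * (s * 2 ^ k * (\<Sum>j\<in>UNIV. Y j)) \<le> 2 * (s * 2 ^ k * (\<Sum>j\<in>UNIV. Y j))"
  proof (rule mult_right_mono)
    show "A / norm z \<le> 2" using s z0 by (simp add: A_def field_simps)
    show "0 \<le> s * 2 ^ k * (\<Sum>j\<in>UNIV. Y j)" using s Y_nonneg by (intro mult_nonneg_nonneg sum_nonneg) auto
  qed
  finally show ?thesis by (simp add: mult_ac)
qed

lemma powr_add_le:
  assumes "0 < p" "0 \<le> (a::real)" "0 \<le> b"
  shows "(a + b) powr p \<le> 2 powr p * (a powr p + b powr p)"
proof -
  have "(a + b) powr p \<le> (2 * max a b) powr p" using assms by (intro powr_mono2) auto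
  also have "\<dots> = 2 powr p * max a b powr p" using assms by (simp add: powr_mult)
  also have "\<dots> \<le> 2 powr p * (a powr p + b powr p)" by (intro mult_left_mono) (auto simp: max_def)
  finally show ?thesis .
qed

lemma fock_mod_powr_ball_finite:
  fixes f :: "complex^'n \<Rightarrow> complex"
  assumes "entire f" "0 < p"
  shows "(\<integral>\<^sup>+w. ennreal (fock_mod k \<alpha> f w powr p) * indicator (cball a R) w \<partial>lborel) < \<infinity>"
  by (rule nn_integral_cball_finite)
     (use assms in \<open>auto intro!: continuous_on_powr' fock_mod_continuous continuous_on_const\<close>)

text \<open>The values at the points of the segment are replaced by local means. Moving inwards by
  \<open>s / |z| \<ge> 1 / (1 + |z|)\<close> keeps the ball around the end point within \<open>|w| \<le> R\<close>, so
  the means of \<open>f\<close> itself are truncated at the same radius as the point \<open>z\<close>; this is what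
  allows absorption later on. The radius \<open>(2 s + 1) / (1 + |z|)\<close> covers the balls around
  all points of the segment.\<close>

lemma fock_mod_Suc_le_local_mean:
  assumes p: "0 < (p::real)" and \<alpha>: "0 < \<alpha>"
  obtains C D where "0 < C" "\<And>s. 0 \<le> D s" "\<And>(f :: complex^'n \<Rightarrow> complex) z s R. entire f \<Longrightarrow> 1 \<le> s \<Longrightarrow> 2 * s \<le> norm z \<Longrightarrow> norm z \<le> R \<Longrightarrow>
     ennreal (fock_mod (Suc k) \<alpha> f z powr p) \<le> ennreal ((1 + norm z) ^ DIM(complex^'n)) *
       (\<integral>\<^sup>+w. (ennreal (C * exp (- (\<alpha> * s * p / 2))) * (ennreal (fock_mod (Suc k) \<alpha> f w powr p) * indicator (cball 0 R) w) +
             ennreal (D s) * (\<Sum>j\<in>UNIV. ennreal (fock_mod k \<alpha> (cpartial j f) w powr p))) *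
             indicator (ball z ((2 * s + 1) / (1 + norm z))) w \<partial>lborel)"
proof -
  let ?N = "DIM(complex^'n)" and ?n = "real CARD('n)"
  obtain C where C: "0 < C" "\<And>(f :: complex^'n \<Rightarrow> complex) a r. entire f \<Longrightarrow> 0 < r \<Longrightarrow> r \<le> 1 \<Longrightarrow>
     ennreal (fock_mod (Suc k) \<alpha> f a powr p * r ^ ?N) \<le>
     ennreal C * (\<integral>\<^sup>+w. ennreal (fock_mod (Suc k) \<alpha> f w powr p) * indicator (ball a r) w \<partial>lborel)"
    using fock_mod_mean_le[OF p \<alpha>, of "Suc k"] by blast
  obtain C' where C': "0 < C'" "\<And>(f :: complex^'n \<Rightarrow> complex) a r. entire f \<Longrightarrow> 0 < r \<Longrightarrow> r \<le> 1 \<Longrightarrow>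
     ennreal (fock_mod k \<alpha> f a powr p * r ^ ?N) \<le>
     ennreal C' * (\<integral>\<^sup>+w. ennreal (fock_mod k \<alpha> f w powr p) * indicator (ball a r) w \<partial>lborel)"
    using fock_mod_mean_le[OF p \<alpha>, of k] by blast
  define Q where "Q = 2 powr p * (2 ^ Suc k) powr p * C"
  define D where "D = (\<lambda>s. 2 powr p * (s * 2 ^ Suc k) powr p * ?n powr p * C')"
  show ?thesis
  proof (rule that[of Q D])
    show "0 < Q" using C(1) by (simp add: Q_def)
    show D0: "0 \<le> D s" for s using C'(1) by (simp add: D_def)
    fix f :: "complex^'n \<Rightarrow> complex" and z :: "complex^'n" and s R :: real
    assume f: "entire f" and s: "1 \<le> s" "2 * s \<le> norm z" and zR: "norm z \<le> R"
    note [measurable] = entire_measurable[OF f] entire_measurable[OF entire_cpartial[OF f]]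
    define r where "r = 1 / (1 + norm z)"
    define \<rho> where "\<rho> = (2 * s + 1) / (1 + norm z)"
    have z0: "0 < norm z" using s by linarith
    have pos: "0 < 1 + norm z" by (simp add: add_pos_nonneg)
    have r: "0 < r" "r \<le> 1" using pos by (auto simp: r_def)
    have \<rho>1: "\<rho> \<le> 1" using s pos by (simp add: \<rho>_def)
    have sr: "s / norm z + r \<le> \<rho>"
    proof -
      have "s * (1 + norm z) \<le> 2 * s * norm z" using s z0 by (simp add: algebra_simps)
      then have "s / norm z \<le> 2 * s / (1 + norm z)" using z0 pos by (simp add: divide_simps mult_ac)
      then show ?thesis by (simp add: r_def \<rho>_def add_divide_distrib)
    qed
    let ?E = "ball z \<rho> \<inter> cball 0 R"
    have fin: "(\<integral>\<^sup>+w. ennreal (fock_mod k' \<alpha> g w powr p) * indicator A w \<partial>lborel) < \<infinity>"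
      if "entire g" "A \<subseteq> cball z 1" for g :: "complex^'n \<Rightarrow> complex" and k' A
      by (rule le_less_trans[OF nn_integral_mono fock_mod_powr_ball_finite[OF that(1) p, of k' \<alpha> z 1]])
         (use that(2) in \<open>auto simp: indicator_def\<close>)
    have "(\<integral>\<^sup>+w. ennreal (fock_mod (Suc k) \<alpha> f w powr p) * indicator ?E w \<partial>lborel) < \<infinity>"
      by (rule fin[OF f]) (use \<rho>1 in auto)
    then obtain i where i: "(\<integral>\<^sup>+w. ennreal (fock_mod (Suc k) \<alpha> f w powr p) * indicator ?E w \<partial>lborel) = ennreal i" "0 \<le> i"
      by (cases "\<integral>\<^sup>+w. ennreal (fock_mod (Suc k) \<alpha> f w powr p) * indicator ?E w \<partial>lborel") auto
    have "\<exists>x\<ge>0. (\<integral>\<^sup>+w. ennreal (fock_mod k \<alpha> (cpartial j f) w powr p) * indicator (ball z \<rho>) w \<partial>lborel) = ennreal x" for j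
    proof -
      have "(\<integral>\<^sup>+w. ennreal (fock_mod k \<alpha> (cpartial j f) w powr p) * indicator (ball z \<rho>) w \<partial>lborel) < \<infinity>"
        by (rule fin[OF entire_cpartial[OF f]]) (use \<rho>1 in auto)
      then show ?thesis
        by (cases "\<integral>\<^sup>+w. ennreal (fock_mod k \<alpha> (cpartial j f) w powr p) * indicator (ball z \<rho>) w \<partial>lborel") auto
    qed
    then obtain J where J: "\<And>j. 0 \<le> J j"
      "\<And>j. (\<integral>\<^sup>+w. ennreal (fock_mod k \<alpha> (cpartial j f) w powr p) * indicator (ball z \<rho>) w \<partial>lborel) = ennreal (J j)"
      by metis
    have near: "norm (c *\<^sub>R z - z) \<le> s / norm z" if "1 - s / (norm z)\<^sup>2 \<le> c" "c \<le> 1" for c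
    proof -
      have "c *\<^sub>R z - z = (c - 1) *\<^sub>R z" by (simp add: algebra_simps)
      then have "norm (c *\<^sub>R z - z) = (1 - c) * norm z" using that by simp
      also have "\<dots> \<le> s / (norm z)\<^sup>2 * norm z" using that by (intro mult_right_mono) auto
      finally show ?thesis using z0 by (simp add: power2_eq_square)
    qed
    have ballsub: "ball (c *\<^sub>R z) r \<subseteq> ball z \<rho>" if "1 - s / (norm z)\<^sup>2 \<le> c" "c \<le> 1" for c
    proof
      fix w assume "w \<in> ball (c *\<^sub>R z) r"
      then have "dist (c *\<^sub>R z) w < r" by simp
      moreover have "dist z (c *\<^sub>R z) \<le> s / norm z" using near[OF that] by (simp add: dist_norm norm_minus_commute)
      ultimately show "w \<in> ball z \<rho>" using sr dist_triangle[of z w "c *\<^sub>R z"] by simp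
    qed
    have c0: "0 \<le> s / (norm z)\<^sup>2" using s by simp
    let ?z = "(1 - s / (norm z)\<^sup>2) *\<^sub>R z"
    have "norm ?z + r \<le> norm z"
    proof -
      have "s \<le> norm z * norm z"
        using mult_mono[of 1 "norm z" s "norm z"] s by argo
      then have "s / (norm z)\<^sup>2 \<le> 1" using z0 by (simp add: power2_eq_square)
      then have "norm ?z = (1 - s / (norm z)\<^sup>2) * norm z" by simp
      also have "\<dots> = norm z - s / norm z" using z0 by (simp add: field_simps power2_eq_square)
      finally have "norm ?z = norm z - s / norm z" .
      moreover have "r \<le> s / norm z" unfolding r_def using s z0 pos by (intro frac_le) auto
      ultimately show ?thesis by linarith
    qed
    then have inR: "ball ?z r \<subseteq> cball 0 R"
    proof (intro subsetI)
      fix w assume "norm ?z + r \<le> norm z" "w \<in> ball ?z r"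
      then have "dist w ?z < r" "norm ?z + r \<le> norm z" by (simp_all add: dist_commute)
      then have "norm w \<le> R" using zR norm_triangle_sub[of w ?z] unfolding dist_norm by argo
      then show "w \<in> cball 0 R" by simp
    qed
    from inR ballsub[of "1 - s / (norm z)\<^sup>2"] c0 have subE: "ball ?z r \<subseteq> ?E" by simp
    define Y0 where "Y0 = (C * i / r ^ ?N) powr (1 / p)"
    define Y where "Y = (\<lambda>j. (C' * J j / r ^ ?N) powr (1 / p))"
    have Y0: "fock_mod (Suc k) \<alpha> f ?z \<le> Y0"
      unfolding Y0_def by (rule fock_mod_le_local_mean[OF p C(1) C(2)[OF f r] r(1) _ i(2) subE]) (simp add: i)
    have Y: "fock_mod k \<alpha> (cpartial j f) (c *\<^sub>R z) \<le> Y j" if "1 - s / (norm z)\<^sup>2 \<le> c" "c \<le> 1" for c j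
      unfolding Y_def
      by (rule fock_mod_le_local_mean[OF p C'(1) C'(2)[OF entire_cpartial[OF f] r] r(1) _ J(1) ballsub[OF that]]) (simp add: J)
    have Yn: "0 \<le> Y0" "\<And>j. 0 \<le> Y j" by (simp_all add: Y0_def Y_def)
    have Yp: "Y0 powr p = C * i * (1 + norm z) ^ ?N" "\<And>j. Y j powr p = C' * J j * (1 + norm z) ^ ?N"
      using p C(1) C'(1) i J(1) pos by (simp_all add: Y0_def Y_def powr_powr r_def power_one_over)
    let ?e = "exp (- (\<alpha> * s / 2))"
    have "fock_mod (Suc k) \<alpha> f z powr p \<le> (2 ^ Suc k * ?e * Y0 + s * 2 ^ Suc k * (\<Sum>j\<in>UNIV. Y j)) powr p"
      using p by (intro powr_mono2 radial_step[OF f \<alpha> s Y0 Y]) auto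
    also have "\<dots> \<le> 2 powr p * ((2 ^ Suc k * ?e * Y0) powr p + (s * 2 ^ Suc k * (\<Sum>j\<in>UNIV. Y j)) powr p)"
      using p s Yn by (intro powr_add_le mult_nonneg_nonneg sum_nonneg) auto
    also have "\<dots> \<le> 2 powr p * ((2 ^ Suc k * ?e * Y0) powr p + (s * 2 ^ Suc k) powr p * (?n powr p * (\<Sum>j\<in>UNIV. Y j powr p)))"
    proof -
      have "(s * 2 ^ Suc k * (\<Sum>j\<in>UNIV. Y j)) powr p = (s * 2 ^ Suc k) powr p * (\<Sum>j\<in>UNIV. Y j) powr p"
        using s Yn by (intro powr_mult)
      also have "\<dots> \<le> (s * 2 ^ Suc k) powr p * (?n powr p * (\<Sum>j\<in>UNIV. Y j powr p))"
        using p Yn by (intro mult_left_mono powr_sum_le) auto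
      finally show ?thesis by (intro mult_left_mono add_left_mono) auto
    qed
    also have "(2 ^ Suc k * ?e * Y0) powr p = (2 ^ Suc k) powr p * exp (- (\<alpha> * s * p / 2)) * Y0 powr p"
      using Yn by (simp add: powr_mult exp_powr_real mult_ac del: power_Suc)
    also have "2 powr p * ((2 ^ Suc k) powr p * exp (- (\<alpha> * s * p / 2)) * Y0 powr p + (s * 2 ^ Suc k) powr p * (?n powr p * (\<Sum>j\<in>UNIV. Y j powr p)))
       = (1 + norm z) ^ ?N * (Q * exp (- (\<alpha> * s * p / 2)) * i + D s * (\<Sum>j\<in>UNIV. J j))"
    proof -
      have "2 powr p * (a * e * (C * i * P) + b * (c * (\<Sum>j\<in>UNIV. C' * J j * P)))
        = P * ((2 powr p * a * C) * e * i + (2 powr p * b * c * C') * (\<Sum>j\<in>UNIV. J j))" for a b c e P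
        by (simp add: sum_distrib_left sum_distrib_right algebra_simps)
      then show ?thesis unfolding Yp Q_def D_def .
    qed
    finally have main: "fock_mod (Suc k) \<alpha> f z powr p \<le> (1 + norm z) ^ ?N * (Q * exp (- (\<alpha> * s * p / 2)) * i + D s * (\<Sum>j\<in>UNIV. J j))" .
    have "(\<integral>\<^sup>+w. (ennreal (Q * exp (- (\<alpha> * s * p / 2))) * (ennreal (fock_mod (Suc k) \<alpha> f w powr p) * indicator (cball 0 R) w) +
             ennreal (D s) * (\<Sum>j\<in>UNIV. ennreal (fock_mod k \<alpha> (cpartial j f) w powr p))) *
             indicator (ball z \<rho>) w \<partial>lborel)
        = (\<integral>\<^sup>+w. ennreal (Q * exp (- (\<alpha> * s * p / 2))) * (ennreal (fock_mod (Suc k) \<alpha> f w powr p) * indicator ?E w) +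
             ennreal (D s) * (\<Sum>j\<in>UNIV. ennreal (fock_mod k \<alpha> (cpartial j f) w powr p) * indicator (ball z \<rho>) w) \<partial>lborel)"
      by (rule nn_integral_cong) (auto simp: indicator_def)
    also have "\<dots> = ennreal (Q * exp (- (\<alpha> * s * p / 2))) * ennreal i + ennreal (D s) * (\<Sum>j\<in>UNIV. ennreal (J j))"
    proof -
      have "(\<integral>\<^sup>+w. a * F w + b * (\<Sum>j\<in>UNIV. G j w) \<partial>lborel) = a * (\<integral>\<^sup>+w. F w \<partial>lborel) + b * (\<Sum>j\<in>UNIV. \<integral>\<^sup>+w. G j w \<partial>lborel)"
        if "F \<in> borel_measurable borel" "\<And>j. G j \<in> borel_measurable borel"
        for a b and F :: "complex^'n \<Rightarrow> ennreal" and G :: "'n \<Rightarrow> complex^'n \<Rightarrow> ennreal"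
        using that by (simp add: nn_integral_add nn_integral_cmult nn_integral_sum)
      note lin = this
      have 1: "(\<lambda>w. ennreal (fock_mod (Suc k) \<alpha> f w powr p) * indicator ?E w) \<in> borel_measurable borel"
        "\<And>j. (\<lambda>w. ennreal (fock_mod k \<alpha> (cpartial j f) w powr p) * indicator (ball z \<rho>) w) \<in> borel_measurable borel"
        by (auto intro!: borel_measurable_times_ennreal borel_measurable_indicator)
      show ?thesis using lin[OF 1] unfolding i(1) J(2) .
    qed
    also have "\<dots> = ennreal (Q * exp (- (\<alpha> * s * p / 2)) * i + D s * (\<Sum>j\<in>UNIV. J j))"
      using i J(1) D0 C(1) by (simp add: ennreal_mult sum_ennreal sum_nonneg ennreal_plus Q_def)
    finally have E: "(\<integral>\<^sup>+w. (ennreal (Q * exp (- (\<alpha> * s * p / 2))) * (ennreal (fock_mod (Suc k) \<alpha> f w powr p) * indicator (cball 0 R) w) +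
             ennreal (D s) * (\<Sum>j\<in>UNIV. ennreal (fock_mod k \<alpha> (cpartial j f) w powr p))) *
             indicator (ball z \<rho>) w \<partial>lborel) = ennreal (Q * exp (- (\<alpha> * s * p / 2)) * i + D s * (\<Sum>j\<in>UNIV. J j))" .
    have "0 \<le> Q * exp (- (\<alpha> * s * p / 2)) * i + D s * (\<Sum>j\<in>UNIV. J j)"
      using i J(1) D0 C(1) unfolding Q_def by (intro add_nonneg_nonneg mult_nonneg_nonneg sum_nonneg) auto
    then show "ennreal (fock_mod (Suc k) \<alpha> f z powr p) \<le> ennreal ((1 + norm z) ^ ?N) *
       (\<integral>\<^sup>+w. (ennreal (Q * exp (- (\<alpha> * s * p / 2))) * (ennreal (fock_mod (Suc k) \<alpha> f w powr p) * indicator (cball 0 R) w) +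
             ennreal (D s) * (\<Sum>j\<in>UNIV. ennreal (fock_mod k \<alpha> (cpartial j f) w powr p))) *
             indicator (ball z ((2 * s + 1) / (1 + norm z))) w \<partial>lborel)"
      unfolding \<rho>_def[symmetric] E
      using ennreal_leI[OF main] pos by (simp only: ennreal_mult[OF zero_le_power[OF less_imp_le[OF pos]]])
  qed
qed

text \<open>Integrating the previous estimate over \<open>2 s \<le> |z| \<le> R\<close> bounds the integral over \<open>|z| \<le> R\<close> by
  half of itself plus a bound independent of \<open>R\<close>, if \<open>s\<close> is large.\<close>

lemma fock_mass_Suc_finite:
  fixes f :: "complex^'n \<Rightarrow> complex"
  assumes p: "0 < (p::real)" and \<alpha>: "0 < \<alpha>" and f: "entire f"
    and fin: "\<And>j. fock_mass k \<alpha> p (cpartial j f) < \<infinity>"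
  shows "fock_mass (Suc k) \<alpha> p f < \<infinity>"
proof -
  let ?N = "DIM(complex^'n)"
  let ?V = "unit_ball_vol ?N"
  note [measurable] = entire_measurable[OF f] entire_measurable[OF entire_cpartial[OF f]]
  have [measurable]: "cball (0::complex^'n) R \<in> sets borel" for R by simp
  define F where "F = (\<lambda>w. ennreal (fock_mod (Suc k) \<alpha> f w powr p))"
  define G where "G = (\<lambda>j w. ennreal (fock_mod k \<alpha> (cpartial j f) w powr p))"
  have Fm [measurable]: "F \<in> borel_measurable borel" and Gm [measurable]: "\<And>j. G j \<in> borel_measurable borel"
    unfolding F_def G_def by measurable
  obtain C D where C: "0 < C" and D: "\<And>s. 0 \<le> D s" and CD: "\<And>(f :: complex^'n \<Rightarrow> complex) z s R. entire f \<Longrightarrow> 1 \<le> s \<Longrightarrow> 2 * s \<le> norm z \<Longrightarrow> norm z \<le> R \<Longrightarrow>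
     ennreal (fock_mod (Suc k) \<alpha> f z powr p) \<le> ennreal ((1 + norm z) ^ ?N) *
       (\<integral>\<^sup>+w. (ennreal (C * exp (- (\<alpha> * s * p / 2))) * (ennreal (fock_mod (Suc k) \<alpha> f w powr p) * indicator (cball 0 R) w) +
             ennreal (D s) * (\<Sum>j\<in>UNIV. ennreal (fock_mod k \<alpha> (cpartial j f) w powr p))) *
             indicator (ball z ((2 * s + 1) / (1 + norm z))) w \<partial>lborel)"
    using fock_mod_Suc_le_local_mean[OF p \<alpha>, of k] by blast
  \<comment> \<open>The exponential gain beats the volume of the enlarged balls.\<close>
  have "((\<lambda>s. (4 * (2 * s + 1)) ^ ?N * ?V * (C * exp (- (\<alpha> * s * p / 2)))) \<longlongrightarrow> 0) at_top"
    using p \<alpha> C unit_ball_vol_pos[of ?N] by real_asymp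
  then have "eventually (\<lambda>s. (4 * (2 * s + 1)) ^ ?N * ?V * (C * exp (- (\<alpha> * s * p / 2))) < 1 / 2) at_top"
    by (rule order_tendstoD) simp
  then obtain s where s: "1 \<le> s" "(4 * (2 * s + 1)) ^ ?N * ?V * (C * exp (- (\<alpha> * s * p / 2))) < 1 / 2"
    using eventually_conj[OF eventually_ge_at_top[of 1]] eventually_happens'[OF trivial_limit_at_top_linorder] by blast
  define q where "q = C * exp (- (\<alpha> * s * p / 2))"
  define v where "v = (4 * (2 * s + 1)) ^ ?N * ?V"
  have vol: "0 \<le> v" and q: "0 \<le> q" and vq: "v * q \<le> 1 / 2"
    using s C unfolding v_def q_def by (simp_all add: unit_ball_vol_nonneg del: distrib_left_numeral)
  have "(\<Sum>j\<in>UNIV. \<integral>\<^sup>+w. G j w \<partial>lborel) < \<infinity>"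
    using fin by (simp add: G_def fock_mass_def)
  then obtain M where M: "(\<Sum>j\<in>UNIV. \<integral>\<^sup>+w. G j w \<partial>lborel) = ennreal M" "0 \<le> M"
    by (cases "\<Sum>j\<in>UNIV. \<integral>\<^sup>+w. G j w \<partial>lborel") auto
  have "(\<integral>\<^sup>+w. F w * indicator (cball 0 (2 * s)) w \<partial>lborel) < \<infinity>"
    unfolding F_def by (rule fock_mod_powr_ball_finite[OF f p])
  then obtain y where y: "(\<integral>\<^sup>+w. F w * indicator (cball 0 (2 * s)) w \<partial>lborel) = ennreal y" "0 \<le> y"
    by (cases "\<integral>\<^sup>+w. F w * indicator (cball 0 (2 * s)) w \<partial>lborel") auto
  have "(\<integral>\<^sup>+z. F z \<partial>lborel) \<le> ennreal (2 * (y + v * (D s * M)))"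
  proof (rule nn_integral_le_if_cball[OF Fm])
    fix R :: nat
    have "(\<integral>\<^sup>+w. F w * indicator (cball 0 (real R)) w \<partial>lborel) < \<infinity>"
      unfolding F_def by (rule fock_mod_powr_ball_finite[OF f p])
    then obtain x where x: "(\<integral>\<^sup>+w. F w * indicator (cball 0 (real R)) w \<partial>lborel) = ennreal x" "0 \<le> x"
      by (cases "\<integral>\<^sup>+w. F w * indicator (cball 0 (real R)) w \<partial>lborel") auto
    let ?S = "{z::complex^'n. 2 * s \<le> norm z \<and> norm z \<le> real R}"
    have [measurable]: "?S \<in> sets borel" by measurable
    have "ennreal x \<le> (\<integral>\<^sup>+w. F w * indicator (cball 0 (2 * s)) w + F w * indicator ?S w \<partial>lborel)"
      unfolding x(1)[symmetric] by (intro nn_integral_mono) (auto simp: indicator_def)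
    also have "\<dots> = ennreal y + (\<integral>\<^sup>+w. F w * indicator ?S w \<partial>lborel)"
      unfolding y(1)[symmetric] by (rule nn_integral_add) (auto intro!: borel_measurable_times_ennreal)
    also have "\<dots> \<le> ennreal y + ennreal v * (ennreal q * ennreal x + ennreal (D s) * ennreal M)"
    proof (rule add_left_mono)
      have "(\<integral>\<^sup>+w. F w * indicator ?S w \<partial>lborel) \<le> ennreal v *
      (\<integral>\<^sup>+w. ennreal q * (F w * indicator (cball 0 (real R)) w) + ennreal (D s) * (\<Sum>j\<in>UNIV. G j w) \<partial>lborel)"
        unfolding v_def q_def by (rule local_average_integral)
         (use s(1) CD[OF f s(1), where R = "real R"] in \<open>auto simp: F_def G_def intro!: borel_measurable_times_ennreal borel_measurable_add borel_measurable_sum\<close>)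
      also have "(\<integral>\<^sup>+w. ennreal q * (F w * indicator (cball 0 (real R)) w) + ennreal (D s) * (\<Sum>j\<in>UNIV. G j w) \<partial>lborel)
       = ennreal q * ennreal x + ennreal (D s) * ennreal M"
        unfolding x(1)[symmetric] M(1)[symmetric]
        by (subst nn_integral_add; (subst nn_integral_cmult)?; (subst nn_integral_cmult)?; (subst nn_integral_sum)?)
         (auto intro!: borel_measurable_times_ennreal)
      finally show "(\<integral>\<^sup>+w. F w * indicator ?S w \<partial>lborel) \<le> ennreal v * (ennreal q * ennreal x + ennreal (D s) * ennreal M)" .
    qed
    also have "\<dots> = ennreal (y + v * (q * x + D s * M))"
      using x y M D[of s] q vol by (simp add: ennreal_mult ennreal_plus)
    finally have "x \<le> y + v * (q * x + D s * M)"
      using x y M D[of s] q vol by (subst (asm) ennreal_le_iff) (auto intro!: add_nonneg_nonneg mult_nonneg_nonneg)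
    also have "\<dots> = y + (v * q) * x + v * (D s * M)" by (simp add: algebra_simps)
    finally have le: "x \<le> y + (v * q) * x + v * (D s * M)" .
    have absorb: "x \<le> 2 * (y + a)" if "x \<le> y + b + a" "b \<le> 1 / 2 * x" for a b :: real
      using that by argo
    have "x \<le> 2 * (y + v * (D s * M))"
      by (rule absorb[OF le]) (intro mult_right_mono vq x(2))
    then show "(\<integral>\<^sup>+w. F w * indicator (cball 0 (real R)) w \<partial>lborel) \<le> ennreal (2 * (y + v * (D s * M)))"
      unfolding x(1) by (rule ennreal_leI)
  qed
  then show ?thesis unfolding fock_mass_def F_def using ennreal_less_top le_less_trans by (metis infinity_ennreal_def)
qed

lemma fock_norm_finite_iff:
  fixes f :: "complex^'n \<Rightarrow> complex"
  assumes "0 < p" "0 < \<alpha>" "entire f"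
  shows "fock_norm \<alpha> p f < \<infinity> \<longleftrightarrow> fock_mass 0 \<alpha> p f < \<infinity>"
proof -
  have "norm (f z) powr p * exp (- (\<alpha> * p / 2) * (norm z)\<^sup>2) = fock_mod 0 \<alpha> f z powr p" for z
    by (simp add: fock_mod_def powr_mult exp_powr_real mult_ac)
  moreover have "0 < (\<alpha> * p / (2 * pi)) ^ CARD('n)" using assms by simp
  then have "ennreal ((\<alpha> * p / (2 * pi)) ^ CARD('n)) \<noteq> 0" by (simp only: ennreal_eq_0_iff not_le)
  then have "ennreal ((\<alpha> * p / (2 * pi)) ^ CARD('n)) * I < top \<longleftrightarrow> I < top" for I
    by (auto simp: ennreal_mult_less_top)
  ultimately show ?thesis
    unfolding fock_norm_def fock_mass_def by (simp only: epow_less_top_iff infinity_ennreal_def)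
qed

lemma entire_cpartial_funpow: "entire f \<Longrightarrow> entire ((cpartial j ^^ k) f)"
  by (induction k) (auto intro: entire_cpartial)

lemma cpartial_funpow_commute: "entire f \<Longrightarrow> (cpartial i ^^ k) (cpartial j f) = cpartial j ((cpartial i ^^ k) f)"
  by (induction k) (auto simp: cpartial_commute entire_cpartial_funpow)

lemma foldr_cpartial_entire:
  "entire f \<Longrightarrow> entire (foldr (\<lambda>j. cpartial j ^^ \<beta> j) js f)"
  by (induction js) (auto intro: entire_cpartial_funpow)

lemma foldr_cpartial_commute:
  "entire f \<Longrightarrow> foldr (\<lambda>j. cpartial j ^^ \<beta> j) js (cpartial i f) = cpartial i (foldr (\<lambda>j. cpartial j ^^ \<beta> j) js f)"
  by (induction js) (auto simp: cpartial_funpow_commute foldr_cpartial_entire)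

lemma foldr_cpartial_update:
  assumes "entire f" "distinct js" "i \<in> set js"
  shows "foldr (\<lambda>j. cpartial j ^^ \<beta> j) js (cpartial i f) = foldr (\<lambda>j. cpartial j ^^ (\<beta>(i := Suc (\<beta> i))) j) js f"
  using assms(2,3)
proof (induction js)
  case (Cons j js)
  show ?case
  proof (cases "i = j")
    case True
    have "foldr (\<lambda>j. cpartial j ^^ (\<beta>(i := Suc (\<beta> i))) j) js f = foldr (\<lambda>j. cpartial j ^^ \<beta> j) js f"
      using Cons True by (intro foldr_cong) auto
    then show ?thesis
      using True assms(1) by (simp add: foldr_cpartial_commute cpartial_funpow_commute foldr_cpartial_entire)
  next
    case False
    then show ?thesis using Cons by simp
  qed
qed simp

lemma some_enumeration: "distinct (SOME js. distinct js \<and> set js = (UNIV :: 'n::finite set))"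
    "set (SOME js. distinct js \<and> set js = (UNIV :: 'n set)) = UNIV"
  using someI_ex[of "\<lambda>js. distinct js \<and> set js = (UNIV :: 'n set)"] finite_distinct_list[of "UNIV :: 'n set"]
  by auto

lemma multi_deriv_cpartial:
  "entire f \<Longrightarrow> multi_deriv \<beta> (cpartial i f) = multi_deriv (\<beta>(i := Suc (\<beta> i))) f"
  unfolding multi_deriv_def by (rule foldr_cpartial_update) (simp_all add: some_enumeration)

lemma entire_multi_deriv: "entire f \<Longrightarrow> entire (multi_deriv \<beta> f)"
  unfolding multi_deriv_def by (rule foldr_cpartial_entire)

lemma multi_deriv_zero: "multi_deriv (\<lambda>_. 0) f = f"
proof -
  have "foldr (\<lambda>j. cpartial j ^^ 0) js f = f" for js by (induction js) auto
  then show ?thesis by (simp add: multi_deriv_def)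
qed

lemma fock_mass_multi_deriv_finite:
  fixes f :: "complex^'n \<Rightarrow> complex"
  assumes p: "0 < p" "0 < \<alpha>" and f: "entire f" and fin: "fock_mass m \<alpha> p f < \<infinity>" and \<beta>: "(\<Sum>j\<in>UNIV. \<beta> j) \<le> m"
  shows "fock_mass 0 \<alpha> p (multi_deriv \<beta> f) < \<infinity>"
proof -
  have pow: "fock_mass (k - l) \<alpha> p ((cpartial j ^^ l) g) < \<infinity>"
    if "fock_mass k \<alpha> p g < \<infinity>" "l \<le> k" "entire g" for k l j and g :: "complex^'n \<Rightarrow> complex"
    using that(2)
  proof (induction l)
    case (Suc l)
    then have "k - l = Suc (k - Suc l)" "fock_mass (k - l) \<alpha> p ((cpartial j ^^ l) g) < \<infinity>" by auto
    then show ?case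
      using fock_mass_cpartial_finite[OF p entire_cpartial_funpow[OF that(3)], of "k - Suc l"] by simp
  qed (use that in simp)
  have "fock_mass (m - sum_list (map \<beta> js)) \<alpha> p (foldr (\<lambda>j. cpartial j ^^ \<beta> j) js f) < \<infinity>"
    if "sum_list (map \<beta> js) \<le> m" for js
    using that
  proof (induction js)
    case (Cons j js)
    then show ?case
      using pow[of "m - sum_list (map \<beta> js)" "foldr (\<lambda>j. cpartial j ^^ \<beta> j) js f" "\<beta> j" j] f
      by (simp add: foldr_cpartial_entire ac_simps)
  qed (use fin in simp)
  moreover have "sum_list (map \<beta> (SOME js. distinct js \<and> set js = (UNIV :: 'n set))) = (\<Sum>j\<in>UNIV. \<beta> j)"
    by (simp add: sum_list_distinct_conv_sum_set some_enumeration)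
  ultimately have "fock_mass (m - (\<Sum>j\<in>UNIV. \<beta> j)) \<alpha> p (multi_deriv \<beta> f) < \<infinity>"
    using \<beta> unfolding multi_deriv_def by metis
  moreover have "fock_mass 0 \<alpha> p g \<le> fock_mass k \<alpha> p g" for k and g :: "complex^'n \<Rightarrow> complex"
    unfolding fock_mass_def fock_mod_def using p
    by (intro nn_integral_mono ennreal_leI powr_mono2 mult_right_mono) (auto simp: one_le_power)
  ultimately show ?thesis using le_less_trans by blast
qed

lemma fock_mass_finite_if_multi_deriv:
  fixes f :: "complex^'n \<Rightarrow> complex"
  assumes p: "0 < p" "0 < \<alpha>"
  shows "entire f \<Longrightarrow> (\<And>\<beta>. (\<Sum>j\<in>UNIV. \<beta> j) \<le> m \<Longrightarrow> fock_mass 0 \<alpha> p (multi_deriv \<beta> f) < \<infinity>) \<Longrightarrow> fock_mass m \<alpha> p f < \<infinity>"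
proof (induction m arbitrary: f)
  case 0
  then show ?case using 0(2)[of "\<lambda>_. 0"] by (simp add: multi_deriv_zero)
next
  case (Suc m)
  show ?case
  proof (rule fock_mass_Suc_finite[OF p Suc.prems(1)])
    fix j
    show "fock_mass m \<alpha> p (cpartial j f) < \<infinity>"
    proof (rule Suc.IH[OF entire_cpartial[OF Suc.prems(1)]])
      fix \<beta> :: "'n \<Rightarrow> nat" assume \<beta>: "(\<Sum>j\<in>UNIV. \<beta> j) \<le> m"
      have "(\<Sum>i\<in>UNIV. (\<beta>(j := Suc (\<beta> j))) i) = Suc (\<Sum>i\<in>UNIV. \<beta> i)"
        by (simp add: sum.remove[of UNIV j])
      then show "fock_mass 0 \<alpha> p (multi_deriv \<beta> (cpartial j f)) < \<infinity>"
        unfolding multi_deriv_cpartial[OF Suc.prems(1)] using \<beta> by (intro Suc.prems(2)) simp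
    qed
  qed
qed

text \<open>One direction lowers the weight by one with each derivative. The other raises it by induction on
  \<open>m\<close>, applied to the first partial derivatives, and needs that partial derivatives commute.\<close>

theorem fock_sobolev_eq:
  assumes "0 < p" "0 < \<alpha>"
  shows "fock_sobolev m \<alpha> p = {f :: complex^'n \<Rightarrow> complex. entire f \<and> fock_mass m \<alpha> p f < \<infinity>}"
proof -
  have "(\<Sum>\<beta> | (\<Sum>j\<in>UNIV. \<beta> j) \<le> m. fock_norm \<alpha> p (multi_deriv \<beta> f)) < \<infinity> \<longleftrightarrow> fock_mass m \<alpha> p f < \<infinity>"
    if f: "entire f" for f :: "complex^'n \<Rightarrow> complex"
  proof -
    have "(\<Sum>\<beta> | (\<Sum>j\<in>UNIV. \<beta> j) \<le> m. fock_norm \<alpha> p (multi_deriv \<beta> f)) < \<infinity> \<longleftrightarrow>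
       (\<forall>\<beta>. (\<Sum>j\<in>UNIV. \<beta> j) \<le> m \<longrightarrow> fock_norm \<alpha> p (multi_deriv \<beta> f) < \<infinity>)"
      using finite_multi_indices[where 'n = 'n and m = m] by simp
    also have "\<dots> \<longleftrightarrow> (\<forall>\<beta>. (\<Sum>j\<in>UNIV. \<beta> j) \<le> m \<longrightarrow> fock_mass 0 \<alpha> p (multi_deriv \<beta> f) < \<infinity>)"
      using fock_norm_finite_iff[OF assms entire_multi_deriv[OF f]] by blast
    also have "\<dots> \<longleftrightarrow> fock_mass m \<alpha> p f < \<infinity>"
      using fock_mass_multi_deriv_finite[OF assms f] fock_mass_finite_if_multi_deriv[OF assms f] by blast
    finally show ?thesis .
  qed
  then show ?thesis unfolding fock_sobolev_def by blast
qed

section \<open>Comparison of the weights \<open>|z|\<^sup>m\<close> and \<open>(1 + |z|)\<^sup>m\<close>\<close>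

definition fs_mass :: "nat \<Rightarrow> real \<Rightarrow> real \<Rightarrow> (complex^'n \<Rightarrow> complex) \<Rightarrow> ennreal" where
  "fs_mass m \<alpha> p f = (\<integral>\<^sup>+ z. ennreal ((norm z ^ m) powr p * norm (f z) powr p *
                           exp (- (\<alpha> * p / 2) * (norm z)\<^sup>2)) \<partial>lborel)"

lemma fs_const_pos:
  assumes "0 < p" "0 < \<alpha>" "0 < n"
  shows "0 < fs_const \<alpha> p m n"
proof -
  have "0 < Gamma (real m * p / 2 + real n)" "0 < Gamma (real n)"
    using assms by (auto intro!: Gamma_real_pos add_nonneg_pos)
  then show ?thesis using assms by (simp add: fs_const_def)
qed

lemma fs_norm_eq_mass:
  "fs_norm m \<alpha> p (f :: complex^'n \<Rightarrow> complex) = epow (ennreal (fs_const \<alpha> p m CARD('n)) * fs_mass m \<alpha> p f) (1 / p)"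
  by (simp add: fs_norm_def fs_mass_def)

lemma fs_mass_weight:
  assumes "0 < p"
  shows "(norm z ^ m) powr p * norm (f z) powr p * exp (- (\<alpha> * p / 2) * (norm z)\<^sup>2)
    = (norm z ^ m * norm (f z) * exp (- (\<alpha> / 2) * (norm z)\<^sup>2)) powr p"
  using assms by (simp add: powr_mult exp_powr_real mult_ac)

lemma fs_mass_le_fock_mass:
  fixes f :: "complex^'n \<Rightarrow> complex"
  assumes "0 < p"
  shows "fs_mass m \<alpha> p f \<le> fock_mass m \<alpha> p f"
  unfolding fs_mass_def fock_mass_def fs_mass_weight[OF assms] fock_mod_def
  using assms by (intro nn_integral_mono ennreal_leI powr_mono2 mult_right_mono power_mono) auto

text \<open>The maximum principle on a complex line.\<close>

lemma entire_le_circle: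
  assumes f: "entire f"
  obtains t where "norm t = 1" "norm (f a) \<le> norm (f (a + t *s v))"
proof -
  have h: "(\<lambda>t. f (a + t *s v)) holomorphic_on S" for S by (rule entire_slice_holomorphic[OF f])
  have "continuous_on (sphere 0 1) (\<lambda>t. norm (f (a + t *s v)))"
    by (intro continuous_intros holomorphic_on_imp_continuous_on h)
  then obtain t where t: "t \<in> sphere (0::complex) 1" "\<And>s. s \<in> sphere 0 1 \<Longrightarrow> norm (f (a + s *s v)) \<le> norm (f (a + t *s v))"
    using continuous_attains_sup[of "sphere (0::complex) 1"] by (metis compact_sphere sphere_eq_empty not_one_less_zero)
  have "norm ((deriv ^^ 0) (\<lambda>t. f (a + t *s v)) 0) \<le> fact 0 * norm (f (a + t *s v)) / 1 ^ 0"
    by (rule Cauchy_inequality) (use t in \<open>auto intro: h holomorphic_on_imp_continuous_on\<close>)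
  then show ?thesis using t(1) by (intro that[of t]) auto
qed

text \<open>The weights are comparable for \<open>|z| \<ge> 1\<close>. For \<open>|z| < 1\<close>, where \<open>|z|\<^sup>m\<close> may vanish, the maximum
  principle transfers the value of \<open>f\<close> to a point at distance \<open>3\<close>, whose unit ball lies in
  \<open>|z| \<ge> 1\<close>.\<close>

lemma fock_mass_le_fs_mass:
  assumes p: "0 < (p::real)" and \<alpha>: "0 < \<alpha>"
  obtains C where "0 < C" "\<And>f :: complex^'n \<Rightarrow> complex. entire f \<Longrightarrow> fock_mass m \<alpha> p f \<le> ennreal C * fs_mass m \<alpha> p f"
proof -
  let ?N = "DIM(complex^'n)"
  let ?V = "unit_ball_vol ?N"
  obtain C where C: "0 < C" "\<And>(f :: complex^'n \<Rightarrow> complex) a r. entire f \<Longrightarrow> 0 < r \<Longrightarrow> r \<le> 1 \<Longrightarrow>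
     ennreal (fock_mod m \<alpha> f a powr p * r ^ ?N) \<le>
     ennreal C * (\<integral>\<^sup>+w. ennreal (fock_mod m \<alpha> f w powr p) * indicator (ball a r) w \<partial>lborel)"
    using fock_mod_mean_le[OF p \<alpha>, of m] by blast
  define K where "K = 2 ^ m * exp (8 * \<alpha>)"
  define c where "c = (2 ^ m) powr p"
  have K: "0 < K" "0 < c" by (simp_all add: K_def c_def)
  define B where "B = c + ?V * (K powr p * C * c)"
  show ?thesis
  proof (rule that[of B])
    show "0 < B" using K C(1) by (simp add: B_def add_pos_nonneg unit_ball_vol_nonneg)
    fix f :: "complex^'n \<Rightarrow> complex" assume f: "entire f"
    note [measurable] = entire_measurable[OF f]
    let ?W = "fs_mass m \<alpha> p f"
    define w where "w = (\<lambda>z. ennreal ((norm z ^ m * norm (f z) * exp (- (\<alpha> / 2) * (norm z)\<^sup>2)) powr p))"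
    have W: "?W = (\<integral>\<^sup>+z. w z \<partial>lborel)" unfolding fs_mass_def w_def fs_mass_weight[OF p] ..
    have wm [measurable]: "w \<in> borel_measurable borel"
      unfolding w_def by (intro measurable_compose[OF _ measurable_ennreal] powr_real_measurable
          borel_measurable_times gauss_measurable) measurable
    have far: "ennreal (fock_mod m \<alpha> f z powr p) \<le> ennreal c * w z" if "1 \<le> norm z" for z
    proof -
      have "(1 + norm z) ^ m \<le> (2 * norm z) ^ m" using that by (intro power_mono) auto
      then have "fock_mod m \<alpha> f z \<le> (2 * norm z) ^ m * norm (f z) * exp (- (\<alpha> / 2) * (norm z)\<^sup>2)"
        unfolding fock_mod_def by (intro mult_right_mono) auto
      also have "\<dots> = 2 ^ m * (norm z ^ m * norm (f z) * exp (- (\<alpha> / 2) * (norm z)\<^sup>2))"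
        by (simp add: power_mult_distrib)
      finally have "fock_mod m \<alpha> f z powr p \<le> (2 ^ m * (norm z ^ m * norm (f z) * exp (- (\<alpha> / 2) * (norm z)\<^sup>2))) powr p"
        using p by (intro powr_mono2) auto
      also have "\<dots> = c * (norm z ^ m * norm (f z) * exp (- (\<alpha> / 2) * (norm z)\<^sup>2)) powr p"
        unfolding c_def by (rule powr_mult)
      finally show ?thesis unfolding w_def using K by (simp add: ennreal_mult[symmetric] ennreal_leI)
    qed
    have near: "ennreal (fock_mod m \<alpha> f z powr p) \<le> ennreal (K powr p * C * c) * ?W" if z: "norm z < 1" for z
    proof -
      \<comment> \<open>Any coordinate direction serves.\<close>
      obtain t where t: "norm t = 1" "norm (f z) \<le> norm (f (z + t *s axis undefined 3))"
        using entire_le_circle[OF f] by blast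
      define a where "a = z + t *s axis undefined 3"
      have "norm (a - z) = 3" by (simp add: a_def norm_vector_scalar norm_axis_complex t)
      then have na: "2 \<le> norm a" "norm a \<le> 4"
        using z norm_triangle_sub[of a z] norm_triangle_ineq2[of "a - z" "- z"] by auto
      have "fock_mod m \<alpha> f z \<le> 2 ^ m * norm (f a) * 1"
        unfolding fock_mod_def using z t(2) \<alpha> by (intro mult_mono power_mono) (auto simp: a_def)
      also have "\<dots> \<le> 2 ^ m * (exp (8 * \<alpha>) * fock_mod m \<alpha> f a)"
      proof -
        have "(norm a)\<^sup>2 \<le> 4\<^sup>2" using na by (intro power_mono) auto
        then have "\<alpha> / 2 * (norm a)\<^sup>2 \<le> \<alpha> / 2 * 4\<^sup>2" using \<alpha> by (intro mult_left_mono) auto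
        then have "1 \<le> exp (8 * \<alpha>) * exp (- (\<alpha> / 2) * (norm a)\<^sup>2)" by (simp flip: exp_add)
        moreover have "1 \<le> (1 + norm a) ^ m" by (intro one_le_power) auto
        ultimately have "1 * 1 \<le> (1 + norm a) ^ m * (exp (8 * \<alpha>) * exp (- (\<alpha> / 2) * (norm a)\<^sup>2))"
          by (intro mult_mono) auto
        from mult_right_mono[OF this, of "2 ^ m * norm (f a)"]
        show ?thesis by (simp add: fock_mod_def mult_ac)
      qed
      finally have "fock_mod m \<alpha> f z powr p \<le> (K * fock_mod m \<alpha> f a) powr p"
        using p by (intro powr_mono2) (auto simp: K_def mult_ac)
      then have le: "fock_mod m \<alpha> f z powr p \<le> K powr p * fock_mod m \<alpha> f a powr p"
        using K by (simp add: powr_mult)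
      have "ennreal (fock_mod m \<alpha> f a powr p) \<le> ennreal C * (\<integral>\<^sup>+w. ennreal (fock_mod m \<alpha> f w powr p) * indicator (ball a 1) w \<partial>lborel)"
        using C(2)[OF f, of 1 a] by simp
      also have "\<dots> \<le> ennreal C * (\<integral>\<^sup>+z. ennreal c * w z \<partial>lborel)"
      proof (intro mult_left_mono nn_integral_mono)
        fix b
        show "ennreal (fock_mod m \<alpha> f b powr p) * indicator (ball a 1) b \<le> ennreal c * w b"
        proof (cases "b \<in> ball a 1")
          case True
          then have "1 \<le> norm b" using na norm_triangle_sub[of a b] by (simp add: dist_norm)
          then show ?thesis using far[of b] True by simp
        qed simp
      qed simp
      also have "\<dots> = ennreal C * (ennreal c * ?W)" unfolding W by (simp add: nn_integral_cmult)
      finally have 1: "ennreal (fock_mod m \<alpha> f a powr p) \<le> ennreal C * (ennreal c * ?W)" .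
      have "ennreal (fock_mod m \<alpha> f z powr p) \<le> ennreal (K powr p) * ennreal (fock_mod m \<alpha> f a powr p)"
        using le by (simp add: ennreal_mult[symmetric] ennreal_leI)
      also have "\<dots> \<le> ennreal (K powr p) * (ennreal C * (ennreal c * ?W))" by (intro mult_left_mono 1) simp
      also have "\<dots> = ennreal (K powr p * C * c) * ?W" using K C(1) by (simp add: ennreal_mult mult.assoc)
      finally show ?thesis .
    qed
    have "fock_mass m \<alpha> p f \<le> (\<integral>\<^sup>+z. ennreal c * w z + (ennreal (K powr p * C * c) * ?W) * indicator (ball 0 1) z \<partial>lborel)"
      unfolding fock_mass_def
    proof (intro nn_integral_mono)
      fix z
      show "ennreal (fock_mod m \<alpha> f z powr p) \<le> ennreal c * w z + (ennreal (K powr p * C * c) * ?W) * indicator (ball 0 1) z"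
      proof (cases "norm z < 1")
        case True
        then show ?thesis using near[OF True] by (simp add: add_increasing)
      next
        case False
        then show ?thesis using far[of z] by simp
      qed
    qed
    also have "\<dots> = ennreal c * ?W + (ennreal (K powr p * C * c) * ?W) * ennreal ?V"
      unfolding W by (subst nn_integral_add) (auto simp: nn_integral_cmult nn_integral_cmult_indicator emeasure_ball)
    also have "\<dots> = ennreal B * ?W"
      using K C(1) by (simp add: B_def ennreal_mult ennreal_plus unit_ball_vol_nonneg algebra_simps)
    finally show "fock_mass m \<alpha> p f \<le> ennreal B * ?W" .
  qed
qed

lemma ennreal_mult_less_top_iff: "0 < c \<Longrightarrow> ennreal c * x < top \<longleftrightarrow> x < top"
  by (auto simp: ennreal_mult_less_top ennreal_eq_0_iff)

lemma fs_norm_equiv: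
  assumes p: "0 < (p::real)" and \<alpha>: "0 < \<alpha>"
  obtains C where "0 < C"
    "\<And>f :: complex^'n \<Rightarrow> complex. fs_norm m \<alpha> p f \<le> ennreal C * epow (fock_mass m \<alpha> p f) (1 / p)"
    "\<And>f :: complex^'n \<Rightarrow> complex. entire f \<Longrightarrow> epow (fock_mass m \<alpha> p f) (1 / p) \<le> ennreal C * fs_norm m \<alpha> p f"
proof -
  let ?k = "fs_const \<alpha> p m CARD('n)"
  have k: "0 < ?k" using fs_const_pos[OF p \<alpha>, of "CARD('n)" m] by simp
  obtain B where B: "0 < B" "\<And>f :: complex^'n \<Rightarrow> complex. entire f \<Longrightarrow> fock_mass m \<alpha> p f \<le> ennreal B * fs_mass m \<alpha> p f"
    using fock_mass_le_fs_mass[OF p \<alpha>, where m = m] by blast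
  define C where "C = max (?k powr (1 / p)) ((B / ?k) powr (1 / p))"
  show ?thesis
  proof (rule that[of C])
    show "0 < C" using k by (auto simp: C_def less_max_iff_disj)
    fix f :: "complex^'n \<Rightarrow> complex"
    have "fs_norm m \<alpha> p f \<le> epow (ennreal ?k * fock_mass m \<alpha> p f) (1 / p)"
      unfolding fs_norm_eq_mass using p by (intro epow_mono mult_left_mono fs_mass_le_fock_mass) auto
    also have "\<dots> = ennreal (?k powr (1 / p)) * epow (fock_mass m \<alpha> p f) (1 / p)"
      using p k by (simp add: epow_mult epow_ennreal)
    also have "\<dots> \<le> ennreal C * epow (fock_mass m \<alpha> p f) (1 / p)"
      by (intro mult_right_mono ennreal_leI) (auto simp: C_def)
    finally show "fs_norm m \<alpha> p f \<le> ennreal C * epow (fock_mass m \<alpha> p f) (1 / p)" .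
  next
    fix f :: "complex^'n \<Rightarrow> complex" assume f: "entire f"
    have "epow (fock_mass m \<alpha> p f) (1 / p) \<le> epow (ennreal B * fs_mass m \<alpha> p f) (1 / p)"
      using p by (intro epow_mono B(2)[OF f]) auto
    also have "ennreal B * fs_mass m \<alpha> p f = ennreal (B / ?k) * (ennreal ?k * fs_mass m \<alpha> p f)"
      using B(1) k by (simp add: mult.assoc[symmetric] ennreal_mult[symmetric] less_imp_le)
    also have "epow \<dots> (1 / p) = ennreal ((B / ?k) powr (1 / p)) * fs_norm m \<alpha> p f"
      using p k B(1) by (simp add: epow_mult[of "1 / p" "ennreal (B / ?k)"] epow_ennreal fs_norm_eq_mass less_imp_le)
    also have "\<dots> \<le> ennreal C * fs_norm m \<alpha> p f"
      by (intro mult_right_mono ennreal_leI) (auto simp: C_def)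
    finally show "epow (fock_mass m \<alpha> p f) (1 / p) \<le> ennreal C * fs_norm m \<alpha> p f" .
  qed
qed

section \<open>The embedding inequality\<close>

lemma ennreal_Young:
  assumes "1 < a" "1 < b" "1 / a + 1 / b = 1"
  shows "x * y \<le> ennreal (1 / a) * epow x a + ennreal (1 / b) * epow y b"
proof (cases "x = top \<or> y = top")
  case True
  then show ?thesis using assms by (auto simp: ennreal_mult_top ennreal_eq_0_iff)
next
  case False
  then obtain s t where st: "x = ennreal s" "0 \<le> s" "y = ennreal t" "0 \<le> t" by (cases x; cases y) auto
  have "s * t \<le> s powr a / a + t powr b / b" using Youngs_inequality[OF assms st(2,4)] .
  then show ?thesis
    using st assms by (simp add: epow_ennreal ennreal_mult[symmetric] ennreal_plus[symmetric] ennreal_leI del: ennreal_plus)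
qed

text \<open>Young's inequality for functions normalized to norm \<open>1\<close>. The cases in which this is impossible
  are trivial.\<close>

lemma nn_integral_Hoelder:
  fixes F G :: "'a \<Rightarrow> ennreal"
  assumes ab: "1 < a" "1 < b" "1 / a + 1 / b = 1"
    and [measurable]: "F \<in> borel_measurable M" "G \<in> borel_measurable M"
  shows "(\<integral>\<^sup>+x. F x * G x \<partial>M) \<le> epow (\<integral>\<^sup>+x. epow (F x) a \<partial>M) (1 / a) * epow (\<integral>\<^sup>+x. epow (G x) b \<partial>M) (1 / b)"
proof -
  let ?I = "\<integral>\<^sup>+x. epow (F x) a \<partial>M" and ?J = "\<integral>\<^sup>+x. epow (G x) b \<partial>M"
  consider "?I = 0" | "?J = 0" | "?I \<noteq> 0" "?J \<noteq> 0" "?I = top \<or> ?J = top" | "?I \<noteq> 0" "?J \<noteq> 0" "?I < top" "?J < top"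
    using top.not_eq_extremum by blast
  then show ?thesis
  proof cases
    case 1
    then have "AE x in M. F x = 0" by (simp add: nn_integral_0_iff_AE epow_eq_0_iff)
    then have "(\<integral>\<^sup>+x. F x * G x \<partial>M) = (\<integral>\<^sup>+x. 0 \<partial>M)" by (intro nn_integral_cong_AE) auto
    then show ?thesis by simp
  next
    case 2
    then have "AE x in M. G x = 0" by (simp add: nn_integral_0_iff_AE epow_eq_0_iff)
    then have "(\<integral>\<^sup>+x. F x * G x \<partial>M) = (\<integral>\<^sup>+x. 0 \<partial>M)" by (intro nn_integral_cong_AE) auto
    then show ?thesis by simp
  next
    case 3
    then have "epow ?I (1 / a) * epow ?J (1 / b) = top"
      by (metis epow_eq_0_iff epow_top(2) ennreal_mult_eq_top_iff)
    then show ?thesis by simp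
  next
    case 4
    then obtain i j where i: "?I = ennreal i" "0 < i" and j: "?J = ennreal j" "0 < j"
      by (cases ?I; cases ?J) (auto simp: ennreal_eq_0_iff)
    define A B where "A = i powr (1 / a)" and "B = j powr (1 / b)"
    have AB: "0 < A" "0 < B" using i j by (simp_all add: A_def B_def)
    have Aa: "A powr a = i" "B powr b = j" using i j ab by (simp_all add: A_def B_def powr_powr)
    have "(\<integral>\<^sup>+x. F x * G x \<partial>M) = (\<integral>\<^sup>+x. ennreal (A * B) * ((ennreal (1 / A) * F x) * (ennreal (1 / B) * G x)) \<partial>M)"
    proof (rule nn_integral_cong)
      fix x
      have "ennreal (A * B) * ((ennreal (1 / A) * F x) * (ennreal (1 / B) * G x))
         = (ennreal A * ennreal (1 / A)) * (ennreal B * ennreal (1 / B)) * (F x * G x)"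
        using AB by (simp add: ennreal_mult mult_ac)
      also have "\<dots> = F x * G x" using AB by (simp flip: ennreal_mult)
      finally show "F x * G x = ennreal (A * B) * ((ennreal (1 / A) * F x) * (ennreal (1 / B) * G x))" ..
    qed
    also have "\<dots> = ennreal (A * B) * (\<integral>\<^sup>+x. (ennreal (1 / A) * F x) * (ennreal (1 / B) * G x) \<partial>M)"
      by (rule nn_integral_cmult) measurable
    also have "\<dots> \<le> ennreal (A * B) * (\<integral>\<^sup>+x. ennreal (1 / a) * (ennreal (1 / i) * epow (F x) a) + ennreal (1 / b) * (ennreal (1 / j) * epow (G x) b) \<partial>M)"
    proof (intro mult_left_mono nn_integral_mono)
      fix x
      have "epow (ennreal (1 / A) * F x) a = ennreal (1 / i) * epow (F x) a"
        "epow (ennreal (1 / B) * G x) b = ennreal (1 / j) * epow (G x) b"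
        using ab AB Aa by (simp_all add: epow_mult epow_ennreal powr_divide)
      then show "(ennreal (1 / A) * F x) * (ennreal (1 / B) * G x) \<le>
        ennreal (1 / a) * (ennreal (1 / i) * epow (F x) a) + ennreal (1 / b) * (ennreal (1 / j) * epow (G x) b)"
        using ennreal_Young[OF ab, of "ennreal (1 / A) * F x" "ennreal (1 / B) * G x"] by simp
    qed simp
    also have "(\<integral>\<^sup>+x. ennreal (1 / a) * (ennreal (1 / i) * epow (F x) a) + ennreal (1 / b) * (ennreal (1 / j) * epow (G x) b) \<partial>M)
       = ennreal (1 / a) * (ennreal (1 / i) * ?I) + ennreal (1 / b) * (ennreal (1 / j) * ?J)"
      by (simp add: nn_integral_add nn_integral_cmult)
    also have "\<dots> = 1"
      unfolding i(1) j(1) using i(2) j(2) ab by (simp flip: ennreal_mult ennreal_plus ennreal_1)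
    finally show ?thesis
      unfolding i(1) j(1) using AB i j by (simp add: epow_ennreal A_def B_def ennreal_mult)
  qed
qed

text \<open>The last two factors compensate the weights in \<^const>\<open>fock_mod\<close> at \<open>\<psi> z\<close>. With this density the
  operator becomes an embedding (\<open>fs_mass_wcomp\<close>), and the transform a Gaussian mean
  (\<open>fs_berezin_eq\<close>). The image measure under \<open>\<psi>\<close> need not be \<open>\<sigma>\<close>-finite, so integrals are
  taken before mapping by \<open>\<psi>\<close>.\<close>

definition wdens :: "nat \<Rightarrow> real \<Rightarrow> real \<Rightarrow> (complex^'n \<Rightarrow> complex) \<Rightarrow> (complex^'n \<Rightarrow> complex^'n) \<Rightarrow> complex^'n \<Rightarrow> real" where
  "wdens m \<alpha> q u \<psi> z = norm (u z) powr q * (norm z ^ m) powr q * exp (- (\<alpha> * q / 2) * (norm z)\<^sup>2) *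
     exp (\<alpha> * q / 2 * (norm (\<psi> z))\<^sup>2) / (1 + norm (\<psi> z)) powr (real m * q)"

lemma wdens_nonneg [simp]: "0 \<le> wdens m \<alpha> q u \<psi> z"
  by (simp add: wdens_def)

lemma wdens_measurable [measurable (raw)]:
  assumes [measurable]: "u \<in> borel_measurable borel" "\<psi> \<in> borel_measurable borel"
  shows "wdens m \<alpha> q u \<psi> \<in> borel_measurable borel"
proof -
  have [measurable]: "(\<lambda>z. exp (\<alpha> * q / 2 * (norm (\<psi> z))\<^sup>2)) \<in> borel_measurable borel"
    using measurable_compose[OF assms(2) gauss_measurable, of "- (\<alpha> * q / 2)"] by simp
  show ?thesis unfolding wdens_def
    by (intro borel_measurable_divide borel_measurable_times powr_real_measurable gauss_measurable) measurable
qed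

lemma fs_berezin_eq:
  fixes \<psi> :: "complex^'n \<Rightarrow> complex^'n"
  assumes "0 < q"
  shows "fs_berezin m \<alpha> q \<psi> (\<lambda>z. norm (u z) powr q) w =
    (\<integral>\<^sup>+z. ennreal (wdens m \<alpha> q u \<psi> z) * ennreal (exp (- (\<alpha> * q / 2) * (norm (\<psi> z - w))\<^sup>2)) \<partial>lborel)"
  unfolding fs_berezin_def
proof (rule nn_integral_cong)
  fix z :: "complex^'n"
  have "norm (\<psi> z - w)^2 = norm (\<psi> z) ^2 + norm w^2 - 2 * (\<psi> z \<bullet> w)"
    by (simp add: power2_norm_eq_inner inner_diff_left inner_diff_right inner_commute)
  then have e: "(\<alpha> * (\<psi> z \<bullet> w) - \<alpha> / 2 * (norm w)\<^sup>2) * q = \<alpha> * q / 2 * (norm (\<psi> z))\<^sup>2 + - (\<alpha> * q / 2) * (norm (\<psi> z - w))\<^sup>2"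
    by algebra
  have "norm (fock_kernel \<alpha> w (\<psi> z)) powr q = exp ((\<alpha> * (\<psi> z \<bullet> w) - \<alpha> / 2 * (norm w)\<^sup>2) * q)"
    by (simp add: fock_kernel_def Re_herm exp_powr_real del: of_real_mult of_real_power)
  also have "\<dots> = exp (\<alpha> * q / 2 * (norm (\<psi> z))\<^sup>2) * exp (- (\<alpha> * q / 2) * (norm (\<psi> z - w))\<^sup>2)"
    unfolding e exp_add ..
  finally show "ennreal (norm (fock_kernel \<alpha> w (\<psi> z)) powr q / (1 + norm (\<psi> z)) powr (real m * q) *
                     norm (u z) powr q * (norm z ^ m) powr q * exp (- (\<alpha> * q / 2) * (norm z)\<^sup>2)) =
     ennreal (wdens m \<alpha> q u \<psi> z) * ennreal (exp (- (\<alpha> * q / 2) * (norm (\<psi> z - w))\<^sup>2))"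
    by (simp add: wdens_def flip: ennreal_mult)
qed

lemma fs_mass_wcomp:
  fixes \<psi> :: "complex^'n \<Rightarrow> complex^'n"
  assumes "0 < q"
  shows "fs_mass m \<alpha> q (wcomp u \<psi> f) = (\<integral>\<^sup>+z. ennreal (wdens m \<alpha> q u \<psi> z) * ennreal (fock_mod m \<alpha> f (\<psi> z) powr q) \<partial>lborel)"
  unfolding fs_mass_def
proof (rule nn_integral_cong)
  fix z :: "complex^'n"
  have pos: "0 < 1 + norm (\<psi> z)" by (simp add: add_pos_nonneg)
  have "fock_mod m \<alpha> f (\<psi> z) powr q = (1 + norm (\<psi> z)) powr (real m * q) * norm (f (\<psi> z)) powr q * exp (- (\<alpha> * q / 2) * (norm (\<psi> z))\<^sup>2)"
    using pos by (simp add: fock_mod_def powr_mult exp_powr_real powr_powr mult_ac flip: powr_realpow)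
  moreover have "X * exp (\<alpha> * q / 2 * (norm (\<psi> z))\<^sup>2) / (1 + norm (\<psi> z)) powr (real m * q) *
     ((1 + norm (\<psi> z)) powr (real m * q) * Y * exp (- (\<alpha> * q / 2) * (norm (\<psi> z))\<^sup>2)) = X * Y" for X Y
  proof -
    have "A * E / P * (P * Y * e) = A * Y * (E * e)" if "P \<noteq> 0" for A E P Y e :: real using that by simp
    from this[of "(1 + norm (\<psi> z)) powr (real m * q)" X] show ?thesis using pos by (simp flip: exp_add)
  qed
  ultimately have "wdens m \<alpha> q u \<psi> z * fock_mod m \<alpha> f (\<psi> z) powr q =
     norm (u z) powr q * (norm z ^ m) powr q * exp (- (\<alpha> * q / 2) * (norm z)\<^sup>2) * norm (f (\<psi> z)) powr q"
    unfolding wdens_def by (simp only:)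
  then show "ennreal ((norm z ^ m) powr q * norm (wcomp u \<psi> f z) powr q * exp (- (\<alpha> * q / 2) * (norm z)\<^sup>2)) =
    ennreal (wdens m \<alpha> q u \<psi> z) * ennreal (fock_mod m \<alpha> f (\<psi> z) powr q)"
    by (simp add: wcomp_def norm_mult powr_mult mult_ac flip: ennreal_mult)
qed

lemma fs_berezin_measurable:
  fixes \<psi> :: "complex^'n \<Rightarrow> complex^'n"
  assumes u: "entire u" and \<psi>: "entire_map \<psi>" and q: "0 < q"
  shows "fs_berezin m \<alpha> q \<psi> (\<lambda>z. norm (u z) powr q) \<in> borel_measurable borel"
proof -
  note [measurable] = entire_measurable[OF u] entire_map_measurable[OF \<psi>]
  define D where "D = (\<lambda>z. ennreal (wdens m \<alpha> q u \<psi> z))"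
  define E where "E = (\<lambda>w z. ennreal (exp (- (\<alpha> * q / 2) * (norm (\<psi> z - w))\<^sup>2)))"
  have [measurable]: "D \<in> borel_measurable borel" unfolding D_def by measurable
  have [measurable]: "(\<lambda>x. E (fst x) (snd x)) \<in> borel_measurable (lborel \<Otimes>\<^sub>M (lborel :: (complex^'n) measure))"
    unfolding E_def by (rule measurable_compose[OF measurable_compose[OF _ gauss_measurable] measurable_ennreal]) measurable
  have "(\<lambda>w. \<integral>\<^sup>+z. D z * E w z \<partial>lborel) \<in> borel_measurable lborel"
    by (rule lborel.borel_measurable_nn_integral) (simp add: split_beta')
  then show ?thesis by (simp add: fs_berezin_eq[OF q, abs_def] D_def E_def)
qed

lemma embedding_pointwise:
  assumes q: "0 < (q::real)" and \<alpha>: "0 < \<alpha>"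
  obtains C where "0 < C" "\<And>(f :: complex^'n \<Rightarrow> complex) \<zeta>. entire f \<Longrightarrow>
     ennreal (fock_mod m \<alpha> f \<zeta> powr q) \<le> ennreal C * (\<integral>\<^sup>+w. ennreal (fock_mod m \<alpha> f w powr q) * ennreal (exp (- (\<alpha> * q / 2) * (norm (\<zeta> - w))\<^sup>2)) \<partial>lborel)"
proof -
  obtain C where C: "0 < C" "\<And>(f :: complex^'n \<Rightarrow> complex) a r. entire f \<Longrightarrow> 0 < r \<Longrightarrow> r \<le> 1 \<Longrightarrow>
     ennreal (fock_mod m \<alpha> f a powr q * r ^ DIM(complex^'n)) \<le>
     ennreal C * (\<integral>\<^sup>+w. ennreal (fock_mod m \<alpha> f w powr q) * indicator (ball a r) w \<partial>lborel)"
    using fock_mod_mean_le[OF q \<alpha>, of m] by blast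
  show ?thesis
  proof (rule that[of "C * exp (\<alpha> * q / 2)"])
    show "0 < C * exp (\<alpha> * q / 2)" using C by simp
    fix f :: "complex^'n \<Rightarrow> complex" and \<zeta> :: "complex^'n" assume f: "entire f"
    note [measurable] = entire_measurable[OF f]
    have [measurable]: "(\<lambda>w. exp (- (\<alpha> * q / 2) * (norm (\<zeta> - w))\<^sup>2)) \<in> borel_measurable borel"
      by (rule measurable_compose[OF _ gauss_measurable]) measurable
    have "ennreal (fock_mod m \<alpha> f \<zeta> powr q) \<le> ennreal C * (\<integral>\<^sup>+w. ennreal (fock_mod m \<alpha> f w powr q) * indicator (ball \<zeta> 1) w \<partial>lborel)"
      using C(2)[OF f, of 1 \<zeta>] by simp
    also have "\<dots> \<le> ennreal C * (\<integral>\<^sup>+w. ennreal (exp (\<alpha> * q / 2)) * (ennreal (fock_mod m \<alpha> f w powr q) * ennreal (exp (- (\<alpha> * q / 2) * (norm (\<zeta> - w))\<^sup>2))) \<partial>lborel)"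
    proof (intro mult_left_mono nn_integral_mono)
      fix w
      show "ennreal (fock_mod m \<alpha> f w powr q) * indicator (ball \<zeta> 1) w \<le>
        ennreal (exp (\<alpha> * q / 2)) * (ennreal (fock_mod m \<alpha> f w powr q) * ennreal (exp (- (\<alpha> * q / 2) * (norm (\<zeta> - w))\<^sup>2)))"
      proof (cases "w \<in> ball \<zeta> 1")
        case True
        then have "(norm (\<zeta> - w))\<^sup>2 \<le> 1" by (simp add: dist_norm power_le_one)
        then have "\<alpha> * q / 2 * (norm (\<zeta> - w))\<^sup>2 \<le> \<alpha> * q / 2 * 1" using q \<alpha> by (intro mult_left_mono) auto
        then have "1 \<le> exp (\<alpha> * q / 2) * exp (- (\<alpha> * q / 2) * (norm (\<zeta> - w))\<^sup>2)" by (simp flip: exp_add)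
        from mult_left_mono[OF this, of "fock_mod m \<alpha> f w powr q"]
        have "fock_mod m \<alpha> f w powr q \<le> exp (\<alpha> * q / 2) * (fock_mod m \<alpha> f w powr q * exp (- (\<alpha> * q / 2) * (norm (\<zeta> - w))\<^sup>2))"
          by (simp add: mult_ac)
        from ennreal_leI[OF this] show ?thesis using True by (simp add: ennreal_mult)
      qed simp
    qed simp
    also have "\<dots> = ennreal (C * exp (\<alpha> * q / 2)) * (\<integral>\<^sup>+w. ennreal (fock_mod m \<alpha> f w powr q) * ennreal (exp (- (\<alpha> * q / 2) * (norm (\<zeta> - w))\<^sup>2)) \<partial>lborel)"
      using C(1) by (subst nn_integral_cmult) (auto simp: ennreal_mult mult.assoc)
    finally show "ennreal (fock_mod m \<alpha> f \<zeta> powr q) \<le> ennreal (C * exp (\<alpha> * q / 2)) * (\<integral>\<^sup>+w. ennreal (fock_mod m \<alpha> f w powr q) * ennreal (exp (- (\<alpha> * q / 2) * (norm (\<zeta> - w))\<^sup>2)) \<partial>lborel)" .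
  qed
qed

lemma fs_mass_wcomp_le:
  assumes q: "0 < (q::real)" and \<alpha>: "0 < \<alpha>"
  obtains C where "0 < C" "\<And>(f :: complex^'n \<Rightarrow> complex) u \<psi>. entire f \<Longrightarrow> entire u \<Longrightarrow> entire_map \<psi> \<Longrightarrow>
     fs_mass m \<alpha> q (wcomp u \<psi> f) \<le> ennreal C *
       (\<integral>\<^sup>+w. ennreal (fock_mod m \<alpha> f w powr q) * fs_berezin m \<alpha> q \<psi> (\<lambda>z. norm (u z) powr q) w \<partial>lborel)"
proof -
  obtain C where C: "0 < C" "\<And>(f :: complex^'n \<Rightarrow> complex) \<zeta>. entire f \<Longrightarrow>
     ennreal (fock_mod m \<alpha> f \<zeta> powr q) \<le> ennreal C * (\<integral>\<^sup>+w. ennreal (fock_mod m \<alpha> f w powr q) * ennreal (exp (- (\<alpha> * q / 2) * (norm (\<zeta> - w))\<^sup>2)) \<partial>lborel)"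
    using embedding_pointwise[OF q \<alpha>, of m] by blast
  show ?thesis
  proof (rule that[OF C(1)])
    fix f u :: "complex^'n \<Rightarrow> complex" and \<psi> :: "complex^'n \<Rightarrow> complex^'n"
    assume f: "entire f" and u: "entire u" and \<psi>: "entire_map \<psi>"
    note [measurable] = entire_measurable[OF u] entire_measurable[OF f] entire_map_measurable[OF \<psi>]
    define F where "F = (\<lambda>w. ennreal (fock_mod m \<alpha> f w powr q))"
    define D where "D = (\<lambda>z. ennreal (wdens m \<alpha> q u \<psi> z))"
    define E where "E = (\<lambda>z w. ennreal (exp (- (\<alpha> * q / 2) * (norm (\<psi> z - w))\<^sup>2)))"
    have [measurable]: "F \<in> borel_measurable borel" "D \<in> borel_measurable borel"
      unfolding F_def D_def by measurable
    have [measurable]: "(\<lambda>x. E (fst x) (snd x)) \<in> borel_measurable (lborel \<Otimes>\<^sub>M (lborel :: (complex^'n) measure))"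
      unfolding E_def by (rule measurable_compose[OF measurable_compose[OF _ gauss_measurable] measurable_ennreal]) measurable
    have [measurable]: "E z \<in> borel_measurable borel" "(\<lambda>z. E z w) \<in> borel_measurable borel" for z w
      unfolding E_def by (rule measurable_compose[OF measurable_compose[OF _ gauss_measurable] measurable_ennreal]; measurable)+
    have "fs_mass m \<alpha> q (wcomp u \<psi> f) \<le> (\<integral>\<^sup>+z. D z * (ennreal C * (\<integral>\<^sup>+w. F w * E z w \<partial>lborel)) \<partial>lborel)"
      unfolding fs_mass_wcomp[OF q] using C(2)[OF f] unfolding D_def E_def F_def
      by (intro nn_integral_mono mult_left_mono) auto
    also have "\<dots> = (\<integral>\<^sup>+z. \<integral>\<^sup>+w. ennreal C * (F w * (D z * E z w)) \<partial>lborel \<partial>lborel)"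
      by (rule nn_integral_cong) (simp add: nn_integral_cmult[symmetric] mult_ac)
    also have "\<dots> = (\<integral>\<^sup>+w. \<integral>\<^sup>+z. ennreal C * (F w * (D z * E z w)) \<partial>lborel \<partial>lborel)"
      by (rule lborel_pair.Fubini'[symmetric]) (simp add: split_beta')
    also have "\<dots> = (\<integral>\<^sup>+w. ennreal C * (F w * (\<integral>\<^sup>+z. D z * E z w \<partial>lborel)) \<partial>lborel)"
      by (rule nn_integral_cong) (simp add: nn_integral_cmult)
    also have "\<dots> = (\<integral>\<^sup>+w. ennreal C * (F w * fs_berezin m \<alpha> q \<psi> (\<lambda>z. norm (u z) powr q) w) \<partial>lborel)"
      by (simp add: fs_berezin_eq[OF q] D_def E_def)
    also have "\<dots> = ennreal C * (\<integral>\<^sup>+w. F w * fs_berezin m \<alpha> q \<psi> (\<lambda>z. norm (u z) powr q) w \<partial>lborel)"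
      by (rule nn_integral_cmult) (simp add: fs_berezin_measurable[OF u \<psi> q] borel_measurable_times_ennreal)
    finally show "fs_mass m \<alpha> q (wcomp u \<psi> f) \<le> ennreal C *
       (\<integral>\<^sup>+w. ennreal (fock_mod m \<alpha> f w powr q) * fs_berezin m \<alpha> q \<psi> (\<lambda>z. norm (u z) powr q) w \<partial>lborel)"
      by (simp add: F_def)
  qed
qed

text \<open>Used with \<open>G\<close> the transform, and with its restriction to the complement of a ball.\<close>

lemma fock_mod_Hoelder:
  fixes f :: "complex^'n \<Rightarrow> complex"
  assumes q: "0 < q" and p: "q < p" and f: "entire f" and G [measurable]: "G \<in> borel_measurable borel"
  shows "(\<integral>\<^sup>+w. ennreal (fock_mod m \<alpha> f w powr q) * G w \<partial>lborel) \<le> epow (fock_mass m \<alpha> p f) (q / p) * Lr_norm (p / (p - q)) G"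
proof -
  note [measurable] = entire_measurable[OF f]
  have ab: "1 < p / q" "1 < p / (p - q)" "1 / (p / q) + 1 / (p / (p - q)) = 1"
    using q p by (auto simp: field_simps)
  have "epow (ennreal (fock_mod m \<alpha> f w powr q)) (p / q) = ennreal (fock_mod m \<alpha> f w powr p)" for w
    using q by (simp add: epow_ennreal powr_powr)
  then show ?thesis
    using nn_integral_Hoelder[OF ab, of "\<lambda>w. ennreal (fock_mod m \<alpha> f w powr q)" lborel G]
    unfolding fock_mass_def Lr_norm_def by simp
qed

section \<open>Test functions\<close>

text \<open>Comparison with a step function on the balls of integer radius reduces this to a series.\<close>

lemma nn_integral_exp_norm_finite:
  assumes c: "0 < (c::real)"
  shows "(\<integral>\<^sup>+v. ennreal (exp (- c * norm (v::'a::euclidean_space))) \<partial>lborel) < \<infinity>"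
proof -
  let ?N = "DIM('a)"
  let ?V = "unit_ball_vol ?N"
  define a where "a = (\<lambda>k::nat. exp (- c * real k) * (?V * (real k + 1) ^ ?N))"
  have a0: "0 \<le> a k" for k by (simp add: a_def unit_ball_vol_nonneg)
  have "(\<integral>\<^sup>+v. ennreal (exp (- c * norm (v::'a))) \<partial>lborel) \<le> (\<integral>\<^sup>+v. (\<Sum>k. ennreal (exp (- c * real k)) * indicator (ball 0 (real k + 1)) (v::'a)) \<partial>lborel)"
  proof (rule nn_integral_mono)
    fix v :: 'a
    define k where "k = nat \<lfloor>norm v\<rfloor>"
    have k: "real k \<le> norm v" "norm v < real k + 1" by (simp_all add: k_def)
    have "ennreal (exp (- c * norm v)) \<le> ennreal (exp (- c * real k)) * indicator (ball 0 (real k + 1)) v"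
      using k c by (simp add: ennreal_leI)
    also have "\<dots> \<le> (\<Sum>k. ennreal (exp (- c * real k)) * indicator (ball 0 (real k + 1)) v)"
    proof -
      have "h k \<le> (\<Sum>k. h k)" for h :: "nat \<Rightarrow> ennreal"
        using sum_le_suminf[OF summableI, of "{k}" h] by simp
      then show ?thesis .
    qed
    finally show "ennreal (exp (- c * norm v)) \<le> (\<Sum>k. ennreal (exp (- c * real k)) * indicator (ball 0 (real k + 1)) v)" .
  qed
  also have "\<dots> = (\<Sum>k. \<integral>\<^sup>+v. ennreal (exp (- c * real k)) * indicator (ball 0 (real k + 1)) (v::'a) \<partial>lborel)"
    by (rule nn_integral_suminf) (auto intro!: borel_measurable_times_ennreal borel_measurable_indicator)
  also have "\<dots> = (\<Sum>k. ennreal (a k))"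
    by (simp add: nn_integral_cmult_indicator emeasure_ball a_def unit_ball_vol_nonneg flip: ennreal_mult)
  also have "\<dots> < \<infinity>"
  proof -
    have "a \<in> O(\<lambda>k. exp (- c / 2 * real k))"
      unfolding a_def using c unit_ball_vol_pos[of ?N] by real_asymp
    moreover have "summable (\<lambda>k. norm (exp (- c / 2 * real k)))"
    proof -
      have "exp (- c / 2 * real k) = exp (- c / 2) ^ k" for k by (simp only: exp_of_nat_mult[symmetric] mult.commute)
      then show ?thesis using c by (simp add: summable_geometric)
    qed
    ultimately have "summable a" by (rule summable_comparison_test_bigo[rotated])
    from ennreal_suminf_neq_top[OF this a0] show ?thesis
      unfolding infinity_ennreal_def by (rule top.not_eq_extremum[THEN iffD1])
  qed
  finally show ?thesis .
qed

definition exp_norm_integral :: "'a::euclidean_space itself \<Rightarrow> real \<Rightarrow> real" where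
  "exp_norm_integral _ c = enn2real (\<integral>\<^sup>+v. ennreal (exp (- c * norm (v::'a))) \<partial>lborel)"

lemma exp_norm_measurable [measurable]: "(\<lambda>v::'a::real_normed_vector. exp (- c * norm v)) \<in> borel_measurable borel"
  by (intro borel_measurable_continuous_onI continuous_intros)

lemma nn_integral_exp_norm:
  assumes "0 < c"
  shows "(\<integral>\<^sup>+v. ennreal (exp (- c * norm (w - (v::'a::euclidean_space)))) \<partial>lborel) = ennreal (exp_norm_integral TYPE('a) c)"
proof -
  have "(\<integral>\<^sup>+v. ennreal (exp (- c * norm (w - (v::'a)))) \<partial>lborel) = (\<integral>\<^sup>+v. ennreal (exp (- c * norm (v::'a))) \<partial>lborel)"
    by (rule nn_integral_lborel_reflection[of "\<lambda>v. ennreal (exp (- c * norm v))"]) measurable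
  then show ?thesis
    using nn_integral_exp_norm_finite[OF assms, where 'a = 'a] by (simp add: exp_norm_integral_def)
qed

text \<open>The balls of radius \<open>1 / 2\<close> around the points are disjoint, and the exponential is comparable to
  its integral over each of them. So the bound depends neither on \<open>K\<close> nor on \<open>z\<close>.\<close>

lemma separated_sum_exp:
  obtains S where "0 < S" "\<And>K (z::'a::euclidean_space). finite K \<Longrightarrow> (\<And>x y. x \<in> K \<Longrightarrow> y \<in> K \<Longrightarrow> x \<noteq> y \<Longrightarrow> 1 \<le> dist x y) \<Longrightarrow>
     (\<Sum>w\<in>K. exp (- norm (z - w))) \<le> S"
proof -
  define V where "V = unit_ball_vol DIM('a) * (1 / 2) ^ DIM('a)"
  have V: "0 < V" by (simp add: V_def unit_ball_vol_pos)
  define I where "I = exp_norm_integral TYPE('a) 1"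
  have I: "0 \<le> I" by (simp add: I_def exp_norm_integral_def)
  show ?thesis
  proof (rule that[of "exp (1 / 2) * I / V + 1"])
    show "0 < exp (1 / 2) * I / V + 1" using V I by (simp add: add_nonneg_pos)
    fix K :: "'a set" and z :: 'a assume K: "finite K" and sep: "\<And>x y. x \<in> K \<Longrightarrow> y \<in> K \<Longrightarrow> x \<noteq> y \<Longrightarrow> 1 \<le> dist x y"
    have [measurable]: "(\<lambda>v. exp (- norm (z - v))) \<in> borel_measurable borel"
      by (intro borel_measurable_continuous_onI continuous_intros)
    let ?g = "\<lambda>v. ennreal (exp (1 / 2) * exp (- norm (z - v)))"
    have "ennreal ((\<Sum>w\<in>K. exp (- norm (z - w))) * V) = (\<Sum>w\<in>K. ennreal (exp (- norm (z - w)) * V))"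
      using V by (simp add: sum_distrib_right)
    also have "\<dots> \<le> (\<Sum>w\<in>K. \<integral>\<^sup>+v. ?g v * indicator (ball w (1 / 2)) v \<partial>lborel)"
    proof (rule sum_mono)
      fix w
      have "ennreal (exp (- norm (z - w)) * V) = (\<integral>\<^sup>+v. ennreal (exp (- norm (z - w))) * indicator (ball w (1 / 2)) v \<partial>lborel)"
        by (subst nn_integral_cmult_indicator) (simp_all add: emeasure_ball V_def ennreal_mult unit_ball_vol_nonneg)
      also have "\<dots> \<le> (\<integral>\<^sup>+v. ?g v * indicator (ball w (1 / 2)) v \<partial>lborel)"
      proof (rule nn_integral_mono)
        fix v
        have "norm (z - v) \<le> norm (z - w) + 1 / 2" if "v \<in> ball w (1 / 2)"
          using that dist_triangle[of z v w] by (simp add: dist_norm)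
        then have "exp (- norm (z - w)) \<le> exp (1 / 2) * exp (- norm (z - v))" if "v \<in> ball w (1 / 2)"
        proof -
          have "- norm (z - w) \<le> 1 / 2 + - norm (z - v)" using \<open>v \<in> ball w (1 / 2) \<Longrightarrow> norm (z - v) \<le> norm (z - w) + 1 / 2\<close> that by argo
          then show ?thesis unfolding exp_add[symmetric] by simp
        qed
        then show "ennreal (exp (- norm (z - w))) * indicator (ball w (1 / 2)) v \<le> ?g v * indicator (ball w (1 / 2)) v"
          by (cases "v \<in> ball w (1 / 2)") (auto intro!: ennreal_leI)
      qed
      finally show "ennreal (exp (- norm (z - w)) * V) \<le> (\<integral>\<^sup>+v. ?g v * indicator (ball w (1 / 2)) v \<partial>lborel)" .
    qed
    also have "\<dots> = (\<integral>\<^sup>+v. (\<Sum>w\<in>K. ?g v * indicator (ball w (1 / 2)) v) \<partial>lborel)"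
      by (rule nn_integral_sum[symmetric]) (auto intro!: borel_measurable_times_ennreal)
    also have "\<dots> \<le> (\<integral>\<^sup>+v. ?g v \<partial>lborel)"
    proof (rule nn_integral_mono)
      fix v
      show "(\<Sum>w\<in>K. ?g v * indicator (ball w (1 / 2)) v) \<le> ?g v"
      proof (cases "\<exists>w0\<in>K. v \<in> ball w0 (1 / 2)")
        case True
        then obtain w0 where w0: "w0 \<in> K" "v \<in> ball w0 (1 / 2)" by blast
        have "v \<notin> ball w (1 / 2)" if "w \<in> K" "w \<noteq> w0" for w
          using sep[OF that(1) w0(1) that(2)] w0(2) dist_triangle[of w w0 v] by (auto simp: dist_commute)
        then have "(\<Sum>w\<in>K. ?g v * indicator (ball w (1 / 2)) v) = (\<Sum>w\<in>{w0}. ?g v * indicator (ball w (1 / 2)) v)"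
          using K w0 by (intro sum.mono_neutral_right) auto
        also have "\<dots> = ?g v" by (subst sum.insert) (use w0(2) in \<open>auto\<close>)
        finally show ?thesis by simp
      next
        case False
        then have "(\<Sum>w\<in>K. ?g v * indicator (ball w (1 / 2)) v) = 0" by (intro sum.neutral) auto
        then show ?thesis by simp
      qed
    qed
    also have "\<dots> = ennreal (exp (1 / 2) * I)"
      using nn_integral_exp_norm[of 1 z] I by (simp add: ennreal_mult nn_integral_cmult I_def)
    finally have "(\<Sum>w\<in>K. exp (- norm (z - w))) * V \<le> exp (1 / 2) * I" using I by (simp add: ennreal_le_iff)
    then have "(\<Sum>w\<in>K. exp (- norm (z - w))) \<le> exp (1 / 2) * I / V" using V by (simp add: field_simps)
    then show "(\<Sum>w\<in>K. exp (- norm (z - w))) \<le> exp (1 / 2) * I / V + 1" by simp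
  qed
qed

text \<open>The previous bound limits the cardinality of separated subsets of a ball; one of maximal
  cardinality has the covering property.\<close>

lemma maximal_separated_set:
  obtains K :: "'a::euclidean_space set" where "finite K"
    "\<And>x y. x \<in> K \<Longrightarrow> y \<in> K \<Longrightarrow> x \<noteq> y \<Longrightarrow> 1 \<le> dist x y"
    "\<And>z. z \<in> cball 0 R \<Longrightarrow> \<exists>w\<in>K. dist z w < 1"
proof -
  obtain S where S: "0 < S" "\<And>K (z::'a). finite K \<Longrightarrow> (\<And>x y. x \<in> K \<Longrightarrow> y \<in> K \<Longrightarrow> x \<noteq> y \<Longrightarrow> 1 \<le> dist x y) \<Longrightarrow>
     (\<Sum>w\<in>K. exp (- norm (z - w))) \<le> S" using separated_sum_exp[where 'a = 'a] by blast
  define P where "P = (\<lambda>K::'a set. finite K \<and> K \<subseteq> cball 0 R \<and> (\<forall>x\<in>K. \<forall>y\<in>K. x \<noteq> y \<longrightarrow> 1 \<le> dist x y))"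
  obtain b :: nat where b: "S * exp R < real b" using reals_Archimedean2 by blast
  have "card K < b" if K: "P K" for K
  proof -
    have "real (card K) * exp (- R) \<le> (\<Sum>w\<in>K. exp (- norm (0 - w)))"
      using K by (intro sum_bounded_below) (auto simp: P_def)
    also have "\<dots> \<le> S" using K by (intro S(2)) (auto simp: P_def)
    finally have "real (card K) \<le> S * exp R" by (simp add: exp_minus field_simps)
    then show ?thesis using b by linarith
  qed
  moreover have "P {}" by (simp add: P_def)
  ultimately obtain K where K: "P K" "\<And>K'. P K' \<Longrightarrow> card K' \<le> card K"
    using ex_has_greatest_nat[of P "{}" card b] by blast
  show ?thesis
  proof (rule that[of K])
    fix z :: 'a assume z: "z \<in> cball 0 R"
    show "\<exists>w\<in>K. dist z w < 1"
    proof (rule ccontr)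
      assume neg: "\<not> (\<exists>w\<in>K. dist z w < 1)"
      then have "z \<notin> K" by force
      moreover have "P (insert z K)"
        using K(1) z neg unfolding P_def by (auto simp: dist_commute not_less)
      ultimately show False using K(1) K(2)[of "insert z K"] by (simp add: P_def)
    qed
  qed (use K in \<open>auto simp: P_def\<close>)
qed

text \<open>A graph with degrees below \<open>T\<close> has a colouring with \<open>T\<close> colours, here for the graph of
  points at distance less than \<open>L\<close>.\<close>

lemma greedy_colouring:
  fixes K :: "'a::metric_space set"
  assumes "finite K" "\<And>x. x \<in> K \<Longrightarrow> card {y\<in>K. y \<noteq> x \<and> dist x y < L} < T"
  shows "\<exists>col. \<forall>x\<in>K. col x < T \<and> (\<forall>y\<in>K. x \<noteq> y \<and> col x = col y \<longrightarrow> L \<le> dist x y)"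
  using assms
proof (induction K rule: finite_induct)
  case (insert a K)
  have "card {y\<in>K. y \<noteq> x \<and> dist x y < L} < T" if "x \<in> K" for x
    by (rule le_less_trans[OF card_mono insert.prems[of x]]) (use insert.hyps that in auto)
  from insert.IH[OF this] obtain col where col: "\<And>x. x \<in> K \<Longrightarrow> col x < T"
    "\<And>x y. x \<in> K \<Longrightarrow> y \<in> K \<Longrightarrow> x \<noteq> y \<Longrightarrow> col x = col y \<Longrightarrow> L \<le> dist x y" by blast
  let ?B = "{y\<in>K. dist a y < L}"
  have "{y \<in> insert a K. y \<noteq> a \<and> dist a y < L} = ?B" using insert.hyps by auto
  then have "card ?B < T" using insert.prems[of a] by simp
  moreover have "card (col ` ?B) \<le> card ?B" using insert.hyps by (intro card_image_le) auto
  ultimately have "card (col ` ?B) < card {..<T}" by simp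
  then have "\<not> {..<T} \<subseteq> col ` ?B"
    using card_mono[of "col ` ?B" "{..<T}"] insert.hyps by auto
  then obtain c where c: "c < T" "c \<notin> col ` ?B" by auto
  have "\<forall>x\<in>insert a K. (col(a := c)) x < T \<and> (\<forall>y\<in>insert a K. x \<noteq> y \<and> (col(a := c)) x = (col(a := c)) y \<longrightarrow> L \<le> dist x y)"
    using insert.hyps col c by (auto simp: dist_commute image_iff not_less)
  then show ?case by blast
qed auto

lemma fock_mod_kernel:
  fixes z w :: "complex^'n"
  shows "fock_mod m \<alpha> (fock_kernel \<alpha> w) z = (1 + norm z) ^ m * exp (- (\<alpha> / 2) * (norm (z - w))\<^sup>2)"
proof -
  have "norm (z - w)^2 = norm z ^2 + norm w^2 - 2 * (z \<bullet> w)"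
    by (simp add: power2_norm_eq_inner inner_diff_left inner_diff_right inner_commute)
  then have e: "(\<alpha> * (z \<bullet> w) - \<alpha> / 2 * (norm w)\<^sup>2) + - (\<alpha> / 2) * (norm z)\<^sup>2 = - (\<alpha> / 2) * (norm (z - w))\<^sup>2"
    by algebra
  have "norm (fock_kernel \<alpha> w z) = exp (\<alpha> * (z \<bullet> w) - \<alpha> / 2 * (norm w)\<^sup>2)"
    by (simp add: fock_kernel_def Re_herm del: of_real_mult of_real_power)
  then show ?thesis unfolding fock_mod_def using e by (simp add: mult.assoc flip: exp_add)
qed

lemma entire_fock_kernel: "entire (fock_kernel \<alpha> w)"
  unfolding fock_kernel_def by (intro entire_exp entire_diff entire_mult entire_const entire_herm)

text \<open>A maximal \<open>1\<close>-separated set of points is split into boundedly many classes of separation \<open>L\<close>, and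
  each class contributes the sum of its normalized kernels with coefficients \<open>\<phi>\<close>. Slow variation
  moves the coefficient \<open>\<phi> w\<close> to \<open>\<phi> z\<close>, at a cost that the Gaussian absorbs.\<close>

lemma test_functions:
  assumes \<alpha>: "0 < \<alpha>" and \<delta>: "0 \<le> \<delta>"
  obtains A c :: real and T :: nat where "0 < A" "0 < c"
    "\<And>\<phi> R. (\<And>w. 0 \<le> \<phi> w) \<Longrightarrow> (\<And>w v. \<phi> w \<le> exp (\<delta> * norm (w - v)) * \<phi> v) \<Longrightarrow>
      \<exists>F :: nat \<Rightarrow> complex^'n \<Rightarrow> complex. (\<forall>t<T. entire (F t) \<and> (\<forall>z. fock_mod m \<alpha> (F t) z \<le> A * \<phi> z)) \<and>
        (\<forall>z\<in>cball 0 R. \<exists>t<T. c * \<phi> z \<le> fock_mod m \<alpha> (F t) z)"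
proof -
  obtain S where S: "0 < S" "\<And>K (z::complex^'n). finite K \<Longrightarrow> (\<And>x y. x \<in> K \<Longrightarrow> y \<in> K \<Longrightarrow> x \<noteq> y \<Longrightarrow> 1 \<le> dist x y) \<Longrightarrow>
     (\<Sum>w\<in>K. exp (- norm (z - w))) \<le> S" using separated_sum_exp by blast
  define B where "B = exp ((real m + \<delta> + 2)\<^sup>2 / (2 * \<alpha>))"
  have B: "0 < B" by (simp add: B_def)
  \<comment> \<open>Gaussian decay beats the polynomial weight and the variation of \<open>\<phi>\<close>; complete the square.\<close>
  have gauss: "(1 + d) ^ m * exp (\<delta> * d) * exp (- (\<alpha> / 2) * d\<^sup>2) \<le> B * exp (- 2 * d)" if "0 \<le> d" for d
  proof -
    have "(1 + d) ^ m \<le> exp d ^ m" using that exp_ge_add_one_self[of d] by (intro power_mono) auto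
    then have "(1 + d) ^ m * (exp (\<delta> * d) * exp (- (\<alpha> / 2) * d\<^sup>2)) \<le> exp d ^ m * (exp (\<delta> * d) * exp (- (\<alpha> / 2) * d\<^sup>2))"
      by (intro mult_right_mono) auto
    also have "\<dots> = exp (real m * d + (\<delta> * d + - (\<alpha> / 2) * d\<^sup>2))"
      by (simp only: exp_of_nat_mult exp_add)
    also have "\<dots> \<le> exp ((real m + \<delta> + 2)\<^sup>2 / (2 * \<alpha>) + - 2 * d)"
    proof -
      have "0 \<le> ((real m + \<delta> + 2) - \<alpha> * d)\<^sup>2 / (2 * \<alpha>)" using \<alpha> by simp
      also have "\<dots> = (real m + \<delta> + 2)\<^sup>2 / (2 * \<alpha>) - (real m + \<delta> + 2) * d + \<alpha> / 2 * d\<^sup>2"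
      proof -
        have "(M - \<alpha> * d)\<^sup>2 / (2 * \<alpha>) = M\<^sup>2 / (2 * \<alpha>) - M * d + \<alpha> / 2 * d\<^sup>2" for M
          using \<alpha> by (simp add: power2_eq_square field_simps)
        then show ?thesis .
      qed
      finally show ?thesis unfolding exp_le_cancel_iff by (simp add: distrib_right)
    qed
    also have "\<dots> = B * exp (- 2 * d)" by (simp only: exp_add B_def)
    finally show ?thesis by (simp add: mult.assoc)
  qed
  define c where "c = exp (- \<delta>) * (1 / 2) ^ m * exp (- (\<alpha> / 2)) / 2"
  have c: "0 < c" by (simp add: c_def)
  \<comment> \<open>The separation of a class of points: the far terms are at most half of the near one.\<close>
  have "((\<lambda>L. B * S * exp (1 - L)) \<longlongrightarrow> 0) at_top" using B S(1) by real_asymp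
  then have "eventually (\<lambda>L. B * S * exp (1 - L) < c) at_top" using c by (rule order_tendstoD)
  then obtain L where L: "B * S * exp (1 - L) < c"
    using eventually_happens'[OF trivial_limit_at_top_linorder] by blast
  obtain T :: nat where T: "S * exp L < real T" using reals_Archimedean2 by blast
  show ?thesis
  proof (rule that[of "B * S" c T])
    show "0 < B * S" "0 < c" using B S(1) c by simp_all
    fix \<phi> :: "complex^'n \<Rightarrow> real" and R :: real
    assume \<phi>0: "\<And>w. 0 \<le> \<phi> w" and slow: "\<And>w v. \<phi> w \<le> exp (\<delta> * norm (w - v)) * \<phi> v"
    obtain K :: "(complex^'n) set" where K: "finite K" "\<And>x y. x \<in> K \<Longrightarrow> y \<in> K \<Longrightarrow> x \<noteq> y \<Longrightarrow> 1 \<le> dist x y"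
      "\<And>z. z \<in> cball 0 R \<Longrightarrow> \<exists>w\<in>K. dist z w < 1"
      using maximal_separated_set[of R] by blast
    have sumle: "(\<Sum>w\<in>K'. exp (- norm (z - w))) \<le> S" if "K' \<subseteq> K" for K' z
      using that K(1,2) by (intro S(2)) (auto intro: finite_subset)
    have "card {y\<in>K. y \<noteq> x \<and> dist x y < L} < T" for x
    proof -
      let ?D = "{y\<in>K. y \<noteq> x \<and> dist x y < L}"
      have "real (card ?D) * exp (- L) \<le> (\<Sum>w\<in>?D. exp (- norm (x - w)))"
        by (intro sum_bounded_below) (auto simp: dist_norm)
      also have "\<dots> \<le> S" by (rule sumle) auto
      finally have "real (card ?D) \<le> S * exp L" by (simp add: exp_minus field_simps)
      then show ?thesis using T by linarith
    qed
    from greedy_colouring[OF K(1) this] obtain col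
      where "\<forall>x\<in>K. col x < T \<and> (\<forall>y\<in>K. x \<noteq> y \<and> col x = col y \<longrightarrow> L \<le> dist x y)" by (rule exE)
    then have col: "\<And>x. x \<in> K \<Longrightarrow> col x < T"
      "\<And>x y. x \<in> K \<Longrightarrow> y \<in> K \<Longrightarrow> x \<noteq> y \<Longrightarrow> col x = col y \<Longrightarrow> L \<le> dist x y"
      by auto
    define Kt where "Kt = (\<lambda>t. {w\<in>K. col w = t})"
    have Kt: "finite (Kt t)" "Kt t \<subseteq> K" for t using K(1) by (auto simp: Kt_def)
    define G where "G = (\<lambda>w z. of_real (\<phi> w / (1 + norm w) ^ m) * fock_kernel \<alpha> w z)"
    define F where "F = (\<lambda>t z. \<Sum>w\<in>Kt t. G w z)"
    have entG: "entire (G w)" for w unfolding G_def by (intro entire_mult entire_const entire_fock_kernel)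
    have entF: "entire (F t)" for t unfolding F_def by (intro entire_sum Kt entG)
    have modG: "fock_mod m \<alpha> (G w) z = \<phi> w * ((1 + norm z) / (1 + norm w)) ^ m * exp (- (\<alpha> / 2) * (norm (z - w))\<^sup>2)" for w z
    proof -
      have "0 \<le> \<phi> w / (1 + norm w) ^ m" using \<phi>0[of w] by (intro divide_nonneg_nonneg zero_le_power) auto
      then have "norm (G w z) = \<phi> w / (1 + norm w) ^ m * norm (fock_kernel \<alpha> w z)"
        by (simp only: G_def norm_mult norm_of_real abs_of_nonneg)
      then have "fock_mod m \<alpha> (G w) z = \<phi> w / (1 + norm w) ^ m * fock_mod m \<alpha> (fock_kernel \<alpha> w) z"
        by (simp only: fock_mod_def mult_ac)
      then show ?thesis by (simp add: fock_mod_kernel power_divide)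
    qed
    have modG_le: "fock_mod m \<alpha> (G w) z \<le> \<phi> z * (B * exp (- 2 * norm (z - w)))" for w z
    proof -
      let ?d = "norm (z - w)"
      have "(1 + norm z) / (1 + norm w) \<le> 1 + ?d"
        using one_plus_norm_le[of z w] by (simp add: divide_le_eq add_pos_nonneg mult.commute)
      then have "((1 + norm z) / (1 + norm w)) ^ m \<le> (1 + ?d) ^ m" by (intro power_mono) auto
      then have "fock_mod m \<alpha> (G w) z \<le> (exp (\<delta> * ?d) * \<phi> z) * (1 + ?d) ^ m * exp (- (\<alpha> / 2) * ?d\<^sup>2)"
        unfolding modG using \<phi>0[of w] \<phi>0[of z] slow[of w z]
        by (intro mult_mono mult_nonneg_nonneg) (auto simp: norm_minus_commute)
      also have "\<dots> = \<phi> z * ((1 + ?d) ^ m * exp (\<delta> * ?d) * exp (- (\<alpha> / 2) * ?d\<^sup>2))" by (simp add: mult_ac)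
      also have "\<dots> \<le> \<phi> z * (B * exp (- 2 * ?d))" by (intro mult_left_mono gauss \<phi>0) auto
      finally show ?thesis .
    qed
    have mod_sum: "fock_mod m \<alpha> (\<lambda>z. \<Sum>w\<in>K'. G w z) z \<le> (\<Sum>w\<in>K'. fock_mod m \<alpha> (G w) z)" for K' z
    proof -
      have "fock_mod m \<alpha> (\<lambda>z. \<Sum>w\<in>K'. G w z) z \<le> (1 + norm z) ^ m * (\<Sum>w\<in>K'. norm (G w z)) * exp (- (\<alpha> / 2) * (norm z)\<^sup>2)"
        unfolding fock_mod_def by (intro mult_right_mono mult_left_mono norm_sum) auto
      then show ?thesis by (simp add: fock_mod_def sum_distrib_left sum_distrib_right)
    qed
    have upper: "fock_mod m \<alpha> (F t) z \<le> B * S * \<phi> z" for t z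
    proof -
      have "fock_mod m \<alpha> (F t) z \<le> (\<Sum>w\<in>Kt t. \<phi> z * (B * exp (- norm (z - w))))"
        unfolding F_def
        by (rule order_trans[OF mod_sum], intro sum_mono, rule order_trans[OF modG_le])
           (use \<phi>0 B in \<open>auto intro!: mult_left_mono\<close>)
      also have "\<dots> = \<phi> z * B * (\<Sum>w\<in>Kt t. exp (- norm (z - w)))" by (simp add: sum_distrib_left mult.assoc)
      also have "\<dots> \<le> \<phi> z * B * S" using \<phi>0 B by (intro mult_left_mono sumle Kt) auto
      finally show ?thesis by (simp add: mult_ac)
    qed
    have lower: "\<exists>t<T. c * \<phi> z \<le> fock_mod m \<alpha> (F t) z" if z: "z \<in> cball 0 R" for z
    proof -
      obtain w0 where w0: "w0 \<in> K" "dist z w0 < 1" using K(3)[OF z] by blast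
      define t where "t = col w0"
      have d0: "norm (z - w0) < 1" using w0 by (simp add: dist_norm)
      let ?rest = "Kt t - {w0}"
      have w0t: "w0 \<in> Kt t" using w0 by (simp add: Kt_def t_def)
      have far: "L - 1 \<le> norm (z - w)" if "w \<in> ?rest" for w
      proof -
        have "L \<le> dist w0 w" using that w0 by (intro col(2)) (auto simp: Kt_def t_def)
        then show ?thesis using dist_triangle[of w0 w z] w0(2) by (simp add: dist_norm norm_minus_commute)
      qed
      have far': "- 2 * norm (z - w) \<le> (1 - L) + - norm (z - w)" if "w \<in> ?rest" for w
        using far[OF that] by linarith
      have rest: "fock_mod m \<alpha> (\<lambda>z. \<Sum>w\<in>?rest. G w z) z \<le> c * \<phi> z"
      proof -
        have "fock_mod m \<alpha> (\<lambda>z. \<Sum>w\<in>?rest. G w z) z \<le> (\<Sum>w\<in>?rest. \<phi> z * (B * (exp (1 - L) * exp (- norm (z - w)))))"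
          by (rule order_trans[OF mod_sum], intro sum_mono, rule order_trans[OF modG_le])
             (use \<phi>0 B far' in \<open>simp_all add: mult_left_mono flip: exp_add\<close>)
        also have "\<dots> = \<phi> z * B * exp (1 - L) * (\<Sum>w\<in>?rest. exp (- norm (z - w)))" by (simp add: sum_distrib_left mult.assoc)
        also have "\<dots> \<le> \<phi> z * B * exp (1 - L) * S" using \<phi>0 B Kt by (intro mult_left_mono sumle) auto
        also have "\<dots> = \<phi> z * (B * S * exp (1 - L))" by (simp add: mult_ac)
        also have "\<dots> \<le> \<phi> z * c" using L \<phi>0 by (intro mult_left_mono) auto
        finally show ?thesis by (simp add: mult_ac)
      qed
      have main: "2 * c * \<phi> z \<le> fock_mod m \<alpha> (G w0) z"
      proof -
        have "\<phi> z \<le> exp \<delta> * \<phi> w0"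
        proof -
          have "\<phi> z \<le> exp (\<delta> * norm (z - w0)) * \<phi> w0" by (rule slow)
          also have "\<dots> \<le> exp \<delta> * \<phi> w0"
            using d0 \<delta> \<phi>0 by (intro mult_right_mono) (auto simp: mult_left_le)
          finally show ?thesis .
        qed
        then have 1: "exp (- \<delta>) * \<phi> z \<le> \<phi> w0" by (simp add: exp_minus field_simps)
        have "1 + norm w0 \<le> 2 * (1 + norm z)"
        proof -
          have "norm w0 \<le> norm z + 1" using d0 norm_triangle_sub[of w0 z] by (simp add: norm_minus_commute)
          then show ?thesis using norm_ge_zero[of z] by argo
        qed
        moreover have "0 < 1 + norm w0" by (simp add: add_pos_nonneg)
        ultimately have 2: "1 / 2 \<le> (1 + norm z) / (1 + norm w0)" by (simp add: field_simps)
        have 3: "exp (- (\<alpha> / 2)) \<le> exp (- (\<alpha> / 2) * (norm (z - w0))\<^sup>2)"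
        proof -
          have "(norm (z - w0))\<^sup>2 \<le> 1" using d0 by (simp add: power_le_one)
          then have "\<alpha> / 2 * (norm (z - w0))\<^sup>2 \<le> \<alpha> / 2 * 1" using \<alpha> by (intro mult_left_mono) auto
          then show ?thesis by simp
        qed
        have "2 * c * \<phi> z = (exp (- \<delta>) * \<phi> z) * (1 / 2) ^ m * exp (- (\<alpha> / 2))" by (simp add: c_def)
        also have "\<dots> \<le> fock_mod m \<alpha> (G w0) z"
          unfolding modG using 1 2 3 \<phi>0 by (intro mult_mono power_mono mult_nonneg_nonneg) auto
        finally show ?thesis .
      qed
      have "fock_mod m \<alpha> (G w0) z \<le> fock_mod m \<alpha> (F t) z + fock_mod m \<alpha> (\<lambda>z. \<Sum>w\<in>?rest. G w z) z"
      proof -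
        have "F t z = G w0 z + (\<Sum>w\<in>?rest. G w z)" unfolding F_def using Kt(1) w0t by (rule sum.remove)
        then have "norm (G w0 z) \<le> norm (F t z) + norm (\<Sum>w\<in>?rest. G w z)"
          by (metis add_diff_cancel_right' norm_triangle_ineq4)
        then have "(1 + norm z) ^ m * norm (G w0 z) * exp (- (\<alpha> / 2) * (norm z)\<^sup>2) \<le>
          (1 + norm z) ^ m * (norm (F t z) + norm (\<Sum>w\<in>?rest. G w z)) * exp (- (\<alpha> / 2) * (norm z)\<^sup>2)"
          by (intro mult_right_mono mult_left_mono) auto
        then show ?thesis by (simp add: fock_mod_def algebra_simps)
      qed
      then have "c * \<phi> z \<le> fock_mod m \<alpha> (F t) z" using main rest by argo
      then show ?thesis using col(1)[OF w0(1)] by (auto simp: t_def)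
    qed
    show "\<exists>F. (\<forall>t<T. entire (F t) \<and> (\<forall>z. fock_mod m \<alpha> (F t) z \<le> B * S * \<phi> z)) \<and>
        (\<forall>z\<in>cball 0 R. \<exists>t<T. c * \<phi> z \<le> fock_mod m \<alpha> (F t) z)"
      using entF upper lower by (intro exI[of _ F]) blast
  qed
qed

section \<open>Necessity: the transform lies in \<open>L\<^sup>r\<close>\<close>

lemma epow_SUP:
  assumes r: "0 < r"
  shows "epow (SUP i::nat. X i) r = (SUP i. epow (X i) r)"
proof (rule antisym)
  have "(SUP i. X i) \<le> epow (SUP i. epow (X i) r) (1 / r)"
  proof (rule SUP_least)
    fix i
    have "X i = epow (epow (X i) r) (1 / r)" using r by (simp add: epow_epow)
    also have "\<dots> \<le> epow (SUP i. epow (X i) r) (1 / r)" using r by (intro epow_mono SUP_upper) auto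
    finally show "X i \<le> epow (SUP i. epow (X i) r) (1 / r)" .
  qed
  then have "epow (SUP i. X i) r \<le> epow (epow (SUP i. epow (X i) r) (1 / r)) r" using r by (intro epow_mono) auto
  then show "epow (SUP i. X i) r \<le> (SUP i. epow (X i) r)" using r by (simp add: epow_epow)
  show "(SUP i. epow (X i) r) \<le> epow (SUP i. X i) r"
    using r by (intro SUP_least epow_mono SUP_upper) auto
qed

text \<open>Hence the density is integrable on balls, whatever its growth.\<close>

lemma wdens_continuous:
  assumes u: "entire u" and \<psi>: "entire_map \<psi>" and q: "0 < q"
  shows "continuous_on S (wdens m \<alpha> q u \<psi>)"
proof -
  have "1 + norm (\<psi> z) \<noteq> 0" for z using norm_ge_zero[of "\<psi> z"] by linarith
  then show ?thesis
    unfolding wdens_def using q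
    by (intro continuous_on_divide continuous_on_mult continuous_on_powr' continuous_on_exp continuous_on_norm
        continuous_on_power continuous_on_add continuous_on_const continuous_on_id
        entire_imp_continuous_on[OF u] entire_map_continuous[OF \<psi>]) (auto simp: add_nonneg_eq_0_iff)
qed

text \<open>Let \<open>E w\<close> be the mean of the image measure against \<open>exp (- |w - \<cdot>|)\<close>, and let \<open>H w\<close> be that of
  \<open>E\<^sup>r\<close> against the same kernel. Both change by at most the factor \<open>exp |w - v|\<close>, so \<open>H\<close> dominates a
  multiple of \<open>E\<^sup>r\<close>, and its integral is a multiple of that of \<open>E\<^sup>r\<close>. The test function is
  \<open>\<phi> = H\<^sup>1\<^sup>/\<^sup>p\<close>: the rate of \<open>\<phi>\<^sup>q\<close> is \<open>q / p < 1\<close>, less than that of the kernel, so the mean of \<open>\<phi>\<^sup>q\<close>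
  against the kernel is at most a multiple of \<open>\<phi>\<^sup>q\<close>. Since \<open>r q / p + 1 = r\<close>, the integral of
  \<open>\<phi>\<^sup>q E\<close> dominates that of \<open>E\<^sup>r\<close>; and the tested inequality bounds it by the power \<open>q / p\<close> of that
  same integral. The integral is finite because \<open>D\<close> is integrable and \<open>\<psi>\<close> bounded where \<open>D\<close> does
  not vanish.\<close>

lemma exponential_mean_Lr_le:
  fixes \<psi> :: "complex^'n \<Rightarrow> complex^'n"
  assumes q: "0 < q" and p: "q < p"
  defines "r \<equiv> p / (p - q)"
  obtains C where "0 < C" "\<And>D \<psi> R' \<Lambda>. D \<in> borel_measurable borel \<Longrightarrow> \<psi> \<in> borel_measurable borel \<Longrightarrow>
     (\<And>z. 0 \<le> D z) \<Longrightarrow> (\<integral>\<^sup>+z. ennreal (D z) \<partial>lborel) < \<infinity> \<Longrightarrow> (\<And>z::complex^'n. D z \<noteq> 0 \<Longrightarrow> norm (\<psi> z :: complex^'n) \<le> R') \<Longrightarrow> 0 \<le> \<Lambda> \<Longrightarrow>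
     (\<And>\<phi>. \<phi> \<in> borel_measurable borel \<Longrightarrow> (\<And>w. 0 \<le> \<phi> w) \<Longrightarrow> (\<And>w v. \<phi> w \<le> exp (1 / p * norm (w - v)) * \<phi> v) \<Longrightarrow>
        (\<integral>\<^sup>+w. ennreal (\<phi> w powr p) \<partial>lborel) < \<infinity> \<Longrightarrow>
        (\<integral>\<^sup>+z. ennreal (D z) * ennreal (\<phi> (\<psi> z) powr q) \<partial>lborel) \<le> ennreal \<Lambda> * epow (\<integral>\<^sup>+w. ennreal (\<phi> w powr p) \<partial>lborel) (q / p)) \<Longrightarrow>
     (\<integral>\<^sup>+w. epow (\<integral>\<^sup>+z. ennreal (D z) * ennreal (exp (- norm (w - \<psi> z))) \<partial>lborel) r \<partial>lborel) \<le> ennreal ((C * \<Lambda>) powr r)"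
proof -
  have p0: "0 < p" using q p by simp
  have r: "1 < r" "r * (q / p) + 1 = r" "1 - q / p = 1 / r" "0 < 1 - q / p" "0 < r" "r * q / p + 1 = r"
    using q p by (auto simp: r_def field_simps)
  let ?V = "unit_ball_vol (DIM(complex^'n))"
  define I1 where "I1 = exp_norm_integral TYPE(complex^'n) 1"
  define I2 where "I2 = exp_norm_integral TYPE(complex^'n) (1 - q / p)"
  have I: "0 \<le> I1" "0 \<le> I2" by (simp_all add: I1_def I2_def exp_norm_integral_def)
  define c1 where "c1 = exp (- 1 - r) * ?V"
  have c1: "0 < c1" by (simp add: c1_def unit_ball_vol_pos)
  define C where "C = I2 * I1 powr (q / p) / c1 powr (q / p) + 1"
  have C: "0 < C" using c1 I by (simp add: C_def add_nonneg_pos)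
  show ?thesis
  proof (rule that[OF C])
    fix D :: "complex^'n \<Rightarrow> real" and \<psi> :: "complex^'n \<Rightarrow> complex^'n" and R' \<Lambda> :: real
    assume Dm [measurable]: "D \<in> borel_measurable borel" and [measurable]: "\<psi> \<in> borel_measurable borel"
      and D0: "\<And>z. 0 \<le> D z" and Dfin: "(\<integral>\<^sup>+z. ennreal (D z) \<partial>lborel) < \<infinity>"
      and bd: "\<And>z. D z \<noteq> 0 \<Longrightarrow> norm (\<psi> z) \<le> R'" and \<Lambda>: "0 \<le> \<Lambda>"
      and test: "\<And>\<phi>. \<phi> \<in> borel_measurable borel \<Longrightarrow> (\<And>w. 0 \<le> \<phi> w) \<Longrightarrow> (\<And>w v. \<phi> w \<le> exp (1 / p * norm (w - v)) * \<phi> v) \<Longrightarrow>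
        (\<integral>\<^sup>+w. ennreal (\<phi> w powr p) \<partial>lborel) < \<infinity> \<Longrightarrow>
        (\<integral>\<^sup>+z. ennreal (D z) * ennreal (\<phi> (\<psi> z) powr q) \<partial>lborel) \<le> ennreal \<Lambda> * epow (\<integral>\<^sup>+w. ennreal (\<phi> w powr p) \<partial>lborel) (q / p)"
    define k where "k = (\<lambda>w v::complex^'n. ennreal (exp (- norm (w - v))))"
    have km [measurable]: "(\<lambda>x. k (fst x) (snd x)) \<in> borel_measurable (lborel \<Otimes>\<^sub>M lborel)"
      unfolding k_def by measurable
    have [measurable]: "(\<lambda>x. k (snd x) (fst x)) \<in> borel_measurable (lborel \<Otimes>\<^sub>M lborel)"
      unfolding k_def by measurable
    have km' [measurable]: "(\<lambda>x. k (fst x) (\<psi> (snd x))) \<in> borel_measurable (lborel \<Otimes>\<^sub>M lborel)"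
      unfolding k_def by measurable
    have km'' [measurable]: "(\<lambda>x. k (snd x) (\<psi> (fst x))) \<in> borel_measurable (lborel \<Otimes>\<^sub>M lborel)"
      unfolding k_def by measurable
    have km1 [measurable]: "k w \<in> borel_measurable borel" "(\<lambda>v. k v w) \<in> borel_measurable borel" "(\<lambda>z. k w (\<psi> z)) \<in> borel_measurable borel" for w
      unfolding k_def by measurable
    have k_slow: "k w y \<le> ennreal (exp (norm (w - v))) * k v y" for w v y
      unfolding k_def using norm_triangle_sub[of "v - y" "w - y"] norm_minus_commute[of w v]
      by (subst ennreal_mult[symmetric]) (auto intro!: ennreal_leI simp flip: exp_add)
    have k_int: "(\<integral>\<^sup>+v. k w v \<partial>lborel) = ennreal I1" for w
      using nn_integral_exp_norm[of 1 w] by (simp add: k_def I1_def)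
    have k_int': "(\<integral>\<^sup>+w. k w v \<partial>lborel) = ennreal I1" for v
      using k_int[of v] by (simp add: k_def norm_minus_commute)
    obtain d where d: "(\<integral>\<^sup>+z. ennreal (D z) \<partial>lborel) = ennreal d" "0 \<le> d"
      using Dfin by (cases "\<integral>\<^sup>+z. ennreal (D z) \<partial>lborel") auto
    define E' where "E' = (\<lambda>w. \<integral>\<^sup>+z. ennreal (D z) * k w (\<psi> z) \<partial>lborel)"
    have E'm [measurable]: "E' \<in> borel_measurable borel"
    proof -
      have "(\<lambda>w. \<integral>\<^sup>+z. ennreal (D z) * k w (\<psi> z) \<partial>lborel) \<in> borel_measurable lborel"
        by (rule lborel.borel_measurable_nn_integral) (simp add: split_beta')
      then show ?thesis unfolding E'_def by simp
    qed
    have E'_le: "E' w \<le> ennreal (d * exp R') * ennreal (exp (- norm w))" for w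
    proof -
      have "E' w \<le> (\<integral>\<^sup>+z. ennreal (D z) * (ennreal (exp R' * exp (- norm w))) \<partial>lborel)"
        unfolding E'_def
      proof (rule nn_integral_mono)
        fix z
        show "ennreal (D z) * k w (\<psi> z) \<le> ennreal (D z) * (ennreal (exp R' * exp (- norm w)))"
        proof (cases "D z = 0")
          case False
          have "- norm (w - \<psi> z) \<le> R' + - norm w" using bd[OF False] norm_triangle_sub[of w "\<psi> z"] by linarith
          then have "k w (\<psi> z) \<le> ennreal (exp R' * exp (- norm w))"
            unfolding k_def exp_add[symmetric] by (intro ennreal_leI) simp
          then show ?thesis by (intro mult_left_mono) auto
        qed simp
      qed
      also have "\<dots> = ennreal d * ennreal (exp R' * exp (- norm w))" by (simp add: nn_integral_multc d)
      finally show ?thesis using d by (simp add: ennreal_mult mult.assoc)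
    qed
    define E where "E = (\<lambda>w. enn2real (E' w))"
    have E: "E' w = ennreal (E w)" and E0: "0 \<le> E w" for w
    proof -
      have "E' w < \<infinity>" by (rule le_less_trans[OF E'_le]) (simp add: ennreal_mult_less_top)
      then show "E' w = ennreal (E w)" by (simp add: E_def)
    qed (simp add: E_def)
    have Em [measurable]: "E \<in> borel_measurable borel" unfolding E_def by measurable
    have E_slow: "E w \<le> exp (norm (w - v)) * E v" for w v
    proof -
      have "E' w \<le> (\<integral>\<^sup>+z. ennreal (exp (norm (w - v))) * (ennreal (D z) * k v (\<psi> z)) \<partial>lborel)"
        unfolding E'_def
      proof (rule nn_integral_mono)
        fix z
        show "ennreal (D z) * k w (\<psi> z) \<le> ennreal (exp (norm (w - v))) * (ennreal (D z) * k v (\<psi> z))"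
          using mult_left_mono[OF k_slow[of w "\<psi> z" v], of "ennreal (D z)"] by (simp add: mult_ac)
      qed
      also have "\<dots> = ennreal (exp (norm (w - v))) * E' v"
        unfolding E'_def by (rule nn_integral_cmult) measurable
      finally show ?thesis unfolding E using E0 by (simp add: ennreal_mult[symmetric])
    qed
    have "(\<integral>\<^sup>+w. ennreal (E w powr r) \<partial>lborel) < \<infinity>"
    proof -
      have "ennreal (E w powr r) \<le> ennreal ((d * exp R') powr r) * ennreal (exp (- r * norm w))" for w
      proof -
        have "E w \<le> d * exp R' * exp (- norm w)" using E'_le[of w] unfolding E using d by (simp add: ennreal_mult[symmetric])
        then have "E w powr r \<le> (d * exp R' * exp (- norm w)) powr r" using r E0 by (intro powr_mono2) auto
        also have "\<dots> = (d * exp R') powr r * exp (- r * norm w)" by (simp add: powr_mult exp_powr_real mult_ac)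
        finally show ?thesis by (simp add: ennreal_mult[symmetric] ennreal_leI)
      qed
      then have "(\<integral>\<^sup>+w. ennreal (E w powr r) \<partial>lborel) \<le> (\<integral>\<^sup>+w. ennreal ((d * exp R') powr r) * ennreal (exp (- r * norm (w::complex^'n))) \<partial>lborel)"
        by (intro nn_integral_mono)
      also have "\<dots> = ennreal ((d * exp R') powr r) * (\<integral>\<^sup>+w. ennreal (exp (- r * norm (w::complex^'n))) \<partial>lborel)"
        by (rule nn_integral_cmult) measurable
      also have "\<dots> < \<infinity>" using nn_integral_exp_norm_finite[OF r(5), where 'a = "complex^'n"] by (simp add: ennreal_mult_less_top)
      finally show ?thesis .
    qed
    then obtain x where x: "(\<integral>\<^sup>+w. ennreal (E w powr r) \<partial>lborel) = ennreal x" "0 \<le> x"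
      by (cases "\<integral>\<^sup>+w. ennreal (E w powr r) \<partial>lborel") auto
    define H' where "H' = (\<lambda>w. \<integral>\<^sup>+v. k w v * ennreal (E v powr r) \<partial>lborel)"
    have H'm [measurable]: "H' \<in> borel_measurable borel"
    proof -
      have "(\<lambda>w. \<integral>\<^sup>+v. k w v * ennreal (E v powr r) \<partial>lborel) \<in> borel_measurable lborel"
        by (rule lborel.borel_measurable_nn_integral) (simp add: split_beta')
      then show ?thesis unfolding H'_def by simp
    qed
    define H where "H = (\<lambda>w. enn2real (H' w))"
    have H: "H' w = ennreal (H w)" and H0: "0 \<le> H w" for w
    proof -
      have "H' w \<le> (\<integral>\<^sup>+v. 1 * ennreal (E v powr r) \<partial>lborel)"
        unfolding H'_def k_def by (intro nn_integral_mono mult_right_mono) auto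
      also have "\<dots> < \<infinity>" using x by simp
      finally show "H' w = ennreal (H w)" by (simp add: H_def)
    qed (simp add: H_def)
    have Hm [measurable]: "H \<in> borel_measurable borel" unfolding H_def by measurable
    have H_slow: "H w \<le> exp (norm (w - v)) * H v" for w v
    proof -
      have "H' w \<le> (\<integral>\<^sup>+y. ennreal (exp (norm (w - v))) * (k v y * ennreal (E y powr r)) \<partial>lborel)"
        unfolding H'_def
      proof (rule nn_integral_mono)
        fix y
        show "k w y * ennreal (E y powr r) \<le> ennreal (exp (norm (w - v))) * (k v y * ennreal (E y powr r))"
          using mult_right_mono[OF k_slow[of w y v], of "ennreal (E y powr r)"] by (simp add: mult_ac)
      qed
      also have "\<dots> = ennreal (exp (norm (w - v))) * H' v"
        unfolding H'_def by (rule nn_integral_cmult) measurable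
      finally show ?thesis unfolding H using H0 by (simp add: ennreal_mult[symmetric])
    qed
    have H_ge: "c1 * E w powr r \<le> H w" for w
    proof -
      have "ennreal (c1 * E w powr r) = (\<integral>\<^sup>+v. ennreal (exp (- 1 - r) * E w powr r) * indicator (ball w 1) v \<partial>lborel)"
        by (subst nn_integral_cmult_indicator) (simp_all add: emeasure_ball c1_def unit_ball_vol_nonneg mult_ac flip: ennreal_mult)
      also have "\<dots> \<le> H' w"
        unfolding H'_def
      proof (rule nn_integral_mono)
        fix v
        show "ennreal (exp (- 1 - r) * E w powr r) * indicator (ball w 1) v \<le> k w v * ennreal (E v powr r)"
        proof (cases "v \<in> ball w 1")
          case True
          then have n: "norm (w - v) \<le> 1" by (simp add: dist_norm)
          have "E w \<le> exp 1 * E v"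
            by (rule order_trans[OF E_slow[of w v]]) (use n E0 in \<open>intro mult_right_mono; simp\<close>)
          then have "exp (- 1) * E w \<le> E v" by (simp add: exp_minus field_simps)
          then have "(exp (- 1) * E w) powr r \<le> E v powr r" using r E0 by (intro powr_mono2) auto
          then have 1: "exp (- r) * E w powr r \<le> E v powr r" by (simp add: powr_mult exp_powr_real)
          have 2: "exp (- 1) \<le> exp (- norm (w - v))" using n by simp
          have "exp (- 1 - r) * E w powr r = exp (- 1) * (exp (- r) * E w powr r)"
            unfolding mult.assoc[symmetric] exp_add[symmetric] by simp
          also have "\<dots> \<le> exp (- norm (w - v)) * E v powr r" using 1 2 by (intro mult_mono) auto
          finally show ?thesis using True unfolding k_def by (simp add: ennreal_mult[symmetric] ennreal_leI)
        qed simp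
      qed
      finally show ?thesis unfolding H using H0 by simp
    qed
    have H_int: "(\<integral>\<^sup>+w. ennreal (H w) \<partial>lborel) = ennreal (I1 * x)"
    proof -
      have "(\<integral>\<^sup>+w. H' w \<partial>lborel) = (\<integral>\<^sup>+v. \<integral>\<^sup>+w. k w v * ennreal (E v powr r) \<partial>lborel \<partial>lborel)"
        unfolding H'_def by (rule lborel_pair.Fubini') (simp add: split_beta')
      also have "\<dots> = (\<integral>\<^sup>+v. ennreal I1 * ennreal (E v powr r) \<partial>lborel)"
        by (rule nn_integral_cong) (simp add: nn_integral_multc k_int')
      also have "\<dots> = ennreal (I1 * x)" using I x by (simp add: nn_integral_cmult ennreal_mult)
      finally show ?thesis by (simp add: H)
    qed
    define \<phi> where "\<phi> = (\<lambda>w. H w powr (1 / p))"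
    have \<phi>p: "\<phi> w powr p = H w" and \<phi>q: "\<phi> w powr q = H w powr (q / p)" for w
      using p0 H0 by (simp_all add: \<phi>_def powr_powr)
    have \<phi>slow: "\<phi> w \<le> exp (1 / p * norm (w - v)) * \<phi> v" for w v
    proof -
      have "\<phi> w \<le> (exp (norm (w - v)) * H v) powr (1 / p)"
        unfolding \<phi>_def using p0 H0 H_slow[of w v] by (intro powr_mono2) auto
      then show ?thesis by (simp add: \<phi>_def powr_mult exp_powr_real)
    qed
    let ?T = "\<integral>\<^sup>+z. ennreal (D z) * ennreal (\<phi> (\<psi> z) powr q) \<partial>lborel"
    have \<phi>m [measurable]: "\<phi> \<in> borel_measurable borel" unfolding \<phi>_def by measurable
    have "?T \<le> ennreal \<Lambda> * epow (\<integral>\<^sup>+w. ennreal (\<phi> w powr p) \<partial>lborel) (q / p)"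
      by (rule test[OF \<phi>m _ \<phi>slow]) (simp_all add: \<phi>p H_int, simp add: \<phi>_def)
    also have "\<dots> = ennreal (\<Lambda> * (I1 * x) powr (q / p))"
      unfolding \<phi>p H_int using I x \<Lambda> by (simp add: epow_ennreal flip: ennreal_mult)
    finally have T_le: "?T \<le> ennreal (\<Lambda> * (I1 * x) powr (q / p))" .
    have inner: "(\<integral>\<^sup>+w. ennreal (\<phi> w powr q) * k w y \<partial>lborel) \<le> ennreal I2 * ennreal (\<phi> y powr q)" for y
    proof -
      have "(\<integral>\<^sup>+w. ennreal (\<phi> w powr q) * k w y \<partial>lborel) \<le> (\<integral>\<^sup>+w. ennreal (exp (- (1 - q / p) * norm (y - w))) * ennreal (\<phi> y powr q) \<partial>lborel)"
      proof (rule nn_integral_mono)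
        fix w
        have "\<phi> w powr q \<le> (exp (1 / p * norm (w - y)) * \<phi> y) powr q"
          using q \<phi>slow[of w y] by (intro powr_mono2) (auto simp: \<phi>_def)
        also have "\<dots> = exp (q / p * norm (w - y)) * \<phi> y powr q" by (simp add: powr_mult exp_powr_real mult_ac)
        finally have "\<phi> w powr q * exp (- norm (w - y)) \<le> exp (q / p * norm (w - y)) * \<phi> y powr q * exp (- norm (w - y))"
          by (intro mult_right_mono) auto
        also have "\<dots> = (exp (q / p * norm (w - y)) * exp (- norm (w - y))) * \<phi> y powr q" by (simp only: mult_ac)
        also have "exp (q / p * norm (w - y)) * exp (- norm (w - y)) = exp (- (1 - q / p) * norm (y - w))"
          unfolding exp_add[symmetric] by (simp add: norm_minus_commute algebra_simps)
        finally show "ennreal (\<phi> w powr q) * k w y \<le> ennreal (exp (- (1 - q / p) * norm (y - w))) * ennreal (\<phi> y powr q)"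
          unfolding k_def by (simp add: ennreal_mult[symmetric] ennreal_leI)
      qed
      also have "\<dots> = (\<integral>\<^sup>+w. ennreal (exp (- (1 - q / p) * norm (y - w))) \<partial>lborel) * ennreal (\<phi> y powr q)"
        by (rule nn_integral_multc) measurable
      also have "(\<integral>\<^sup>+w. ennreal (exp (- (1 - q / p) * norm (y - w))) \<partial>lborel) = ennreal I2"
        unfolding I2_def by (rule nn_integral_exp_norm[OF r(4)])
      finally show ?thesis .
    qed
    have "ennreal (c1 powr (q / p) * x) = (\<integral>\<^sup>+w. ennreal (c1 powr (q / p)) * ennreal (E w powr r) \<partial>lborel)"
      using x by (simp add: nn_integral_cmult ennreal_mult)
    also have "\<dots> \<le> (\<integral>\<^sup>+w. ennreal (\<phi> w powr q) * E' w \<partial>lborel)"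
    proof (rule nn_integral_mono)
      fix w
      have "(c1 * E w powr r) powr (q / p) \<le> \<phi> w powr q"
        unfolding \<phi>q using H_ge[of w] c1 q p0 by (intro powr_mono2) auto
      then have "(c1 * E w powr r) powr (q / p) * E w \<le> \<phi> w powr q * E w" using E0 by (intro mult_right_mono) auto
      moreover have "(c1 * E w powr r) powr (q / p) * E w = c1 powr (q / p) * E w powr r"
      proof -
        have "E w powr r = E w powr (r * (q / p) + 1)" by (simp only: r(2))
        also have "\<dots> = E w powr (r * (q / p)) * E w" using E0[of w] by (simp add: powr_add)
        finally have B: "E w powr r = E w powr (r * (q / p)) * E w" .
        have "(c1 * E w powr r) powr (q / p) = c1 powr (q / p) * E w powr (r * (q / p))"
          by (simp add: powr_mult powr_powr)
        then show ?thesis by (simp only: B mult.assoc)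
      qed
      ultimately show "ennreal (c1 powr (q / p)) * ennreal (E w powr r) \<le> ennreal (\<phi> w powr q) * E' w"
        unfolding E using E0 by (simp add: ennreal_mult[symmetric] ennreal_leI)
    qed
    also have "\<dots> = (\<integral>\<^sup>+w. \<integral>\<^sup>+z. ennreal (D z) * (ennreal (\<phi> w powr q) * k w (\<psi> z)) \<partial>lborel \<partial>lborel)"
      unfolding E'_def by (rule nn_integral_cong) (simp add: nn_integral_cmult[symmetric] mult_ac)
    also have "\<dots> = (\<integral>\<^sup>+z. \<integral>\<^sup>+w. ennreal (D z) * (ennreal (\<phi> w powr q) * k w (\<psi> z)) \<partial>lborel \<partial>lborel)"
      by (rule lborel_pair.Fubini') (simp add: split_beta')
    also have "\<dots> = (\<integral>\<^sup>+z. ennreal (D z) * (\<integral>\<^sup>+w. ennreal (\<phi> w powr q) * k w (\<psi> z) \<partial>lborel) \<partial>lborel)"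
      by (rule nn_integral_cong, rule nn_integral_cmult) measurable
    also have "\<dots> \<le> (\<integral>\<^sup>+z. ennreal I2 * (ennreal (D z) * ennreal (\<phi> (\<psi> z) powr q)) \<partial>lborel)"
    proof (rule nn_integral_mono)
      fix z
      show "ennreal (D z) * (\<integral>\<^sup>+w. ennreal (\<phi> w powr q) * k w (\<psi> z) \<partial>lborel) \<le> ennreal I2 * (ennreal (D z) * ennreal (\<phi> (\<psi> z) powr q))"
        using mult_left_mono[OF inner[of "\<psi> z"], of "ennreal (D z)"] by (simp add: mult_ac)
    qed
    also have "\<dots> = ennreal I2 * ?T" by (rule nn_integral_cmult) measurable
    also have "\<dots> \<le> ennreal I2 * ennreal (\<Lambda> * (I1 * x) powr (q / p))" by (intro mult_left_mono T_le) simp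
    also have "\<dots> = ennreal (I2 * (\<Lambda> * (I1 * x) powr (q / p)))" using I \<Lambda> by (simp add: ennreal_mult)
    finally have "c1 powr (q / p) * x \<le> I2 * (\<Lambda> * (I1 * x) powr (q / p))"
      using I \<Lambda> by (simp add: ennreal_le_iff)
    then have "x \<le> I2 * I1 powr (q / p) / c1 powr (q / p) * (\<Lambda> * x powr (q / p))"
      using c1 by (simp add: powr_mult field_simps)
    also have "\<dots> \<le> C * (\<Lambda> * x powr (q / p))" using \<Lambda> by (intro mult_right_mono) (auto simp: C_def)
    finally have x_le: "x \<le> C * \<Lambda> * x powr (q / p)" by (simp add: mult.assoc)
    have "x \<le> (C * \<Lambda>) powr r"
    proof (cases "x = 0")
      case False
      then have x0: "0 < x" using x by simp
      have "x powr (1 / r) * x powr (q / p) = x powr (1 / r + q / p)" by (simp only: powr_add)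
      also have "1 / r + q / p = 1" using r(3) by argo
      also have "x powr 1 = x" using x0 by simp
      finally have "x powr (1 / r) * x powr (q / p) \<le> C * \<Lambda> * x powr (q / p)" using x_le by (simp only:)
      moreover have "0 < x powr (q / p)" using False by simp
      ultimately have "x powr (1 / r) \<le> C * \<Lambda>" by (rule mult_right_le_imp_le)
      then have "(x powr (1 / r)) powr r \<le> (C * \<Lambda>) powr r" by (intro powr_mono2 powr_ge_zero less_imp_le[OF r(5)])
      moreover have "(x powr (1 / r)) powr r = x powr (1 / r * r)" by (rule powr_powr)
      moreover have "1 / r * r = 1" using r(5) by (metis less_irrefl nonzero_eq_divide_eq)
      ultimately show ?thesis using x0 by (simp only: powr_one)
    qed simp
    moreover have "(\<integral>\<^sup>+w. epow (E' w) r \<partial>lborel) = ennreal x"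
      unfolding x(1)[symmetric] E using E0 by (simp add: epow_ennreal)
    ultimately show "(\<integral>\<^sup>+w. epow (\<integral>\<^sup>+z. ennreal (D z) * ennreal (exp (- norm (w - \<psi> z))) \<partial>lborel) r \<partial>lborel) \<le> ennreal ((C * \<Lambda>) powr r)"
      unfolding E'_def k_def by (simp add: ennreal_leI)
  qed
qed

lemma gaussian_le_exponential:
  assumes "0 < (a::real)"
  shows "exp (- a * d\<^sup>2) \<le> exp (1 / (4 * a)) * exp (- d)"
proof -
  have "0 \<le> (2 * a * d - 1)\<^sup>2 / (4 * a)" using assms by simp
  also have "(2 * a * d - 1)\<^sup>2 / (4 * a) = a * d\<^sup>2 - d + 1 / (4 * a)"
    using assms by (simp add: power2_eq_square field_simps)
  finally show ?thesis unfolding exp_add[symmetric] by simp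
qed

text \<open>The density is truncated to balls, for which the previous lemma applies with constants independent
  of the radius, and monotone convergence gives the result. The test inequality for \<open>\<phi>\<close> follows by
  summing the assumed bound over the finitely many test functions.\<close>

lemma berezin_Lr_le:
  assumes q: "0 < (q::real)" and p: "q < p" and \<alpha>: "0 < \<alpha>"
  obtains C where "0 < C" "\<And>(u :: complex^'n \<Rightarrow> complex) \<psi> \<Lambda>. entire u \<Longrightarrow> entire_map \<psi> \<Longrightarrow> 0 \<le> \<Lambda> \<Longrightarrow>
     (\<And>f. entire f \<Longrightarrow> fock_mass m \<alpha> p f < \<infinity> \<Longrightarrow> fs_mass m \<alpha> q (wcomp u \<psi> f) \<le> ennreal \<Lambda> * epow (fock_mass m \<alpha> p f) (q / p)) \<Longrightarrow>
     Lr_norm (p / (p - q)) (fs_berezin m \<alpha> q \<psi> (\<lambda>z. norm (u z) powr q)) \<le> ennreal (C * \<Lambda>)"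
proof -
  have p0: "0 < p" using q p by simp
  define r where "r = p / (p - q)"
  have r0: "0 < r" using q p by (simp add: r_def)
  obtain A c and T :: nat where A: "0 < A" and c: "0 < c" and test: "\<And>\<phi> R. (\<And>w. 0 \<le> \<phi> w) \<Longrightarrow> (\<And>w v. \<phi> w \<le> exp (1 / p * norm (w - v)) * \<phi> v) \<Longrightarrow>
      \<exists>F :: nat \<Rightarrow> complex^'n \<Rightarrow> complex. (\<forall>t<T. entire (F t) \<and> (\<forall>z. fock_mod m \<alpha> (F t) z \<le> A * \<phi> z)) \<and>
        (\<forall>z\<in>cball 0 R. \<exists>t<T. c * \<phi> z \<le> fock_mod m \<alpha> (F t) z)"
    using test_functions[OF \<alpha>, of "1 / p" m] p0 by (metis (no_types, lifting) divide_nonneg_pos zero_le_one)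
  obtain C where C: "0 < C" and mean: "\<And>D (\<psi> :: complex^'n \<Rightarrow> complex^'n) R' \<Lambda>. D \<in> borel_measurable borel \<Longrightarrow> \<psi> \<in> borel_measurable borel \<Longrightarrow>
     (\<And>z. 0 \<le> D z) \<Longrightarrow> (\<integral>\<^sup>+z. ennreal (D z) \<partial>lborel) < \<infinity> \<Longrightarrow> (\<And>z. D z \<noteq> 0 \<Longrightarrow> norm (\<psi> z) \<le> R') \<Longrightarrow> 0 \<le> \<Lambda> \<Longrightarrow>
     (\<And>\<phi>. \<phi> \<in> borel_measurable borel \<Longrightarrow> (\<And>w. 0 \<le> \<phi> w) \<Longrightarrow> (\<And>w v. \<phi> w \<le> exp (1 / p * norm (w - v)) * \<phi> v) \<Longrightarrow>
        (\<integral>\<^sup>+w. ennreal (\<phi> w powr p) \<partial>lborel) < \<infinity> \<Longrightarrow>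
        (\<integral>\<^sup>+z. ennreal (D z) * ennreal (\<phi> (\<psi> z) powr q) \<partial>lborel) \<le> ennreal \<Lambda> * epow (\<integral>\<^sup>+w. ennreal (\<phi> w powr p) \<partial>lborel) (q / p)) \<Longrightarrow>
     (\<integral>\<^sup>+w. epow (\<integral>\<^sup>+z. ennreal (D z) * ennreal (exp (- norm (w - \<psi> z))) \<partial>lborel) r \<partial>lborel) \<le> ennreal ((C * \<Lambda>) powr r)"
    using exponential_mean_Lr_le[OF q p, where 'n = 'n, folded r_def] by blast
  \<comment> \<open>One factor \<open>(A / c)\<^sup>q\<close> for each of the \<open>T\<close> test functions.\<close>
  define K where "K = real T * A powr q / c powr q"
  have K: "0 \<le> K" by (simp add: K_def)
  define g where "g = exp (1 / (4 * (\<alpha> * q / 2)))"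
  have g: "0 < g" by (simp add: g_def)
  show ?thesis
  proof (rule that[of "g * C * (K + 1)"])
    show "0 < g * C * (K + 1)" using g C K by simp
    fix u :: "complex^'n \<Rightarrow> complex" and \<psi> :: "complex^'n \<Rightarrow> complex^'n" and \<Lambda> :: real
    assume u: "entire u" and \<psi>: "entire_map \<psi>" and \<Lambda>: "0 \<le> \<Lambda>"
      and bd: "\<And>f. entire f \<Longrightarrow> fock_mass m \<alpha> p f < \<infinity> \<Longrightarrow> fs_mass m \<alpha> q (wcomp u \<psi> f) \<le> ennreal \<Lambda> * epow (fock_mass m \<alpha> p f) (q / p)"
    note [measurable] = entire_measurable[OF u] entire_map_measurable[OF \<psi>]
    have [measurable]: "cball (0::complex^'n) R \<in> sets borel" for R by simp
    define d where "d = wdens m \<alpha> q u \<psi>"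
    have d0: "0 \<le> d z" for z by (simp add: d_def)
    have dm [measurable]: "d \<in> borel_measurable borel" unfolding d_def by measurable
    let ?B = "fs_berezin m \<alpha> q \<psi> (\<lambda>z. norm (u z) powr q)"
    define e where "e = (\<lambda>w z. ennreal (exp (- (\<alpha> * q / 2) * (norm (\<psi> z - w))\<^sup>2)))"
    have em [measurable]: "e w \<in> borel_measurable borel" for w
      unfolding e_def by (rule measurable_compose[OF measurable_compose[OF _ gauss_measurable] measurable_ennreal]) measurable
    have em2 [measurable]: "(\<lambda>x. e (fst x) (snd x)) \<in> borel_measurable (lborel \<Otimes>\<^sub>M (lborel :: (complex^'n) measure))"
      unfolding e_def by (rule measurable_compose[OF measurable_compose[OF _ gauss_measurable] measurable_ennreal]) measurable
    define BR where "BR = (\<lambda>R::nat. \<lambda>w. \<integral>\<^sup>+z. ennreal (d z * indicator (cball 0 (real R)) z) * e w z \<partial>lborel)"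
    have BRm [measurable]: "BR R \<in> borel_measurable borel" for R
    proof -
      have "(\<lambda>w. \<integral>\<^sup>+z. ennreal (d z * indicator (cball 0 (real R)) z) * e w z \<partial>lborel) \<in> borel_measurable lborel"
        by (rule lborel.borel_measurable_nn_integral) (simp add: split_beta')
      then show ?thesis unfolding BR_def by simp
    qed
    have BR_mono: "incseq BR"
      unfolding BR_def incseq_def le_fun_def using d0
      by (auto intro!: nn_integral_mono mult_right_mono ennreal_leI mult_left_mono simp: indicator_def)
    have B_SUP: "?B w = (SUP R. BR R w)" for w
    proof -
      have "?B w = (\<integral>\<^sup>+z. ennreal (d z) * e w z \<partial>lborel)"
        by (simp add: fs_berezin_eq[OF q] d_def e_def)
      also have "\<dots> = (\<integral>\<^sup>+z. (SUP R::nat. ennreal (d z * indicator (cball 0 (real R)) z) * e w z) \<partial>lborel)"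
      proof (rule nn_integral_cong)
        fix z :: "complex^'n"
        obtain R :: nat where R: "norm z \<le> real R" using real_arch_simple by blast
        show "ennreal (d z) * e w z = (SUP R::nat. ennreal (d z * indicator (cball 0 (real R)) z) * e w z)"
        proof (rule antisym)
          show "ennreal (d z) * e w z \<le> (SUP R::nat. ennreal (d z * indicator (cball 0 (real R)) z) * e w z)"
            by (rule SUP_upper2[of R]) (use R in simp_all)
        qed (use d0 in \<open>auto intro!: SUP_least mult_right_mono ennreal_leI simp: indicator_def\<close>)
      qed
      also have "\<dots> = (SUP R. BR R w)"
        unfolding BR_def using d0
        by (intro nn_integral_monotone_convergence_SUP)
           (auto simp: incseq_def le_fun_def indicator_def intro!: mult_right_mono ennreal_leI)
      finally show ?thesis .
    qed
    have BR_le: "(\<integral>\<^sup>+w. epow (BR R w) r \<partial>lborel) \<le> ennreal ((g * (C * (K * \<Lambda>))) powr r)" for R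
    proof -
      define D where "D = (\<lambda>z. d z * indicator (cball 0 (real R)) z)"
      have D0: "0 \<le> D z" for z using d0 by (simp add: D_def)
      have Dm [measurable]: "D \<in> borel_measurable borel" unfolding D_def by measurable
      have "compact (\<psi> ` cball 0 (real R))"
        by (rule compact_continuous_image[OF entire_map_continuous[OF \<psi>]]) simp
      then obtain R' where R': "\<And>z. z \<in> cball 0 (real R) \<Longrightarrow> norm (\<psi> z) \<le> R'"
        using compact_imp_bounded bounded_iff by (metis imageI)
      have "(\<integral>\<^sup>+z. ennreal (D z) \<partial>lborel) = (\<integral>\<^sup>+z. ennreal (d z) * indicator (cball 0 (real R)) z \<partial>lborel)"
        unfolding D_def by (intro nn_integral_cong) (auto simp: indicator_def)
      also have "\<dots> < \<infinity>" unfolding d_def by (rule nn_integral_cball_finite[OF wdens_continuous[OF u \<psi> q]])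
      finally have Dfin: "(\<integral>\<^sup>+z. ennreal (D z) \<partial>lborel) < \<infinity>" .
      have main: "(\<integral>\<^sup>+z. ennreal (D z) * ennreal (\<phi> (\<psi> z) powr q) \<partial>lborel) \<le> ennreal (K * \<Lambda>) * epow (\<integral>\<^sup>+w. ennreal (\<phi> w powr p) \<partial>lborel) (q / p)"
        if \<phi>m [measurable]: "\<phi> \<in> borel_measurable borel" and \<phi>0: "\<And>w. 0 \<le> \<phi> w" and slow: "\<And>w v. \<phi> w \<le> exp (1 / p * norm (w - v)) * \<phi> v"
          and fin: "(\<integral>\<^sup>+w. ennreal (\<phi> w powr p) \<partial>lborel) < \<infinity>" for \<phi>
      proof -
        let ?I = "\<integral>\<^sup>+w. ennreal (\<phi> w powr p) \<partial>lborel"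
        from test[OF \<phi>0 slow, of R'] obtain F :: "nat \<Rightarrow> complex^'n \<Rightarrow> complex" where
          "(\<forall>t<T. entire (F t) \<and> (\<forall>z. fock_mod m \<alpha> (F t) z \<le> A * \<phi> z)) \<and>
            (\<forall>z\<in>cball 0 R'. \<exists>t<T. c * \<phi> z \<le> fock_mod m \<alpha> (F t) z)" by (rule exE)
        then have F: "\<And>t. t < T \<Longrightarrow> entire (F t)" "\<And>t z. t < T \<Longrightarrow> fock_mod m \<alpha> (F t) z \<le> A * \<phi> z"
          "\<And>z. z \<in> cball 0 R' \<Longrightarrow> \<exists>t<T. c * \<phi> z \<le> fock_mod m \<alpha> (F t) z" by auto
        have mass: "fock_mass m \<alpha> p (F t) \<le> ennreal (A powr p) * ?I" if t: "t < T" for t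
        proof -
          have "fock_mass m \<alpha> p (F t) \<le> (\<integral>\<^sup>+w. ennreal (A powr p) * ennreal (\<phi> w powr p) \<partial>lborel)"
            unfolding fock_mass_def
          proof (rule nn_integral_mono)
            fix w
            have "fock_mod m \<alpha> (F t) w powr p \<le> (A * \<phi> w) powr p"
              using F(2)[OF t, of w] p0 by (intro powr_mono2) auto
            then show "ennreal (fock_mod m \<alpha> (F t) w powr p) \<le> ennreal (A powr p) * ennreal (\<phi> w powr p)"
              by (simp add: powr_mult ennreal_mult[symmetric] ennreal_leI)
          qed
          also have "\<dots> = ennreal (A powr p) * ?I" by (rule nn_integral_cmult) measurable
          finally show ?thesis .
        qed
        have op: "fs_mass m \<alpha> q (wcomp u \<psi> (F t)) \<le> ennreal (\<Lambda> * A powr q) * epow ?I (q / p)" if t: "t < T" for t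
        proof -
          have "fock_mass m \<alpha> p (F t) < \<infinity>"
            by (rule le_less_trans[OF mass[OF t]]) (use fin in \<open>simp add: ennreal_mult_less_top\<close>)
          then have "fs_mass m \<alpha> q (wcomp u \<psi> (F t)) \<le> ennreal \<Lambda> * epow (fock_mass m \<alpha> p (F t)) (q / p)"
            by (rule bd[OF F(1)[OF t]])
          also have "\<dots> \<le> ennreal \<Lambda> * epow (ennreal (A powr p) * ?I) (q / p)"
            using q p0 by (intro mult_left_mono epow_mono mass t) auto
          also have "epow (ennreal (A powr p) * ?I) (q / p) = ennreal (A powr q) * epow ?I (q / p)"
            using q p0 by (simp add: epow_mult epow_ennreal powr_powr)
          finally show ?thesis using \<Lambda> by (simp add: ennreal_mult mult.assoc)
        qed
        have "(\<integral>\<^sup>+z. ennreal (D z) * ennreal (\<phi> (\<psi> z) powr q) \<partial>lborel) \<le>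
          (\<integral>\<^sup>+z. (\<Sum>t<T. ennreal (1 / c powr q) * (ennreal (d z) * ennreal (fock_mod m \<alpha> (F t) (\<psi> z) powr q))) \<partial>lborel)"
        proof (rule nn_integral_mono)
          fix z
          show "ennreal (D z) * ennreal (\<phi> (\<psi> z) powr q) \<le>
            (\<Sum>t<T. ennreal (1 / c powr q) * (ennreal (d z) * ennreal (fock_mod m \<alpha> (F t) (\<psi> z) powr q)))"
          proof (cases "z \<in> cball 0 (real R)")
            case True
            then have "\<psi> z \<in> cball 0 R'" using R' by simp
            then obtain t where t: "t < T" "c * \<phi> (\<psi> z) \<le> fock_mod m \<alpha> (F t) (\<psi> z)" using F(3) by blast
            have "(c * \<phi> (\<psi> z)) powr q \<le> fock_mod m \<alpha> (F t) (\<psi> z) powr q" using t(2) c \<phi>0 q by (intro powr_mono2) auto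
            then have "\<phi> (\<psi> z) powr q \<le> 1 / c powr q * fock_mod m \<alpha> (F t) (\<psi> z) powr q"
              using c by (simp add: powr_mult field_simps)
            from mult_left_mono[OF this d0[of z]]
            have "ennreal (D z) * ennreal (\<phi> (\<psi> z) powr q) \<le> ennreal (1 / c powr q) * (ennreal (d z) * ennreal (fock_mod m \<alpha> (F t) (\<psi> z) powr q))"
              using True d0 by (simp add: D_def ennreal_mult[symmetric] ennreal_leI mult_ac)
            also have "\<dots> \<le> (\<Sum>t<T. ennreal (1 / c powr q) * (ennreal (d z) * ennreal (fock_mod m \<alpha> (F t) (\<psi> z) powr q)))"
              using t(1) by (intro member_le_sum) auto
            finally show ?thesis .
          qed (simp add: D_def)
        qed
        also have "\<dots> = (\<Sum>t<T. ennreal (1 / c powr q) * fs_mass m \<alpha> q (wcomp u \<psi> (F t)))"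
        proof -
          have meas: "(\<lambda>z. ennreal (d z) * ennreal (fock_mod m \<alpha> (F t) (\<psi> z) powr q)) \<in> borel_measurable lborel" if "t < T" for t
          proof -
            note [measurable] = entire_measurable[OF F(1)[OF that]]
            have [measurable]: "fock_mod m \<alpha> (F t) \<in> borel_measurable borel" by measurable
            show ?thesis by measurable
          qed
          have "(\<integral>\<^sup>+z. (\<Sum>t<T. a * G t z) \<partial>lborel) = (\<Sum>t<T. a * (\<integral>\<^sup>+z. G t z \<partial>lborel))"
            if "\<And>t. t < T \<Longrightarrow> G t \<in> borel_measurable lborel" for a and G :: "nat \<Rightarrow> complex^'n \<Rightarrow> ennreal"
            using that by (subst nn_integral_sum)
              (auto simp: nn_integral_cmult intro!: sum.cong borel_measurable_times_ennreal)
          from this[OF meas] show ?thesis unfolding fs_mass_wcomp[OF q] d_def[symmetric] .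
        qed
        also have "\<dots> \<le> (\<Sum>t<T. ennreal (1 / c powr q) * (ennreal (\<Lambda> * A powr q) * epow ?I (q / p)))"
          by (intro sum_mono mult_left_mono op) auto
        also have "\<dots> = ennreal (K * \<Lambda>) * epow ?I (q / p)"
        proof -
          have "ennreal (K * \<Lambda>) = ennreal (real T * (1 / c powr q * (\<Lambda> * A powr q)))" by (simp add: K_def mult_ac)
          also have "\<dots> = of_nat T * (ennreal (1 / c powr q) * ennreal (\<Lambda> * A powr q))"
          proof -
            have "ennreal (real T * (a * b)) = of_nat T * (ennreal a * ennreal b)" if "0 \<le> a" "0 \<le> b" for a b
              using that by (simp add: ennreal_mult ennreal_of_nat_eq_real_of_nat)
            from this[of "1 / c powr q" "\<Lambda> * A powr q"] \<Lambda> show ?thesis by (simp only: divide_nonneg_nonneg mult_nonneg_nonneg powr_ge_zero zero_le_one)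
          qed
          finally show ?thesis by (simp add: mult.assoc)
        qed
        finally show ?thesis .
      qed
      have "(\<integral>\<^sup>+w. epow (BR R w) r \<partial>lborel) \<le> (\<integral>\<^sup>+w. ennreal (g powr r) * epow (\<integral>\<^sup>+z. ennreal (D z) * ennreal (exp (- norm (w - \<psi> z))) \<partial>lborel) r \<partial>lborel)"
      proof (rule nn_integral_mono)
        fix w
        have "BR R w = (\<integral>\<^sup>+z. ennreal (D z) * e w z \<partial>lborel)" by (simp add: BR_def D_def)
        also have "\<dots> \<le> (\<integral>\<^sup>+z. ennreal g * (ennreal (D z) * ennreal (exp (- norm (w - \<psi> z)))) \<partial>lborel)"
        proof (rule nn_integral_mono)
          fix z
          have "exp (- (\<alpha> * q / 2) * (norm (\<psi> z - w))\<^sup>2) \<le> g * exp (- norm (w - \<psi> z))"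
            unfolding g_def norm_minus_commute[of w] using \<alpha> q by (intro gaussian_le_exponential) simp
          then have "e w z \<le> ennreal (g * exp (- norm (w - \<psi> z)))" unfolding e_def by (rule ennreal_leI)
          then have "ennreal (D z) * e w z \<le> ennreal (D z) * ennreal (g * exp (- norm (w - \<psi> z)))" by (rule mult_left_mono) simp
          then show "ennreal (D z) * e w z \<le> ennreal g * (ennreal (D z) * ennreal (exp (- norm (w - \<psi> z))))"
            using g by (simp add: ennreal_mult mult_ac)
        qed
        also have "\<dots> = ennreal g * (\<integral>\<^sup>+z. ennreal (D z) * ennreal (exp (- norm (w - \<psi> z))) \<partial>lborel)"
          by (rule nn_integral_cmult) measurable
        finally have "epow (BR R w) r \<le> epow (ennreal g * (\<integral>\<^sup>+z. ennreal (D z) * ennreal (exp (- norm (w - \<psi> z))) \<partial>lborel)) r"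
          using r0 by (intro epow_mono) auto
        then show "epow (BR R w) r \<le> ennreal (g powr r) * epow (\<integral>\<^sup>+z. ennreal (D z) * ennreal (exp (- norm (w - \<psi> z))) \<partial>lborel) r"
          using r0 g by (simp add: epow_mult epow_ennreal)
      qed
      also have "\<dots> = ennreal (g powr r) * (\<integral>\<^sup>+w. epow (\<integral>\<^sup>+z. ennreal (D z) * ennreal (exp (- norm (w - \<psi> z))) \<partial>lborel) r \<partial>lborel)"
      proof (rule nn_integral_cmult)
        have "(\<lambda>w. \<integral>\<^sup>+z. ennreal (D z) * ennreal (exp (- norm (w - \<psi> z))) \<partial>lborel) \<in> borel_measurable lborel"
          by (rule lborel.borel_measurable_nn_integral) measurable
        then show "(\<lambda>w. epow (\<integral>\<^sup>+z. ennreal (D z) * ennreal (exp (- norm (w - \<psi> z))) \<partial>lborel) r) \<in> borel_measurable lborel"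
          by (rule measurable_compose[OF _ measurable_epow])
      qed
      also have "\<dots> \<le> ennreal (g powr r) * ennreal ((C * (K * \<Lambda>)) powr r)"
      proof (rule mult_left_mono[OF mean[of D \<psi> R' "K * \<Lambda>"]])
        show "norm (\<psi> z) \<le> R'" if "D z \<noteq> 0" for z
          using that by (intro R') (auto simp: D_def indicator_def split: if_splits)
      qed (use D0 Dfin K \<Lambda> main in auto)
      also have "\<dots> = ennreal ((g * (C * (K * \<Lambda>))) powr r)" by (simp add: powr_mult flip: ennreal_mult)
      finally show ?thesis .
    qed
    have "(\<integral>\<^sup>+w. epow (?B w) r \<partial>lborel) = (\<integral>\<^sup>+w. (SUP R. epow (BR R w) r) \<partial>lborel)"
      unfolding B_SUP epow_SUP[OF r0] ..
    also have "\<dots> = (SUP R. \<integral>\<^sup>+w. epow (BR R w) r \<partial>lborel)"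
    proof (rule nn_integral_monotone_convergence_SUP)
      show "incseq (\<lambda>R w. epow (BR R w) r)"
        using BR_mono r0 by (auto simp: incseq_def le_fun_def intro!: epow_mono)
    qed measurable
    also have "\<dots> \<le> ennreal ((g * (C * (K * \<Lambda>))) powr r)" by (rule SUP_least) (rule BR_le)
    finally have "Lr_norm r ?B \<le> epow (ennreal ((g * (C * (K * \<Lambda>))) powr r)) (1 / r)"
      unfolding Lr_norm_def using r0 by (intro epow_mono) auto
    also have "\<dots> = ennreal (g * (C * (K * \<Lambda>)))"
      using r0 g C K \<Lambda> by (simp add: epow_ennreal powr_powr)
    also have "\<dots> \<le> ennreal (g * C * (K + 1) * \<Lambda>)"
    proof (rule ennreal_leI)
      have "K * \<Lambda> \<le> (K + 1) * \<Lambda>" using \<Lambda> by (intro mult_right_mono) auto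
      then have "g * C * (K * \<Lambda>) \<le> g * C * ((K + 1) * \<Lambda>)" using g C by (intro mult_left_mono) auto
      then show "g * (C * (K * \<Lambda>)) \<le> g * C * (K + 1) * \<Lambda>" by (simp only: mult.assoc)
    qed
    finally show "Lr_norm (p / (p - q)) ?B \<le> ennreal (g * C * (K + 1) * \<Lambda>)" unfolding r_def .
  qed
qed

section \<open>Normal families\<close>

text \<open>By Cauchy's formula the partial derivatives converge uniformly on balls as well.\<close>

lemma entire_uniform_limit:
  fixes F :: "nat \<Rightarrow> complex^'n \<Rightarrow> complex"
  assumes ent: "\<And>n. entire (F n)" and lim: "\<And>R. uniform_limit (cball 0 R) F f sequentially"
  shows "entire f"
  unfolding entire_def
proof
  fix z :: "complex^'n"
  have cont: "continuous_on (cball 0 R) f" for R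
    by (rule uniform_limit_theorem[OF _ lim]) (auto intro!: always_eventually entire_imp_continuous_on ent)
  have fcont: "continuous_on UNIV f"
  proof (rule continuous_at_imp_continuous_on, rule ballI)
    fix x :: "complex^'n"
    have "x \<in> interior (cball 0 (norm x + 1))" by simp
    then show "isCont f x" by (rule continuous_on_interior[OF cont])
  qed
  let ?c = "\<lambda>h j x t. h (x + cis (2 * pi * t) *s axis j 1) * cis (- (2 * pi * t))"
  define G where "G = (\<lambda>j x. integral (cbox 0 (1::real)) (?c f j x))"
  have int: "continuous_on {0..1::real} (?c h j x)" if "continuous_on UNIV h" for h j and x :: "complex^'n"
    by (intro continuous_intros continuous_on_compose2[OF that] bounded_linear.continuous_on[OF bounded_linear_vector_scalar]) auto
  define S where "S = ball z 1"
  have near: "norm (x + cis t *s axis j 1) \<le> norm z + 2" if "x \<in> S" for x j t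
  proof -
    have "norm (x + cis t *s axis j 1) \<le> norm x + norm (cis t *s (axis j 1 :: complex^'n))" by (rule norm_triangle_ineq)
    moreover have "norm (cis t *s (axis j 1 :: complex^'n)) = 1" by (simp add: norm_vector_scalar norm_axis_complex)
    moreover have "norm x \<le> norm z + 1" using that norm_triangle_sub[of x z] by (simp add: S_def dist_norm norm_minus_commute)
    ultimately show ?thesis by linarith
  qed
  have nle: "\<forall>\<^sub>F n in sequentially. \<forall>x\<in>S. \<forall>h. norm ((\<Sum>j\<in>UNIV. h $ j * cpartial j (F n) x) - (\<Sum>j\<in>UNIV. h $ j * G j x)) \<le> e * norm h"
    if e: "0 < e" for e
  proof -
    define \<delta> where "\<delta> = e / real CARD('n)"
    have \<delta>: "0 < \<delta>" using e by (simp add: \<delta>_def)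
    have "\<forall>\<^sub>F n in sequentially. \<forall>y\<in>cball 0 (norm z + 2). dist (F n y) (f y) < \<delta>"
      using lim[of "norm z + 2"] \<delta> by (auto simp: uniform_limit_iff)
    then show ?thesis
    proof (rule eventually_mono, intro ballI allI)
      fix n x and h :: "complex^'n"
      assume close: "\<forall>y\<in>cball 0 (norm z + 2). dist (F n y) (f y) < \<delta>" and x: "x \<in> S"
      have dj: "norm (cpartial j (F n) x - G j x) \<le> \<delta>" for j
      proof -
        have "cpartial j (F n) x - G j x = integral {0..1} (\<lambda>t. ?c (F n) j x t - ?c f j x t)"
          unfolding cpartial_circle_integral[OF ent] G_def box_real
          by (rule integral_diff[symmetric]) (intro integrable_continuous_real int fcont entire_imp_continuous_on[OF ent])+
        also have "norm \<dots> \<le> \<delta> * (1 - 0)"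
        proof (rule integral_bound)
          show "continuous_on {0..1} (\<lambda>t. ?c (F n) j x t - ?c f j x t)"
            by (intro continuous_on_diff int fcont entire_imp_continuous_on[OF ent])
          fix t :: real
          let ?y = "x + cis (2 * pi * t) *s axis j 1"
          have "?y \<in> cball 0 (norm z + 2)" using near[OF x] by simp
          then have "dist (F n ?y) (f ?y) < \<delta>" using close by blast
          then show "norm (?c (F n) j x t - ?c f j x t) \<le> \<delta>"
            by (simp add: dist_norm norm_mult flip: left_diff_distrib)
        qed simp
        finally show ?thesis by simp
      qed
      have "norm ((\<Sum>j\<in>UNIV. h $ j * cpartial j (F n) x) - (\<Sum>j\<in>UNIV. h $ j * G j x))
          = norm (\<Sum>j\<in>UNIV. h $ j * (cpartial j (F n) x - G j x))"
        by (simp add: sum_subtractf right_diff_distrib)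
      also have "\<dots> \<le> (\<Sum>j\<in>(UNIV :: 'n set). norm h * \<delta>)"
      proof (rule sum_norm_le)
        fix j
        show "norm (h $ j * (cpartial j (F n) x - G j x)) \<le> norm h * \<delta>"
          unfolding norm_mult by (rule mult_mono[OF Finite_Cartesian_Product.norm_nth_le dj]) auto
      qed
      also have "\<dots> = e * norm h" by (simp add: \<delta>_def)
      finally show "norm ((\<Sum>j\<in>UNIV. h $ j * cpartial j (F n) x) - (\<Sum>j\<in>UNIV. h $ j * G j x)) \<le> e * norm h" .
    qed
  qed
  have ptlim: "(\<lambda>n. F n x) \<longlonglongrightarrow> f x" for x
    by (rule tendsto_uniform_limitI[OF lim[of "norm x"]]) simp
  have zS: "z \<in> S" by (simp add: S_def)
  have "\<exists>g. \<forall>x\<in>S. (\<lambda>n. F n x) \<longlonglongrightarrow> g x \<and> (g has_derivative (\<lambda>h. \<Sum>j\<in>UNIV. h $ j * G j x)) (at x within S)"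
    by (rule has_derivative_sequence[OF _ _ nle zS ptlim])
       (auto simp: S_def intro: has_derivative_at_withinI entire_has_derivative[OF ent])
  then obtain g where g: "\<And>x. x \<in> S \<Longrightarrow> (\<lambda>n. F n x) \<longlonglongrightarrow> g x"
    "\<And>x. x \<in> S \<Longrightarrow> (g has_derivative (\<lambda>h. \<Sum>j\<in>UNIV. h $ j * G j x)) (at x within S)" by blast
  have gf: "g x = f x" if "x \<in> S" for x by (rule LIMSEQ_unique[OF g(1)[OF that] ptlim])
  have "(f has_derivative (\<lambda>h. \<Sum>j\<in>UNIV. h $ j * G j z)) (at z within S)"
    by (rule has_derivative_transform[OF zS _ g(2)[OF zS]]) (simp add: gf)
  then have "(f has_derivative (\<lambda>h. \<Sum>j\<in>UNIV. h $ j * G j z)) (at z)"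
    using at_within_open[OF zS] by (simp add: S_def)
  then show "\<exists>D. (f has_derivative D) (at z) \<and> (\<forall>c v. D (c *s v) = c * D v)"
    by (intro exI[of _ "\<lambda>h. \<Sum>j\<in>UNIV. h $ j * G j z"]) (auto simp: sum_distrib_left mult.assoc)
qed

lemma entire_Lipschitz_cball:
  fixes f :: "complex^'n \<Rightarrow> complex"
  assumes f: "entire f" and B: "\<And>w. w \<in> cball 0 (R + 1) \<Longrightarrow> norm (f w) \<le> B"
    and xy: "x \<in> cball 0 R" "y \<in> cball 0 R"
  shows "norm (f x - f y) \<le> real CARD('n) * B * norm (x - y)"
proof (rule differentiable_bound[where S = "cball 0 R" and f' = "\<lambda>z v. \<Sum>j\<in>UNIV. v $ j * cpartial j f z"])
  show "(f has_derivative (\<lambda>v. \<Sum>j\<in>UNIV. v $ j * cpartial j f z)) (at z within cball 0 R)" for z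
    by (rule has_derivative_at_withinI[OF entire_has_derivative[OF f]])
  show "onorm (\<lambda>v. \<Sum>j\<in>UNIV. v $ j * cpartial j f z) \<le> real CARD('n) * B" if z: "z \<in> cball 0 R" for z
  proof (rule onorm_le)
    fix v :: "complex^'n"
    have d: "norm (cpartial j f z) \<le> B" for j
    proof -
      have "norm (cpartial j f z) \<le> B / 1"
      proof (rule cpartial_bound[OF f])
        fix t :: complex assume "norm t = 1"
        then have "norm (z + axis j t) \<le> R + 1"
          using z norm_triangle_ineq[of z "axis j t"] by (simp add: norm_axis_complex)
        then show "norm (f (z + axis j t)) \<le> B" by (intro B) simp
      qed simp
      then show ?thesis by simp
    qed
    have "norm (\<Sum>j\<in>UNIV. v $ j * cpartial j f z) \<le> (\<Sum>j\<in>(UNIV :: 'n set). norm v * B)"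
    proof (rule sum_norm_le)
      fix j
      show "norm (v $ j * cpartial j f z) \<le> norm v * B"
        unfolding norm_mult by (rule mult_mono[OF Finite_Cartesian_Product.norm_nth_le d]) auto
    qed
    then show "norm (\<Sum>j\<in>UNIV. v $ j * cpartial j f z) \<le> real CARD('n) * B * norm v" by (simp add: mult_ac)
  qed
qed (use xy in auto)

text \<open>Local bounds give local Lipschitz bounds by Cauchy's estimate, so the theorem of Arzela and Ascoli
  applies on every ball, and a diagonal sequence works on all of them.\<close>

lemma entire_normal_family:
  fixes F :: "nat \<Rightarrow> complex^'n \<Rightarrow> complex"
  assumes ent: "\<And>n. entire (F n)" and B: "\<And>n w. norm (F n w) \<le> B (norm w)" and mono: "mono B"
  obtains k f where "strict_mono (k :: nat \<Rightarrow> nat)" "entire f" "\<And>R. uniform_limit (cball 0 R) (\<lambda>n. F (k n)) f sequentially"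
proof -
  define P where "P = (\<lambda>(i::nat) (r::nat \<Rightarrow> nat). \<exists>g. uniform_limit (cball 0 (real i)) (\<lambda>n. F (r n)) g sequentially)"
  have sub: "\<exists>k. strict_mono (k :: nat \<Rightarrow> nat) \<and> P i (r \<circ> k)" for i r
  proof -
    define L where "L = real CARD('n) * \<bar>B (real i + 1)\<bar> + 1"
    have L: "0 < L" by (simp add: L_def add_nonneg_pos)
    have bd: "norm (F n w) \<le> \<bar>B (real i + 1)\<bar>" if "w \<in> cball 0 (real i + 1)" for n w
      using B[of n w] monoD[OF mono, of "norm w" "real i + 1"] that by simp
    have lip: "norm (F n x - F n y) \<le> L * norm (x - y)" if "x \<in> cball 0 (real i)" "y \<in> cball 0 (real i)" for n x y
    proof -
      have "norm (F n x - F n y) \<le> real CARD('n) * \<bar>B (real i + 1)\<bar> * norm (x - y)"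
        by (rule entire_Lipschitz_cball[OF ent bd that])
      also have "\<dots> \<le> L * norm (x - y)" by (intro mult_right_mono) (auto simp: L_def)
      finally show ?thesis .
    qed
    obtain g k where gk: "strict_mono (k :: nat \<Rightarrow> nat)"
      "\<And>e. 0 < e \<Longrightarrow> \<exists>N. \<forall>n x. n \<ge> N \<and> x \<in> cball 0 (real i) \<longrightarrow> norm (F (r (k n)) x - g x) < e"
    proof (rule Arzela_Ascoli[of "cball (0::complex^'n) (real i)" "\<lambda>n. F (r n)" "\<bar>B (real i + 1)\<bar>"])
      show "norm (F (r n) x) \<le> \<bar>B (real i + 1)\<bar>" if "x \<in> cball 0 (real i)" for n x
        using that by (intro bd) simp
      show "\<exists>d>0. \<forall>n y. y \<in> cball 0 (real i) \<and> norm (x - y) < d \<longrightarrow> norm (F (r n) x - F (r n) y) < e"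
        if x: "x \<in> cball 0 (real i)" and e: "0 < e" for x e
      proof (intro exI[of _ "e / L"] conjI allI impI)
        show "0 < e / L" using e L by simp
        fix n y assume y: "y \<in> cball 0 (real i) \<and> norm (x - y) < e / L"
        have "norm (F (r n) x - F (r n) y) \<le> L * norm (x - y)" using x y by (intro lip) auto
        also have "\<dots> < e" using y L by (simp add: field_simps)
        finally show "norm (F (r n) x - F (r n) y) < e" .
      qed
    qed auto
    have "uniform_limit (cball 0 (real i)) (\<lambda>n. F (r (k n))) g sequentially"
      unfolding uniform_limit_sequentially_iff dist_norm using gk(2) by metis
    then show ?thesis using gk(1) by (auto simp: P_def)
  qed
  have P_P: "P i (r \<circ> k2)" if r1: "P i (r \<circ> k1)" and r2: "\<And>j. N \<le> j \<Longrightarrow> \<exists>j'. j \<le> j' \<and> k2 j = k1 j'" for i r k1 k2 N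
  proof -
    obtain g where g: "uniform_limit (cball 0 (real i)) (\<lambda>n. F (r (k1 n))) g sequentially" using r1 by (auto simp: P_def)
    have "uniform_limit (cball 0 (real i)) (\<lambda>n. F (r (k2 n))) g sequentially"
      unfolding uniform_limit_sequentially_iff
    proof (intro allI impI)
      fix e :: real assume "0 < e"
      then obtain N' where N': "\<And>n x. N' \<le> n \<Longrightarrow> x \<in> cball 0 (real i) \<Longrightarrow> dist (F (r (k1 n)) x) (g x) < e"
        using g unfolding uniform_limit_sequentially_iff by blast
      have "dist (F (r (k2 n)) x) (g x) < e" if n: "max N N' \<le> n" and x: "x \<in> cball 0 (real i)" for n x
      proof -
        have "N \<le> n" using n by simp
        then obtain j' where "n \<le> j'" "k2 n = k1 j'" using r2 by blast
        then show ?thesis using N'[of j' x] n x by simp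
      qed
      then show "\<exists>N. \<forall>n\<ge>N. \<forall>x\<in>cball 0 (real i). dist (F (r (k2 n)) x) (g x) < e" by blast
    qed
    then show ?thesis by (auto simp: P_def)
  qed
  obtain k where k: "strict_mono (k :: nat \<Rightarrow> nat)" "\<And>i. P i (id \<circ> k)"
  proof (rule subsequence_diagonalization_lemma[of P id])
    show "\<exists>k. strict_mono (k :: nat \<Rightarrow> nat) \<and> P i (r \<circ> k)" for i r by (rule sub)
    show "P i (r \<circ> k2)" if "P i (r \<circ> k1)" "\<And>j. N \<le> j \<Longrightarrow> \<exists>j'. j \<le> j' \<and> k2 j = k1 j'" for i r k1 k2 N
      using that by (rule P_P)
  qed auto
  have ui: "\<exists>g. uniform_limit (cball 0 (real i)) (\<lambda>n. F (k n)) g sequentially" for i :: nat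
    using k(2)[of i] by (simp add: P_def)
  define f where "f = (\<lambda>z. lim (\<lambda>n. F (k n) z))"
  have uf: "uniform_limit (cball 0 R) (\<lambda>n. F (k n)) f sequentially" for R :: real
  proof -
    obtain i :: nat where i: "R \<le> real i" using real_arch_simple by blast
    obtain g where g: "uniform_limit (cball 0 (real i)) (\<lambda>n. F (k n)) g sequentially" using ui by blast
    have "f z = g z" if "z \<in> cball 0 (real i)" for z
      unfolding f_def by (rule limI[OF tendsto_uniform_limitI[OF g that]])
    then have "uniform_limit (cball 0 (real i)) (\<lambda>n. F (k n)) f sequentially"
      using g by (subst uniform_limit_cong'[where g = "\<lambda>n. F (k n)" and i = g]) auto
    then show ?thesis by (rule uniform_limit_on_subset) (use i in auto)
  qed
  show ?thesis by (rule that[OF k(1) _ uf]) (rule entire_uniform_limit[OF ent uf])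
qed

lemma fock_mass_bounded_pointwise:
  assumes p: "0 < (p::real)" and \<alpha>: "0 < \<alpha>"
  obtains C where "0 < C" "\<And>(f :: complex^'n \<Rightarrow> complex) M z. entire f \<Longrightarrow> fock_mass m \<alpha> p f \<le> ennreal M \<Longrightarrow> 0 \<le> M \<Longrightarrow>
    norm (f z) \<le> (C * M) powr (1 / p) * exp (\<alpha> / 2 * (norm z)\<^sup>2)"
proof -
  obtain C where C: "0 < C" "\<And>(f :: complex^'n \<Rightarrow> complex) a r. entire f \<Longrightarrow> 0 < r \<Longrightarrow> r \<le> 1 \<Longrightarrow>
     ennreal (fock_mod m \<alpha> f a powr p * r ^ DIM(complex^'n)) \<le>
     ennreal C * (\<integral>\<^sup>+w. ennreal (fock_mod m \<alpha> f w powr p) * indicator (ball a r) w \<partial>lborel)"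
    using fock_mod_mean_le[OF p \<alpha>, of m] by blast
  show ?thesis
  proof (rule that[OF C(1)])
    fix f :: "complex^'n \<Rightarrow> complex" and M :: real and z
    assume f: "entire f" and M: "fock_mass m \<alpha> p f \<le> ennreal M" "0 \<le> M"
    have "fock_mod m \<alpha> f z \<le> (C * M / 1 ^ DIM(complex^'n)) powr (1 / p)"
      by (rule fock_mod_le_local_mean[OF p C(1) C(2)[OF f], where E = UNIV]) (use M in \<open>auto simp: fock_mass_def\<close>)
    from fock_mod_le_imp[OF this]
    have "norm (f z) \<le> (C * M) powr (1 / p) * exp (\<alpha> / 2 * (norm z)\<^sup>2) / (1 + norm z) ^ m" by simp
    also have "\<dots> \<le> (C * M) powr (1 / p) * exp (\<alpha> / 2 * (norm z)\<^sup>2) / 1"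
      by (rule divide_left_mono) (auto simp: one_le_power add_pos_nonneg)
    finally show "norm (f z) \<le> (C * M) powr (1 / p) * exp (\<alpha> / 2 * (norm z)\<^sup>2)" by simp
  qed
qed

text \<open>Boundedness in the space implies local boundedness by the mean value inequality, and the limit
  inherits the bound by Fatou's lemma.\<close>

lemma fock_mass_Montel:
  fixes F :: "nat \<Rightarrow> complex^'n \<Rightarrow> complex"
  assumes p: "0 < (p::real)" and \<alpha>: "0 < \<alpha>" and ent: "\<And>n. entire (F n)"
    and M: "\<And>n. fock_mass m \<alpha> p (F n) \<le> ennreal M" "0 \<le> M"
  obtains k f where "strict_mono (k :: nat \<Rightarrow> nat)" "entire f" "fock_mass m \<alpha> p f \<le> ennreal M"
    "\<And>R. uniform_limit (cball 0 R) (\<lambda>n. F (k n)) f sequentially"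
proof -
  obtain C where C: "0 < C" "\<And>(f :: complex^'n \<Rightarrow> complex) M z. entire f \<Longrightarrow> fock_mass m \<alpha> p f \<le> ennreal M \<Longrightarrow> 0 \<le> M \<Longrightarrow>
    norm (f z) \<le> (C * M) powr (1 / p) * exp (\<alpha> / 2 * (norm z)\<^sup>2)"
    using fock_mass_bounded_pointwise[OF p \<alpha>, where m = m] by blast
  define B where "B = (\<lambda>x::real. (C * M) powr (1 / p) * exp (\<alpha> / 2 * (max 0 x)\<^sup>2))"
  have mono: "mono B"
  proof (rule monoI)
    fix x y :: real assume "x \<le> y"
    then have "(max 0 x)\<^sup>2 \<le> (max 0 y)\<^sup>2" by (intro power_mono) auto
    then have "\<alpha> / 2 * (max 0 x)\<^sup>2 \<le> \<alpha> / 2 * (max 0 y)\<^sup>2" by (rule mult_left_mono) (use \<alpha> in simp)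
    then show "B x \<le> B y" unfolding B_def by (intro mult_left_mono) auto
  qed
  have bd: "norm (F n w) \<le> B (norm w)" for n w using C(2)[OF ent M] by (simp add: B_def)
  obtain k f where kf: "strict_mono (k :: nat \<Rightarrow> nat)" "entire f" "\<And>R. uniform_limit (cball 0 R) (\<lambda>n. F (k n)) f sequentially"
    by (rule entire_normal_family[OF ent bd mono]) (rule that)
  have "fock_mass m \<alpha> p f \<le> ennreal M"
  proof -
    have ptlim: "(\<lambda>n. ennreal (fock_mod m \<alpha> (F (k n)) z powr p)) \<longlonglongrightarrow> ennreal (fock_mod m \<alpha> f z powr p)" for z
    proof -
      have "(\<lambda>n. F (k n) z) \<longlonglongrightarrow> f z" by (rule tendsto_uniform_limitI[OF kf(3)[of "norm z"]]) simp
      then show ?thesis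
        unfolding fock_mod_def using p by (intro tendsto_ennrealI tendsto_powr' tendsto_mult tendsto_norm tendsto_const) auto
    qed
    have "fock_mass m \<alpha> p f = (\<integral>\<^sup>+z. liminf (\<lambda>n. ennreal (fock_mod m \<alpha> (F (k n)) z powr p)) \<partial>lborel)"
      unfolding fock_mass_def by (rule nn_integral_cong) (rule lim_imp_Liminf[OF sequentially_bot ptlim, symmetric])
    also have "\<dots> \<le> liminf (\<lambda>n. fock_mass m \<alpha> p (F (k n)))"
      unfolding fock_mass_def
    proof (rule nn_integral_liminf)
      fix n
      note [measurable] = entire_measurable[OF ent]
      have [measurable]: "fock_mod m \<alpha> (F (k n)) \<in> borel_measurable borel" by measurable
      show "(\<lambda>z. ennreal (fock_mod m \<alpha> (F (k n)) z powr p)) \<in> borel_measurable lborel" by measurable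
    qed
    also have "\<dots> \<le> ennreal M"
      by (rule order_trans[OF Liminf_le_Limsup Limsup_bounded]) (auto simp: M)
    finally show ?thesis .
  qed
  then show ?thesis by (rule that[OF kf(1,2) _ kf(3)])
qed

section \<open>Boundedness, compactness and the norm estimate\<close>

lemma fs_mass_finite_iff:
  fixes f :: "complex^'n \<Rightarrow> complex"
  assumes "0 < p" "0 < \<alpha>" "entire f"
  shows "fs_mass m \<alpha> p f < \<infinity> \<longleftrightarrow> fock_mass m \<alpha> p f < \<infinity>"
proof -
  obtain C where C: "0 < C" "\<And>f :: complex^'n \<Rightarrow> complex. entire f \<Longrightarrow> fock_mass m \<alpha> p f \<le> ennreal C * fs_mass m \<alpha> p f"
    by (rule fock_mass_le_fs_mass[OF assms(1,2), where m = m]) (rule that)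
  have "fock_mass m \<alpha> p f < \<infinity>" if "fs_mass m \<alpha> p f < \<infinity>"
    by (rule le_less_trans[OF C(2)[OF assms(3)]]) (use that in \<open>simp add: ennreal_mult_less_top\<close>)
  moreover have "fs_mass m \<alpha> p f < \<infinity>" if "fock_mass m \<alpha> p f < \<infinity>"
    using fs_mass_le_fock_mass[OF assms(1)] that by (rule le_less_trans)
  ultimately show ?thesis by (rule iffI)
qed

lemma fs_norm_finite_iff:
  fixes f :: "complex^'n \<Rightarrow> complex"
  assumes "0 < p" "0 < \<alpha>"
  shows "fs_norm m \<alpha> p f < \<infinity> \<longleftrightarrow> fs_mass m \<alpha> p f < \<infinity>"
  unfolding fs_norm_eq_mass epow_less_top_iff infinity_ennreal_def
  by (rule ennreal_mult_less_top_iff[OF fs_const_pos[OF assms]]) simp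

lemma fock_sobolev_iff_norm:
  fixes f :: "complex^'n \<Rightarrow> complex"
  assumes "0 < p" "0 < \<alpha>"
  shows "f \<in> fock_sobolev m \<alpha> p \<longleftrightarrow> entire f \<and> fs_norm m \<alpha> p f < \<infinity>"
  unfolding fock_sobolev_eq[OF assms] mem_Collect_eq fs_norm_finite_iff[OF assms]
  by (rule conj_cong[OF refl]) (rule fs_mass_finite_iff[OF assms, symmetric])

lemma entire_wcomp: "entire u \<Longrightarrow> entire_map \<psi> \<Longrightarrow> entire f \<Longrightarrow> entire (wcomp u \<psi> f)"
  unfolding wcomp_def by (rule entire_mult[OF _ entire_compose])

lemma fs_weight_measurable:
  fixes f :: "complex^'n \<Rightarrow> complex"
  assumes "entire f"
  shows "(\<lambda>z. (norm z ^ m) powr p * norm (f z) powr p * exp (- (\<alpha> * p / 2) * (norm z)\<^sup>2)) \<in> borel_measurable borel"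
proof -
  note [measurable] = entire_measurable[OF assms]
  show ?thesis by (intro borel_measurable_times gauss_measurable) measurable
qed

lemma fs_norm_scale:
  fixes f :: "complex^'n \<Rightarrow> complex"
  assumes p: "0 < p" and c: "0 \<le> c" and f: "entire f"
  shows "fs_norm m \<alpha> p (\<lambda>z. of_real c * f z) = ennreal c * fs_norm m \<alpha> p f"
proof -
  have "fs_mass m \<alpha> p (\<lambda>z. of_real c * f z) = (\<integral>\<^sup>+z. ennreal (c powr p) * ennreal ((norm z ^ m) powr p * norm (f z) powr p * exp (- (\<alpha> * p / 2) * (norm z)\<^sup>2)) \<partial>lborel)"
    unfolding fs_mass_def using c by (intro nn_integral_cong) (simp add: norm_mult powr_mult mult_ac flip: ennreal_mult)
  also have "\<dots> = ennreal (c powr p) * fs_mass m \<alpha> p f"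
    unfolding fs_mass_def using fs_weight_measurable[OF f] by (intro nn_integral_cmult) simp
  finally have "fs_norm m \<alpha> p (\<lambda>z. of_real c * f z) = epow (ennreal (c powr p)) (1 / p) * fs_norm m \<alpha> p f"
    using p by (simp add: fs_norm_eq_mass epow_mult mult_ac)
  then show ?thesis using p c by (simp add: epow_ennreal powr_powr)
qed

text \<open>A quasi-triangle inequality, stated for a majorant so that it applies to sums and to
  differences.\<close>

lemma fock_mass_add_le:
  fixes f g :: "complex^'n \<Rightarrow> complex"
  assumes p: "0 < p" and f: "entire f" and g: "entire g" and h: "\<And>z. norm (h z) \<le> norm (f z) + norm (g z)"
  shows "fock_mass m \<alpha> p h \<le> ennreal (2 powr p) * (fock_mass m \<alpha> p f + fock_mass m \<alpha> p g)"
proof -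
  have [measurable]: "fock_mod m \<alpha> f \<in> borel_measurable borel" "fock_mod m \<alpha> g \<in> borel_measurable borel"
    using entire_measurable[OF f] entire_measurable[OF g] by measurable
  have "fock_mass m \<alpha> p h \<le> (\<integral>\<^sup>+z. ennreal (2 powr p) * (ennreal (fock_mod m \<alpha> f z powr p) + ennreal (fock_mod m \<alpha> g z powr p)) \<partial>lborel)"
    unfolding fock_mass_def
  proof (rule nn_integral_mono)
    fix z
    have "fock_mod m \<alpha> h z \<le> (1 + norm z) ^ m * (norm (f z) + norm (g z)) * exp (- (\<alpha> / 2) * (norm z)\<^sup>2)"
      unfolding fock_mod_def using h[of z] by (intro mult_right_mono mult_left_mono) auto
    also have "\<dots> = fock_mod m \<alpha> f z + fock_mod m \<alpha> g z" by (simp add: fock_mod_def algebra_simps)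
    finally have "fock_mod m \<alpha> h z powr p \<le> (fock_mod m \<alpha> f z + fock_mod m \<alpha> g z) powr p" using p by (intro powr_mono2) auto
    also have "\<dots> \<le> 2 powr p * (fock_mod m \<alpha> f z powr p + fock_mod m \<alpha> g z powr p)" by (rule powr_add_le[OF p]) auto
    finally show "ennreal (fock_mod m \<alpha> h z powr p) \<le> ennreal (2 powr p) * (ennreal (fock_mod m \<alpha> f z powr p) + ennreal (fock_mod m \<alpha> g z powr p))"
      by (simp add: ennreal_leI flip: ennreal_mult ennreal_plus)
  qed
  also have "\<dots> = ennreal (2 powr p) * (fock_mass m \<alpha> p f + fock_mass m \<alpha> p g)"
    unfolding fock_mass_def by (simp add: nn_integral_cmult nn_integral_add)
  finally show ?thesis .
qed

lemma wcomp_norm_le: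
  assumes q: "0 < (q::real)" and p: "q < p" and \<alpha>: "0 < \<alpha>"
  obtains C where "0 < C" "\<And>(u :: complex^'n \<Rightarrow> complex) \<psi> f. entire u \<Longrightarrow> entire_map \<psi> \<Longrightarrow> entire f \<Longrightarrow>
     fs_norm m \<alpha> q (wcomp u \<psi> f) \<le> ennreal C * epow (Lr_norm (p / (p - q)) (fs_berezin m \<alpha> q \<psi> (\<lambda>z. norm (u z) powr q))) (1 / q) * fs_norm m \<alpha> p f"
proof -
  have p0: "0 < p" using q p by simp
  let ?k = "fs_const \<alpha> q m CARD('n)"
  have k: "0 < ?k" using fs_const_pos[OF q \<alpha>, of "CARD('n)" m] by simp
  obtain C1 where C1: "0 < C1" "\<And>(f :: complex^'n \<Rightarrow> complex) u \<psi>. entire f \<Longrightarrow> entire u \<Longrightarrow> entire_map \<psi> \<Longrightarrow>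
     fs_mass m \<alpha> q (wcomp u \<psi> f) \<le> ennreal C1 *
       (\<integral>\<^sup>+w. ennreal (fock_mod m \<alpha> f w powr q) * fs_berezin m \<alpha> q \<psi> (\<lambda>z. norm (u z) powr q) w \<partial>lborel)"
    using fs_mass_wcomp_le[OF q \<alpha>, where m = m] by blast
  obtain C2 where C2pos: "0 < C2" and C2a: "\<And>f :: complex^'n \<Rightarrow> complex. fs_norm m \<alpha> p f \<le> ennreal C2 * epow (fock_mass m \<alpha> p f) (1 / p)"
    and C2b: "\<And>f :: complex^'n \<Rightarrow> complex. entire f \<Longrightarrow> epow (fock_mass m \<alpha> p f) (1 / p) \<le> ennreal C2 * fs_norm m \<alpha> p f"
    by (rule fs_norm_equiv[OF p0 \<alpha>, where m = m]) (rule that)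
  note C2 = C2pos C2b
  show ?thesis
  proof (rule that[of "(?k * C1) powr (1 / q) * C2"])
    show "0 < (?k * C1) powr (1 / q) * C2" using k C1(1) C2(1) by simp
    fix u f :: "complex^'n \<Rightarrow> complex" and \<psi> :: "complex^'n \<Rightarrow> complex^'n"
    assume u: "entire u" and \<psi>: "entire_map \<psi>" and f: "entire f"
    let ?B = "fs_berezin m \<alpha> q \<psi> (\<lambda>z. norm (u z) powr q)"
    let ?L = "Lr_norm (p / (p - q)) ?B"
    have "fs_mass m \<alpha> q (wcomp u \<psi> f) \<le> ennreal C1 * (epow (fock_mass m \<alpha> p f) (q / p) * ?L)"
      by (rule order_trans[OF C1(2)[OF f u \<psi>]], rule mult_left_mono)
         (auto intro!: fock_mod_Hoelder q p f fs_berezin_measurable u \<psi>)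
    then have "ennreal ?k * fs_mass m \<alpha> q (wcomp u \<psi> f) \<le> ennreal ?k * (ennreal C1 * (epow (fock_mass m \<alpha> p f) (q / p) * ?L))"
      by (rule mult_left_mono) simp
    then have "fs_norm m \<alpha> q (wcomp u \<psi> f) \<le> epow (ennreal ?k * (ennreal C1 * (epow (fock_mass m \<alpha> p f) (q / p) * ?L))) (1 / q)"
      unfolding fs_norm_eq_mass using q by (intro epow_mono) auto
    also have "\<dots> = ennreal ((?k * C1) powr (1 / q)) * (epow (fock_mass m \<alpha> p f) (1 / p) * epow ?L (1 / q))"
      using q k C1(1) by (simp add: epow_mult epow_epow epow_ennreal powr_mult ennreal_mult mult.assoc)
    also have "\<dots> \<le> ennreal ((?k * C1) powr (1 / q)) * ((ennreal C2 * fs_norm m \<alpha> p f) * epow ?L (1 / q))"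
      by (intro mult_left_mono mult_right_mono C2(2) f) auto
    also have "\<dots> = ennreal ((?k * C1) powr (1 / q) * C2) * epow ?L (1 / q) * fs_norm m \<alpha> p f"
      using C2(1) by (simp add: ennreal_mult mult_ac)
    finally show "fs_norm m \<alpha> q (wcomp u \<psi> f) \<le> ennreal ((?k * C1) powr (1 / q) * C2) * epow ?L (1 / q) * fs_norm m \<alpha> p f" .
  qed
qed

lemma berezin_norm_le:
  assumes q: "0 < (q::real)" and p: "q < p" and \<alpha>: "0 < \<alpha>"
  obtains C where "0 < C" "\<And>(u :: complex^'n \<Rightarrow> complex) \<psi> N. entire u \<Longrightarrow> entire_map \<psi> \<Longrightarrow> 0 \<le> N \<Longrightarrow>
     (\<And>f. f \<in> fock_sobolev m \<alpha> p \<Longrightarrow> fs_norm m \<alpha> q (wcomp u \<psi> f) \<le> ennreal N * fs_norm m \<alpha> p f) \<Longrightarrow>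
     epow (Lr_norm (p / (p - q)) (fs_berezin m \<alpha> q \<psi> (\<lambda>z. norm (u z) powr q))) (1 / q) \<le> ennreal (C * N)"
proof -
  have p0: "0 < p" using q p by simp
  let ?k = "fs_const \<alpha> q m CARD('n)"
  have k: "0 < ?k" using fs_const_pos[OF q \<alpha>, of "CARD('n)" m] by simp
  obtain C3 where C3: "0 < C3" "\<And>(u :: complex^'n \<Rightarrow> complex) \<psi> \<Lambda>. entire u \<Longrightarrow> entire_map \<psi> \<Longrightarrow> 0 \<le> \<Lambda> \<Longrightarrow>
     (\<And>f. entire f \<Longrightarrow> fock_mass m \<alpha> p f < \<infinity> \<Longrightarrow> fs_mass m \<alpha> q (wcomp u \<psi> f) \<le> ennreal \<Lambda> * epow (fock_mass m \<alpha> p f) (q / p)) \<Longrightarrow>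
     Lr_norm (p / (p - q)) (fs_berezin m \<alpha> q \<psi> (\<lambda>z. norm (u z) powr q)) \<le> ennreal (C3 * \<Lambda>)"
    using berezin_Lr_le[OF q p \<alpha>, where m = m] by blast
  obtain C2 where C2pos: "0 < C2" and C2a: "\<And>f :: complex^'n \<Rightarrow> complex. fs_norm m \<alpha> p f \<le> ennreal C2 * epow (fock_mass m \<alpha> p f) (1 / p)"
    and C2b: "\<And>f :: complex^'n \<Rightarrow> complex. entire f \<Longrightarrow> epow (fock_mass m \<alpha> p f) (1 / p) \<le> ennreal C2 * fs_norm m \<alpha> p f"
    by (rule fs_norm_equiv[OF p0 \<alpha>, where m = m]) (rule that)
  note C2 = C2pos C2a
  show ?thesis
  proof (rule that[of "(C3 / ?k) powr (1 / q) * C2"])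
    show "0 < (C3 / ?k) powr (1 / q) * C2" using k C3(1) C2(1) by simp
    fix u :: "complex^'n \<Rightarrow> complex" and \<psi> :: "complex^'n \<Rightarrow> complex^'n" and N :: real
    assume u: "entire u" and \<psi>: "entire_map \<psi>" and N: "0 \<le> N"
      and bd: "\<And>f. f \<in> fock_sobolev m \<alpha> p \<Longrightarrow> fs_norm m \<alpha> q (wcomp u \<psi> f) \<le> ennreal N * fs_norm m \<alpha> p f"
    let ?L = "Lr_norm (p / (p - q)) (fs_berezin m \<alpha> q \<psi> (\<lambda>z. norm (u z) powr q))"
    have "?L \<le> ennreal (C3 * ((N * C2) powr q / ?k))"
    proof (rule C3(2)[OF u \<psi>])
      show "0 \<le> (N * C2) powr q / ?k" using k by simp
      fix f :: "complex^'n \<Rightarrow> complex" assume f: "entire f" and fin: "fock_mass m \<alpha> p f < \<infinity>"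
      have "f \<in> fock_sobolev m \<alpha> p" using f fin fock_sobolev_eq[where 'n = 'n, OF p0 \<alpha>] by blast
      from bd[OF this] have "fs_norm m \<alpha> q (wcomp u \<psi> f) \<le> ennreal N * (ennreal C2 * epow (fock_mass m \<alpha> p f) (1 / p))"
        by (rule order_trans[OF _ mult_left_mono[OF C2(2)]]) simp
      then have "epow (fs_norm m \<alpha> q (wcomp u \<psi> f)) q \<le> epow (ennreal (N * C2) * epow (fock_mass m \<alpha> p f) (1 / p)) q"
        using q N C2(1) by (intro epow_mono) (auto simp: ennreal_mult mult.assoc)
      also have "\<dots> = ennreal ((N * C2) powr q) * epow (fock_mass m \<alpha> p f) (q / p)"
        using q N C2(1) by (simp add: epow_mult epow_epow epow_ennreal)
      also have "epow (fs_norm m \<alpha> q (wcomp u \<psi> f)) q = ennreal ?k * fs_mass m \<alpha> q (wcomp u \<psi> f)"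
        using q by (simp add: fs_norm_eq_mass epow_epow)
      finally have "ennreal (1 / ?k) * (ennreal ?k * fs_mass m \<alpha> q (wcomp u \<psi> f)) \<le> ennreal (1 / ?k) * (ennreal ((N * C2) powr q) * epow (fock_mass m \<alpha> p f) (q / p))"
        by (rule mult_left_mono) simp
      then show "fs_mass m \<alpha> q (wcomp u \<psi> f) \<le> ennreal ((N * C2) powr q / ?k) * epow (fock_mass m \<alpha> p f) (q / p)"
        using k by (simp add: mult.assoc[symmetric] ennreal_mult[symmetric] less_imp_le)
    qed
    then have "epow ?L (1 / q) \<le> epow (ennreal (C3 * ((N * C2) powr q / ?k))) (1 / q)" using q by (intro epow_mono) auto
    also have "\<dots> = ennreal ((C3 / ?k) powr (1 / q) * C2 * N)"
    proof -
      have "(C3 * ((N * C2) powr q / ?k)) powr (1 / q) = (C3 / ?k) powr (1 / q) * ((N * C2) powr q) powr (1 / q)"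
        by (simp flip: powr_mult)
      also have "((N * C2) powr q) powr (1 / q) = N * C2" using q N C2(1) by (simp add: powr_powr)
      finally show ?thesis using C3(1) k by (simp add: epow_ennreal mult_ac)
    qed
    finally show "epow ?L (1 / q) \<le> ennreal ((C3 / ?k) powr (1 / q) * C2 * N)" .
  qed
qed

text \<open>Functions of norm \<open>0\<close> cannot be normalized; for them boundedness is used directly.\<close>

lemma fs_opnorm_bound:
  fixes u :: "complex^'n \<Rightarrow> complex"
  assumes q: "0 < q" and p: "0 < p" and \<alpha>: "0 < \<alpha>" and u: "entire u" and \<psi>: "entire_map \<psi>"
    and bd: "fs_bounded m \<alpha> p q (wcomp u \<psi>)"
  shows "fs_opnorm m \<alpha> p q (wcomp u \<psi>) < \<infinity>"
    and "\<And>f :: complex^'n \<Rightarrow> complex. f \<in> fock_sobolev m \<alpha> p \<Longrightarrow> fs_norm m \<alpha> q (wcomp u \<psi> f) \<le> fs_opnorm m \<alpha> p q (wcomp u \<psi>) * fs_norm m \<alpha> p f"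
proof -
  obtain C where C: "\<And>f. f \<in> fock_sobolev m \<alpha> p \<Longrightarrow> fs_norm m \<alpha> q (wcomp u \<psi> f) \<le> ennreal C * fs_norm m \<alpha> p f"
    using bd unfolding fs_bounded_def by blast
  have "fs_opnorm m \<alpha> p q (wcomp u \<psi>) \<le> ennreal C"
    unfolding fs_opnorm_def
  proof (rule SUP_least)
    fix f :: "complex^'n \<Rightarrow> complex" assume "f \<in> {f \<in> fock_sobolev m \<alpha> p. fs_norm m \<alpha> p f \<le> 1}"
    then have "fs_norm m \<alpha> q (wcomp u \<psi> f) \<le> ennreal C * fs_norm m \<alpha> p f" "ennreal C * fs_norm m \<alpha> p f \<le> ennreal C * 1"
      using C by (auto intro!: mult_left_mono simp del: mult_1_right)
    then show "fs_norm m \<alpha> q (wcomp u \<psi> f) \<le> ennreal C" by simp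
  qed
  then show "fs_opnorm m \<alpha> p q (wcomp u \<psi>) < \<infinity>" by (rule le_less_trans) simp
  fix f :: "complex^'n \<Rightarrow> complex" assume f: "f \<in> fock_sobolev m \<alpha> p"
  then have ent: "entire f" and fin: "fs_norm m \<alpha> p f < \<infinity>" using fock_sobolev_iff_norm[where 'n = 'n, OF p \<alpha>] by auto
  then obtain s where s: "fs_norm m \<alpha> p f = ennreal s" "0 \<le> s" by (cases "fs_norm m \<alpha> p f") auto
  show "fs_norm m \<alpha> q (wcomp u \<psi> f) \<le> fs_opnorm m \<alpha> p q (wcomp u \<psi>) * fs_norm m \<alpha> p f"
  proof (cases "s = 0")
    case True
    then show ?thesis using C[OF f] s by simp
  next
    case False
    then have s0: "0 < s" using s by simp
    define g where "g = (\<lambda>z. of_real (1 / s) * f z)"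
    have gn: "fs_norm m \<alpha> p g = 1"
      unfolding g_def using fs_norm_scale[OF p _ ent, of "1 / s" m \<alpha>] s s0 by (simp flip: ennreal_mult)
    have gent: "entire g" unfolding g_def by (intro entire_mult entire_const ent)
    have gFS: "g \<in> fock_sobolev m \<alpha> p" using fock_sobolev_iff_norm[where 'n = 'n, OF p \<alpha>] gent gn by simp
    have "wcomp u \<psi> g = (\<lambda>z. of_real (1 / s) * wcomp u \<psi> f z)" by (auto simp: wcomp_def g_def)
    then have "fs_norm m \<alpha> q (wcomp u \<psi> g) = ennreal (1 / s) * fs_norm m \<alpha> q (wcomp u \<psi> f)"
      using fs_norm_scale[OF q _ entire_wcomp[OF u \<psi> ent], of "1 / s"] s0 by simp
    moreover have "fs_norm m \<alpha> q (wcomp u \<psi> g) \<le> fs_opnorm m \<alpha> p q (wcomp u \<psi>)"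
      unfolding fs_opnorm_def by (rule SUP_upper) (use gFS gn in simp)
    ultimately have "ennreal (1 / s) * fs_norm m \<alpha> q (wcomp u \<psi> f) \<le> fs_opnorm m \<alpha> p q (wcomp u \<psi>)"
      by (simp only:)
    then have le: "ennreal s * (ennreal (1 / s) * fs_norm m \<alpha> q (wcomp u \<psi> f)) \<le> ennreal s * fs_opnorm m \<alpha> p q (wcomp u \<psi>)"
      by (rule mult_left_mono) simp
    have "ennreal s * ennreal (1 / s) = 1" using s0 by (simp flip: ennreal_mult)
    then have "ennreal s * (ennreal (1 / s) * X) = X" for X by (simp only: mult.assoc[symmetric] mult_1_left)
    from le[unfolded this] show ?thesis unfolding s by (simp only: mult.commute)
  qed
qed

lemma nn_integral_tail:
  fixes G :: "'a::euclidean_space \<Rightarrow> ennreal"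
  assumes G [measurable]: "G \<in> borel_measurable borel" and fin: "(\<integral>\<^sup>+z. G z \<partial>lborel) < \<infinity>" and e: "0 < e"
  obtains R :: nat where "(\<integral>\<^sup>+z. G z * indicator (- cball 0 (real R)) z \<partial>lborel) < e"
proof -
  let ?f = "\<lambda>(R::nat) z. G z * indicator (- cball 0 (real R)) z"
  have [measurable]: "cball (0::'a) r \<in> sets borel" for r by simp
  have "(\<integral>\<^sup>+z. (INF R. ?f R z) \<partial>lborel) = (INF R. \<integral>\<^sup>+z. ?f R z \<partial>lborel)"
  proof (rule nn_integral_monotone_convergence_INF_decseq)
    show "decseq ?f" by (rule decseq_SucI) (auto simp: le_fun_def indicator_def)
    show "(\<integral>\<^sup>+z. ?f 0 z \<partial>lborel) < \<infinity>"
      by (rule le_less_trans[OF nn_integral_mono fin]) (auto simp: indicator_def)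
  qed (auto intro!: borel_measurable_times_ennreal)
  moreover have "(INF R. ?f R z) = 0" for z
  proof -
    obtain R :: nat where "norm z \<le> real R" using real_arch_simple by blast
    then have "(INF R. ?f R z) \<le> 0" by (intro INF_lower2[of R]) auto
    then show ?thesis by simp
  qed
  ultimately have "(INF R. \<integral>\<^sup>+z. ?f R z \<partial>lborel) < e" using e by simp
  then show ?thesis unfolding INF_less_iff using that by blast
qed

text \<open>The integral of \<open>(G h)\<^sup>q B\<close> is split at a large ball. Inside, \<open>h\<close> is uniformly small and \<open>B\<close> is
  integrable, since \<open>B \<le> 1 + B\<^sup>r\<close>; outside, Hoelder's inequality leaves the small tail of \<open>B\<close> in
  \<open>L\<^sup>r\<close>.\<close>

lemma wcomp_mass_tendsto_0:
  fixes h :: "nat \<Rightarrow> complex^'n \<Rightarrow> complex"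
  assumes q: "0 < (q::real)" and p: "q < p" and \<alpha>: "0 < \<alpha>" and u: "entire u" and \<psi>: "entire_map \<psi>"
    and L: "in_Lr (p / (p - q)) (fs_berezin m \<alpha> q \<psi> (\<lambda>z. norm (u z) powr q))"
    and ent: "\<And>n. entire (h n)" and M: "\<And>n. fock_mass m \<alpha> p (h n) \<le> ennreal M" "0 \<le> M"
    and lim: "\<And>R. uniform_limit (cball 0 R) h (\<lambda>_. 0) sequentially"
  shows "(\<lambda>n. fs_mass m \<alpha> q (wcomp u \<psi> (h n))) \<longlonglongrightarrow> 0"
proof (rule order_tendstoI)
  fix a :: ennreal assume "0 < a"
  then obtain \<epsilon> where \<epsilon>: "0 < \<epsilon>" "ennreal \<epsilon> \<le> a"
  proof (cases a)
    case (real x)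
    then show ?thesis using \<open>0 < a\<close> that[of x] by simp
  next
    case top
    then show ?thesis using that[of 1] by simp
  qed
  define r where "r = p / (p - q)"
  have r: "1 < r" "0 < r" using q p by (auto simp: r_def field_simps)
  define B where "B = fs_berezin m \<alpha> q \<psi> (\<lambda>z. norm (u z) powr q)"
  have Bm [measurable]: "B \<in> borel_measurable borel" unfolding B_def by (rule fs_berezin_measurable[OF u \<psi> q])
  have [measurable]: "cball (0::complex^'n) R \<in> sets borel" for R by simp
  have Bfin: "(\<integral>\<^sup>+w. epow (B w) r \<partial>lborel) < \<infinity>"
    using L unfolding in_Lr_def Lr_norm_def B_def r_def by (simp add: epow_less_top_iff)
  obtain C where C: "0 < C" "\<And>(f :: complex^'n \<Rightarrow> complex) u \<psi>. entire f \<Longrightarrow> entire u \<Longrightarrow> entire_map \<psi> \<Longrightarrow>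
     fs_mass m \<alpha> q (wcomp u \<psi> f) \<le> ennreal C *
       (\<integral>\<^sup>+w. ennreal (fock_mod m \<alpha> f w powr q) * fs_berezin m \<alpha> q \<psi> (\<lambda>z. norm (u z) powr q) w \<partial>lborel)"
    using fs_mass_wcomp_le[OF q \<alpha>, where m = m] by blast
  \<comment> \<open>The tail beyond the ball contributes at most \<open>C M\<^sup>q\<^sup>/\<^sup>p \<delta> \<le> \<epsilon> / 4\<close>, the ball itself at most
     \<open>C \<eta> b \<le> \<epsilon> / 4\<close>.\<close>
  define \<delta> where "\<delta> = \<epsilon> / (4 * C * (M powr (q / p) + 1))"
  have M1: "0 < M powr (q / p) + 1" by (simp add: add_nonneg_pos)
  have \<delta>: "0 < \<delta>" "C * (M powr (q / p) * \<delta>) \<le> \<epsilon> / 4"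
  proof -
    show "0 < \<delta>" using \<epsilon> C(1) M1 by (simp add: \<delta>_def)
    have "C * (M powr (q / p) * \<delta>) \<le> C * ((M powr (q / p) + 1) * \<delta>)"
      using C(1) \<open>0 < \<delta>\<close> by (intro mult_left_mono mult_right_mono) auto
    also have "\<dots> = \<epsilon> / 4" using C(1) M1 by (simp add: \<delta>_def)
    finally show "C * (M powr (q / p) * \<delta>) \<le> \<epsilon> / 4" .
  qed
  have Bp: "(\<lambda>w. epow (B w) r) \<in> borel_measurable borel" by measurable
  obtain R :: nat where R: "(\<integral>\<^sup>+w. epow (B w) r * indicator (- cball 0 (real R)) w \<partial>lborel) < ennreal (\<delta> powr r)"
    by (rule nn_integral_tail[OF Bp Bfin, of "ennreal (\<delta> powr r)"]) (use \<delta> in \<open>auto intro: that\<close>)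
  define Bo where "Bo = (\<lambda>w. B w * indicator (- cball 0 (real R)) w)"
  have Bom [measurable]: "Bo \<in> borel_measurable borel" unfolding Bo_def by measurable
  have Lo: "Lr_norm r Bo \<le> ennreal \<delta>"
  proof -
    have "epow (Bo w) r = epow (B w) r * indicator (- cball 0 (real R)) w" for w
      by (auto simp: Bo_def indicator_def)
    then have "Lr_norm r Bo \<le> epow (ennreal (\<delta> powr r)) (1 / r)"
      unfolding Lr_norm_def using R r by (intro epow_mono) auto
    then show ?thesis using r \<delta> by (simp add: epow_ennreal powr_powr)
  qed
  have "(\<integral>\<^sup>+w. B w * indicator (cball 0 (real R)) w \<partial>lborel) < \<infinity>"
  proof -
    have x: "x \<le> 1 + epow x r" for x
    proof (cases x)
      case (real t)
      have "t \<le> 1 + t powr r"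
      proof (cases "t \<le> 1")
        case False
        then have "t powr 1 \<le> t powr r" using r by (intro powr_mono) auto
        then show ?thesis using False by simp
      qed (simp add: add_increasing2)
      then show ?thesis using real by (simp add: epow_ennreal ennreal_leI flip: ennreal_plus ennreal_1)
    qed simp
    have "(\<integral>\<^sup>+w. B w * indicator (cball 0 (real R)) w \<partial>lborel) \<le> (\<integral>\<^sup>+w. indicator (cball 0 (real R)) w + epow (B w) r \<partial>lborel)"
      using x by (intro nn_integral_mono) (auto simp: indicator_def)
    also have "\<dots> = emeasure lborel (cball (0::complex^'n) (real R)) + (\<integral>\<^sup>+w. epow (B w) r \<partial>lborel)"
      by (subst nn_integral_add) auto
    also have "\<dots> < \<infinity>" using Bfin emeasure_lborel_cball_finite[of "0::complex^'n" "real R"] by simp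
    finally show ?thesis .
  qed
  then obtain b where b: "(\<integral>\<^sup>+w. B w * indicator (cball 0 (real R)) w \<partial>lborel) = ennreal b" "0 \<le> b"
    by (cases "\<integral>\<^sup>+w. B w * indicator (cball 0 (real R)) w \<partial>lborel") auto
  define \<eta> where "\<eta> = \<epsilon> / (4 * C * (b + 1))"
  have \<eta>: "0 < \<eta>" "C * (\<eta> * b) \<le> \<epsilon> / 4"
  proof -
    show "0 < \<eta>" using \<epsilon> C(1) b by (simp add: \<eta>_def)
    have "C * (\<eta> * b) \<le> C * (\<eta> * (b + 1))"
      using C(1) \<open>0 < \<eta>\<close> by (intro mult_left_mono) auto
    also have "\<dots> = \<epsilon> / 4" using C(1) b by (simp add: \<eta>_def)
    finally show "C * (\<eta> * b) \<le> \<epsilon> / 4" .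
  qed
  define e where "e = \<eta> powr (1 / q) / (1 + real R) ^ m"
  have e: "0 < e" using \<eta> by (simp add: e_def)
  have "\<forall>\<^sub>F n in sequentially. \<forall>w\<in>cball 0 (real R). dist (h n w) 0 < e"
    using lim[of "real R"] e by (auto simp: uniform_limit_iff)
  then show "\<forall>\<^sub>F n in sequentially. fs_mass m \<alpha> q (wcomp u \<psi> (h n)) < a"
  proof (rule eventually_mono)
    fix n assume close: "\<forall>w\<in>cball 0 (real R). dist (h n w) 0 < e"
    have hm [measurable]: "fock_mod m \<alpha> (h n) \<in> borel_measurable borel" using entire_measurable[OF ent[of n]] by measurable
    have in_ball: "ennreal (fock_mod m \<alpha> (h n) w powr q) * (B w * indicator (cball 0 (real R)) w) \<le> ennreal \<eta> * (B w * indicator (cball 0 (real R)) w)" for w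
    proof (cases "w \<in> cball 0 (real R)")
      case True
      have "norm (h n w) < e" using close True by (metis dist_0_norm dist_commute)
      then have "fock_mod m \<alpha> (h n) w \<le> (1 + real R) ^ m * e * 1"
        unfolding fock_mod_def using True \<alpha> e by (intro mult_mono power_mono) auto
      also have "\<dots> = \<eta> powr (1 / q)"
      proof -
        have "1 + real R \<noteq> 0" by linarith
        then show ?thesis by (simp add: e_def)
      qed
      finally have "fock_mod m \<alpha> (h n) w powr q \<le> (\<eta> powr (1 / q)) powr q" using q by (intro powr_mono2) auto
      then have "fock_mod m \<alpha> (h n) w powr q \<le> \<eta>" using q \<eta> by (simp add: powr_powr)
      then show ?thesis by (intro mult_right_mono ennreal_leI) auto
    qed simp
    have "fs_mass m \<alpha> q (wcomp u \<psi> (h n)) \<le> ennreal C * (\<integral>\<^sup>+w. ennreal (fock_mod m \<alpha> (h n) w powr q) * B w \<partial>lborel)"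
      unfolding B_def by (rule C(2)[OF ent u \<psi>])
    also have "(\<integral>\<^sup>+w. ennreal (fock_mod m \<alpha> (h n) w powr q) * B w \<partial>lborel)
        = (\<integral>\<^sup>+w. ennreal (fock_mod m \<alpha> (h n) w powr q) * (B w * indicator (cball 0 (real R)) w) + ennreal (fock_mod m \<alpha> (h n) w powr q) * Bo w \<partial>lborel)"
      by (rule nn_integral_cong) (auto simp: Bo_def indicator_def)
    also have "\<dots> = (\<integral>\<^sup>+w. ennreal (fock_mod m \<alpha> (h n) w powr q) * (B w * indicator (cball 0 (real R)) w) \<partial>lborel) + (\<integral>\<^sup>+w. ennreal (fock_mod m \<alpha> (h n) w powr q) * Bo w \<partial>lborel)"
      by (rule nn_integral_add) measurable
    also have "ennreal C * \<dots> \<le> ennreal C * (ennreal \<eta> * ennreal b + ennreal (M powr (q / p)) * ennreal \<delta>)"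
    proof (intro mult_left_mono add_mono)
      have "(\<integral>\<^sup>+w. ennreal (fock_mod m \<alpha> (h n) w powr q) * (B w * indicator (cball 0 (real R)) w) \<partial>lborel) \<le> (\<integral>\<^sup>+w. ennreal \<eta> * (B w * indicator (cball 0 (real R)) w) \<partial>lborel)"
        by (intro nn_integral_mono in_ball)
      also have "\<dots> = ennreal \<eta> * ennreal b" unfolding b(1)[symmetric] by (rule nn_integral_cmult) measurable
      finally show "(\<integral>\<^sup>+w. ennreal (fock_mod m \<alpha> (h n) w powr q) * (B w * indicator (cball 0 (real R)) w) \<partial>lborel) \<le> ennreal \<eta> * ennreal b" .
      have "(\<integral>\<^sup>+w. ennreal (fock_mod m \<alpha> (h n) w powr q) * Bo w \<partial>lborel) \<le> epow (fock_mass m \<alpha> p (h n)) (q / p) * Lr_norm r Bo"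
        unfolding r_def by (rule fock_mod_Hoelder[OF q p ent Bom])
      also have "\<dots> \<le> epow (ennreal M) (q / p) * ennreal \<delta>"
        using q p by (intro mult_mono epow_mono M Lo) auto
      finally show "(\<integral>\<^sup>+w. ennreal (fock_mod m \<alpha> (h n) w powr q) * Bo w \<partial>lborel) \<le> ennreal (M powr (q / p)) * ennreal \<delta>"
        using M by (simp add: epow_ennreal)
    qed simp
    also have "\<dots> = ennreal (C * (\<eta> * b) + C * (M powr (q / p) * \<delta>))"
      using C(1) \<eta>(1) \<delta>(1) b by (simp add: distrib_left flip: ennreal_mult ennreal_plus)
    also have "\<dots> \<le> ennreal (\<epsilon> / 2)" using \<eta>(2) \<delta>(2) by (intro ennreal_leI) linarith
    also have "\<dots> < ennreal \<epsilon>" using \<epsilon> by (simp add: ennreal_less_iff)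
    finally show "fs_mass m \<alpha> q (wcomp u \<psi> (h n)) < a" using \<epsilon>(2) by (rule less_le_trans)
  qed
qed (simp add: not_less)

lemma fs_norm_tendsto_0:
  fixes h :: "nat \<Rightarrow> complex^'n \<Rightarrow> complex"
  assumes q: "0 < q" and \<alpha>: "0 < \<alpha>" and lim: "(\<lambda>n. fs_mass m \<alpha> q (h n)) \<longlonglongrightarrow> 0"
  shows "(\<lambda>n. fs_norm m \<alpha> q (h n)) \<longlonglongrightarrow> 0"
proof (rule order_tendstoI)
  let ?k = "fs_const \<alpha> q m CARD('n)"
  have k: "0 < ?k" using fs_const_pos[OF q \<alpha>, of "CARD('n)" m] by simp
  fix a :: ennreal assume "0 < a"
  then obtain s where s: "0 < s" "ennreal s \<le> a"
  proof (cases a)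
    case (real x)
    then show ?thesis using \<open>0 < a\<close> that[of x] by simp
  next
    case top
    then show ?thesis using that[of 1] by simp
  qed
  have "0 < ennreal ((s / 2) powr q / ?k)" using s k by simp
  then have "\<forall>\<^sub>F n in sequentially. fs_mass m \<alpha> q (h n) < ennreal ((s / 2) powr q / ?k)"
    by (rule order_tendstoD(2)[OF lim])
  then show "\<forall>\<^sub>F n in sequentially. fs_norm m \<alpha> q (h n) < a"
  proof (rule eventually_mono)
    fix n assume "fs_mass m \<alpha> q (h n) < ennreal ((s / 2) powr q / ?k)"
    then have "ennreal ?k * fs_mass m \<alpha> q (h n) \<le> ennreal ?k * ennreal ((s / 2) powr q / ?k)" by (intro mult_left_mono) auto
    also have "\<dots> = ennreal ((s / 2) powr q)" using k by (simp flip: ennreal_mult)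
    finally have "fs_norm m \<alpha> q (h n) \<le> epow (ennreal ((s / 2) powr q)) (1 / q)"
      unfolding fs_norm_eq_mass using q by (intro epow_mono) auto
    also have "\<dots> = ennreal (s / 2)" using q s by (simp add: epow_ennreal powr_powr)
    also have "\<dots> < ennreal s" using s by (simp add: ennreal_less_iff)
    finally show "fs_norm m \<alpha> q (h n) < a" using s(2) by (rule less_le_trans)
  qed
qed (simp add: not_less)

text \<open>The limit of the images is the image of the locally uniform limit.\<close>

lemma fs_compact_if_in_Lr:
  fixes u :: "complex^'n \<Rightarrow> complex"
  assumes q: "0 < (q::real)" and p: "q < p" and \<alpha>: "0 < \<alpha>" and u: "entire u" and \<psi>: "entire_map \<psi>"
    and L: "in_Lr (p / (p - q)) (fs_berezin m \<alpha> q \<psi> (\<lambda>z. norm (u z) powr q))"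
  shows "fs_compact m \<alpha> p q (wcomp u \<psi>)"
proof -
  have p0: "0 < p" using q p by simp
  obtain C where C: "0 < C" "\<And>(u :: complex^'n \<Rightarrow> complex) \<psi> f. entire u \<Longrightarrow> entire_map \<psi> \<Longrightarrow> entire f \<Longrightarrow>
     fs_norm m \<alpha> q (wcomp u \<psi> f) \<le> ennreal C * epow (Lr_norm (p / (p - q)) (fs_berezin m \<alpha> q \<psi> (\<lambda>z. norm (u z) powr q))) (1 / q) * fs_norm m \<alpha> p f"
    using wcomp_norm_le[OF q p \<alpha>, where m = m] by blast
  have maps: "wcomp u \<psi> f \<in> fock_sobolev m \<alpha> q" if f: "f \<in> fock_sobolev m \<alpha> p" for f
  proof -
    have ent: "entire f" and fin: "fs_norm m \<alpha> p f < \<infinity>" using f fock_sobolev_iff_norm[where 'n = 'n, OF p0 \<alpha>] by auto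
    have "fs_norm m \<alpha> q (wcomp u \<psi> f) < \<infinity>"
      by (rule le_less_trans[OF C(2)[OF u \<psi> ent]])
         (use L fin in \<open>simp add: in_Lr_def ennreal_mult_less_top epow_less_top_iff\<close>)
    then show ?thesis using fock_sobolev_iff_norm[where 'n = 'n, OF q \<alpha>] entire_wcomp[OF u \<psi> ent] by simp
  qed
  obtain C2 where C2pos: "0 < C2" and C2a: "\<And>f :: complex^'n \<Rightarrow> complex. fs_norm m \<alpha> p f \<le> ennreal C2 * epow (fock_mass m \<alpha> p f) (1 / p)"
    and C2b: "\<And>f :: complex^'n \<Rightarrow> complex. entire f \<Longrightarrow> epow (fock_mass m \<alpha> p f) (1 / p) \<le> ennreal C2 * fs_norm m \<alpha> p f"
    by (rule fs_norm_equiv[OF p0 \<alpha>, where m = m]) (rule that)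
  note C2 = C2pos C2b
  have seq: "\<exists>r g. strict_mono (r :: nat \<Rightarrow> nat) \<and> g \<in> fock_sobolev m \<alpha> q \<and>
                 (\<lambda>k. fs_norm m \<alpha> q (\<lambda>z. wcomp u \<psi> (F (r k)) z - g z)) \<longlonglongrightarrow> 0"
    if F: "\<And>k. F k \<in> fock_sobolev m \<alpha> p" and R: "\<And>k. fs_norm m \<alpha> p (F k) \<le> ennreal R" for F :: "nat \<Rightarrow> complex^'n \<Rightarrow> complex" and R
  proof -
    have ent: "entire (F n)" for n using F fock_sobolev_iff_norm[where 'n = 'n, OF p0 \<alpha>] by auto
    define M where "M = (C2 * \<bar>R\<bar>) powr p"
    have M: "0 \<le> M" by (simp add: M_def)
    have mass: "fock_mass m \<alpha> p (F n) \<le> ennreal M" for n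
    proof -
      have "fs_norm m \<alpha> p (F n) \<le> ennreal \<bar>R\<bar>" using R[of n] by (rule order_trans) (auto intro: ennreal_leI)
      then have "epow (fock_mass m \<alpha> p (F n)) (1 / p) \<le> ennreal (C2 * \<bar>R\<bar>)"
        using order_trans[OF C2(2)[OF ent] mult_left_mono] C2(1) by (simp add: ennreal_mult)
      then have "epow (epow (fock_mass m \<alpha> p (F n)) (1 / p)) p \<le> epow (ennreal (C2 * \<bar>R\<bar>)) p"
        using p0 by (intro epow_mono) auto
      then show ?thesis using p0 C2(1) by (simp add: epow_epow epow_ennreal M_def)
    qed
    obtain k f where kf: "strict_mono (k :: nat \<Rightarrow> nat)" "entire f" "fock_mass m \<alpha> p f \<le> ennreal M"
      "\<And>R. uniform_limit (cball 0 R) (\<lambda>n. F (k n)) f sequentially"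
      by (rule fock_mass_Montel[OF p0 \<alpha> ent mass M]) (rule that)
    define h where "h = (\<lambda>n z. F (k n) z - f z)"
    have hent: "entire (h n)" for n unfolding h_def by (intro entire_diff ent kf(2))
    have hmass: "fock_mass m \<alpha> p (h n) \<le> ennreal (2 powr p * (M + M))" for n
    proof -
      have "fock_mass m \<alpha> p (h n) \<le> ennreal (2 powr p) * (fock_mass m \<alpha> p (F (k n)) + fock_mass m \<alpha> p f)"
        by (rule fock_mass_add_le[OF p0 ent kf(2)]) (simp add: h_def norm_triangle_ineq4)
      also have "\<dots> \<le> ennreal (2 powr p) * (ennreal M + ennreal M)"
        by (intro mult_left_mono add_mono mass kf(3)) simp
      finally show ?thesis
        by (simp only: ennreal_plus[OF M M, symmetric] ennreal_mult[OF powr_ge_zero add_nonneg_nonneg[OF M M]])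
    qed
    have hlim: "uniform_limit (cball 0 R) h (\<lambda>_. 0) sequentially" for R
      using kf(4)[of R] by (simp add: uniform_limit_iff h_def dist_norm)
    have "(\<lambda>n. fs_mass m \<alpha> q (wcomp u \<psi> (h n))) \<longlonglongrightarrow> 0"
      by (rule wcomp_mass_tendsto_0[OF q p \<alpha> u \<psi> L hent hmass _ hlim]) (use M in simp)
    then have "(\<lambda>n. fs_norm m \<alpha> q (wcomp u \<psi> (h n))) \<longlonglongrightarrow> 0" by (rule fs_norm_tendsto_0[OF q \<alpha>])
    moreover have "wcomp u \<psi> (h n) = (\<lambda>z. wcomp u \<psi> (F (k n)) z - wcomp u \<psi> f z)" for n
      by (simp add: wcomp_def h_def right_diff_distrib)
    moreover have "f \<in> fock_sobolev m \<alpha> p"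
      using fock_sobolev_eq[where 'n = 'n, OF p0 \<alpha>] kf(2) le_less_trans[OF kf(3)] by simp
    ultimately show ?thesis using kf(1) maps by (intro exI[of _ k] exI[of _ "wcomp u \<psi> f"]) simp
  qed
  show ?thesis
    unfolding fs_compact_def
  proof (intro conjI ballI allI impI)
    fix f :: "complex^'n \<Rightarrow> complex" assume "f \<in> fock_sobolev m \<alpha> p"
    then show "wcomp u \<psi> f \<in> fock_sobolev m \<alpha> q" by (rule maps)
  next
    fix F :: "nat \<Rightarrow> complex^'n \<Rightarrow> complex"
    assume "(\<forall>k. F k \<in> fock_sobolev m \<alpha> p) \<and> (\<exists>R. \<forall>k. fs_norm m \<alpha> p (F k) \<le> ennreal R)"
    then obtain R where "\<And>k. F k \<in> fock_sobolev m \<alpha> p" "\<And>k. fs_norm m \<alpha> p (F k) \<le> ennreal R" by auto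
    then show "\<exists>r g. strict_mono (r :: nat \<Rightarrow> nat) \<and> g \<in> fock_sobolev m \<alpha> q \<and>
                 (\<lambda>k. fs_norm m \<alpha> q (\<lambda>z. wcomp u \<psi> (F (r k)) z - g z)) \<longlonglongrightarrow> 0" by (rule seq)
  qed
qed

text \<open>Otherwise some functions of norm at most \<open>1\<close> have images with norms at least \<open>0, 1, 2, \<dots>\<close>, and no
  subsequence of these converges, since a convergent one would be bounded by the quasi-triangle
  inequality.\<close>

lemma fs_bounded_if_compact:
  fixes u :: "complex^'n \<Rightarrow> complex"
  assumes q: "0 < (q::real)" and p: "0 < p" and \<alpha>: "0 < \<alpha>" and u: "entire u" and \<psi>: "entire_map \<psi>"
    and comp: "fs_compact m \<alpha> p q (wcomp u \<psi>)"
  shows "fs_bounded m \<alpha> p q (wcomp u \<psi>)"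
proof (rule ccontr)
  assume neg: "\<not> fs_bounded m \<alpha> p q (wcomp u \<psi>)"
  have maps: "\<And>f. f \<in> fock_sobolev m \<alpha> p \<Longrightarrow> wcomp u \<psi> f \<in> fock_sobolev m \<alpha> q"
    using comp unfolding fs_compact_def by blast
  have ex: "\<exists>g. g \<in> fock_sobolev m \<alpha> p \<and> fs_norm m \<alpha> p g \<le> 1 \<and> ennreal (real N) \<le> fs_norm m \<alpha> q (wcomp u \<psi> g)" for N :: nat
  proof -
    obtain f where f: "f \<in> fock_sobolev m \<alpha> p" "ennreal (real N) * fs_norm m \<alpha> p f < fs_norm m \<alpha> q (wcomp u \<psi> f)"
      using neg maps unfolding fs_bounded_def by (meson not_less)
    have ent: "entire f" and fin: "fs_norm m \<alpha> p f < \<infinity>" using f fock_sobolev_iff_norm[where 'n = 'n, OF p \<alpha>] by auto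
    have fin': "fs_norm m \<alpha> q (wcomp u \<psi> f) < \<infinity>" using maps[OF f(1)] fock_sobolev_iff_norm[where 'n = 'n, OF q \<alpha>] by auto
    obtain s where s: "fs_norm m \<alpha> p f = ennreal s" "0 \<le> s" using fin by (cases "fs_norm m \<alpha> p f") auto
    obtain t where t: "fs_norm m \<alpha> q (wcomp u \<psi> f) = ennreal t" "0 \<le> t" using fin' by (cases "fs_norm m \<alpha> q (wcomp u \<psi> f)") auto
    have st: "real N * s < t" using f(2) s t by (simp add: ennreal_less_iff flip: ennreal_mult)
    then have t0: "0 < t" using s(2) by (smt (verit) mult_nonneg_nonneg of_nat_0_le_iff)
    \<comment> \<open>The norm of \<open>f\<close> may vanish, and then the image is scaled to the value \<open>N\<close>.\<close>
    define c where "c = (if s = 0 then real N / t else 1 / s)"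
    have c: "0 \<le> c" "c * s \<le> 1" "real N \<le> c * t"
      using s t0 st by (auto simp: c_def field_simps)
    define g where "g = (\<lambda>z. of_real c * f z)"
    have gent: "entire g" unfolding g_def by (intro entire_mult entire_const ent)
    have gn: "fs_norm m \<alpha> p g = ennreal (c * s)"
      unfolding g_def fs_norm_scale[OF p c(1) ent] s using c s by (simp add: ennreal_mult)
    have "wcomp u \<psi> g = (\<lambda>z. of_real c * wcomp u \<psi> f z)" by (auto simp: wcomp_def g_def)
    then have "fs_norm m \<alpha> q (wcomp u \<psi> g) = ennreal (c * t)"
      using fs_norm_scale[OF q c(1) entire_wcomp[OF u \<psi> ent]] t c by (simp add: ennreal_mult)
    moreover have "g \<in> fock_sobolev m \<alpha> p" using gn gent fock_sobolev_iff_norm[where 'n = 'n, OF p \<alpha>] by simp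
    moreover have "ennreal (c * s) \<le> 1" using c(2) by (simp add: ennreal_le_1)
    ultimately show ?thesis using gn c(3) by (intro exI[of _ g]) (simp add: ennreal_leI)
  qed
  then obtain F where F: "\<And>N. F N \<in> fock_sobolev m \<alpha> p" "\<And>N. fs_norm m \<alpha> p (F N) \<le> 1"
    "\<And>N::nat. ennreal (real N) \<le> fs_norm m \<alpha> q (wcomp u \<psi> (F N))" by metis
  have "\<exists>R::real. \<forall>k. fs_norm m \<alpha> p (F k) \<le> ennreal R" using F(2) by (intro exI[of _ 1]) simp
  then obtain r g where rg: "strict_mono (r :: nat \<Rightarrow> nat)" "g \<in> fock_sobolev m \<alpha> q"
     "(\<lambda>k. fs_norm m \<alpha> q (\<lambda>z. wcomp u \<psi> (F (r k)) z - g z)) \<longlonglongrightarrow> 0"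
    using comp F(1) unfolding fs_compact_def by blast
  have gent: "entire g" and gfin: "fock_mass m \<alpha> q g < \<infinity>" using rg(2) fock_sobolev_eq[where 'n = 'n, OF q \<alpha>] by auto
  obtain C where C: "0 < C"
    "\<And>f :: complex^'n \<Rightarrow> complex. fs_norm m \<alpha> q f \<le> ennreal C * epow (fock_mass m \<alpha> q f) (1 / q)"
    "\<And>f :: complex^'n \<Rightarrow> complex. entire f \<Longrightarrow> epow (fock_mass m \<alpha> q f) (1 / q) \<le> ennreal C * fs_norm m \<alpha> q f"
    by (rule fs_norm_equiv[OF q \<alpha>, where m = m]) (rule that)
  obtain G where G: "fock_mass m \<alpha> q g = ennreal G" "0 \<le> G" using gfin by (cases "fock_mass m \<alpha> q g") auto
  define X where "X = C * (2 powr q * (C powr q + G)) powr (1 / q)"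
  have "\<forall>\<^sub>F k in sequentially. fs_norm m \<alpha> q (\<lambda>z. wcomp u \<psi> (F (r k)) z - g z) < 1"
    by (rule order_tendstoD(2)[OF rg(3)]) simp
  then obtain K where K: "\<And>k. K \<le> k \<Longrightarrow> fs_norm m \<alpha> q (\<lambda>z. wcomp u \<psi> (F (r k)) z - g z) < 1"
    unfolding eventually_sequentially by blast
  obtain N :: nat where N: "X < real N" using reals_Archimedean2 by blast
  define k where "k = max K N"
  define T where "T = wcomp u \<psi> (F (r k))"
  have Tent: "entire T" unfolding T_def using F(1) fock_sobolev_iff_norm[where 'n = 'n, OF p \<alpha>] by (intro entire_wcomp u \<psi>) auto
  have dent: "entire (\<lambda>z. T z - g z)" by (intro entire_diff Tent gent)
  have "epow (fock_mass m \<alpha> q (\<lambda>z. T z - g z)) (1 / q) \<le> ennreal C * 1"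
    by (rule order_trans[OF C(3)[OF dent] mult_left_mono]) (use K[of k] in \<open>auto simp: T_def k_def\<close>)
  then have "epow (epow (fock_mass m \<alpha> q (\<lambda>z. T z - g z)) (1 / q)) q \<le> epow (ennreal C) q" using q by (intro epow_mono) auto
  then have d: "fock_mass m \<alpha> q (\<lambda>z. T z - g z) \<le> ennreal (C powr q)" using q C(1) by (simp add: epow_epow epow_ennreal)
  have "fock_mass m \<alpha> q T \<le> ennreal (2 powr q) * (fock_mass m \<alpha> q (\<lambda>z. T z - g z) + fock_mass m \<alpha> q g)"
    by (rule fock_mass_add_le[OF q dent gent]) (metis add.commute norm_triangle_sub)
  also have "\<dots> \<le> ennreal (2 powr q) * (ennreal (C powr q) + ennreal G)"
    unfolding G(1) by (intro mult_left_mono add_mono d) auto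
  also have "\<dots> = ennreal (2 powr q * (C powr q + G))" using G by (simp add: ennreal_mult)
  finally have "epow (fock_mass m \<alpha> q T) (1 / q) \<le> epow (ennreal (2 powr q * (C powr q + G))) (1 / q)" using q by (intro epow_mono) auto
  then have "ennreal C * epow (fock_mass m \<alpha> q T) (1 / q) \<le> ennreal C * ennreal ((2 powr q * (C powr q + G)) powr (1 / q))"
    using G by (intro mult_left_mono) (auto simp: epow_ennreal)
  then have "fs_norm m \<alpha> q T \<le> ennreal X" using C(1) order_trans[OF C(2)[of T]] by (simp add: X_def ennreal_mult)
  moreover have "ennreal (real N) \<le> fs_norm m \<alpha> q T"
  proof -
    have "N \<le> r k" using strict_mono_imp_increasing[OF rg(1), of k] by (simp add: k_def)
    then have "ennreal (real N) \<le> ennreal (real (r k))" by (intro ennreal_leI) simp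
    then show ?thesis using F(3)[of "r k"] unfolding T_def by (rule order_trans)
  qed
  ultimately have "ennreal (real N) \<le> ennreal X" by (rule order_trans[rotated])
  moreover have "0 \<le> X" using C(1) by (simp add: X_def)
  ultimately show False using N by (simp add: ennreal_le_iff)
qed

theorem theorem3p3:
  fixes \<alpha> p q :: real and m :: nat
  assumes "\<alpha> > 0" and "0 < q" and "q < p"
  shows
    "(\<forall>(u :: complex ^ 'n \<Rightarrow> complex) \<psi>. entire u \<and> entire_map \<psi> \<longrightarrow>
        (fs_bounded m \<alpha> p q (wcomp u \<psi>) \<longleftrightarrow> fs_compact m \<alpha> p q (wcomp u \<psi>)) \<and>
        (fs_compact m \<alpha> p q (wcomp u \<psi>) \<longleftrightarrow>
           in_Lr (p / (p - q)) (fs_berezin m \<alpha> q \<psi> (\<lambda>z. norm (u z) powr q)))) \<and>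
     (\<exists>C>0. \<forall>(u :: complex ^ 'n \<Rightarrow> complex) \<psi>. entire u \<and> entire_map \<psi> \<longrightarrow>
        fs_bounded m \<alpha> p q (wcomp u \<psi>) \<longrightarrow>
        fs_opnorm m \<alpha> p q (wcomp u \<psi>) \<le>
          ennreal C * epow (Lr_norm (p / (p - q))
                        (fs_berezin m \<alpha> q \<psi> (\<lambda>z. norm (u z) powr q))) (1 / q) \<and>
        epow (Lr_norm (p / (p - q))
                (fs_berezin m \<alpha> q \<psi> (\<lambda>z. norm (u z) powr q))) (1 / q) \<le>
          ennreal C * fs_opnorm m \<alpha> p q (wcomp u \<psi>))"
proof -
  note \<alpha> = assms(1) and q = assms(2) and p = assms(3)
  have p0: "0 < p" using q p by simp
  let ?B = "\<lambda>(u :: complex ^ 'n \<Rightarrow> complex) \<psi>. fs_berezin m \<alpha> q \<psi> (\<lambda>z. norm (u z) powr q)"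
  let ?L = "\<lambda>u \<psi>. Lr_norm (p / (p - q)) (?B u \<psi>)"
  obtain C1 where C1: "0 < C1" "\<And>(u :: complex^'n \<Rightarrow> complex) \<psi> f. entire u \<Longrightarrow> entire_map \<psi> \<Longrightarrow> entire f \<Longrightarrow>
     fs_norm m \<alpha> q (wcomp u \<psi> f) \<le> ennreal C1 * epow (?L u \<psi>) (1 / q) * fs_norm m \<alpha> p f"
    using wcomp_norm_le[OF q p \<alpha>, where m = m] by blast
  obtain C2 where C2: "0 < C2" "\<And>(u :: complex^'n \<Rightarrow> complex) \<psi> N. entire u \<Longrightarrow> entire_map \<psi> \<Longrightarrow> 0 \<le> N \<Longrightarrow>
     (\<And>f. f \<in> fock_sobolev m \<alpha> p \<Longrightarrow> fs_norm m \<alpha> q (wcomp u \<psi> f) \<le> ennreal N * fs_norm m \<alpha> p f) \<Longrightarrow>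
     epow (?L u \<psi>) (1 / q) \<le> ennreal (C2 * N)"
    using berezin_norm_le[OF q p \<alpha>, where m = m] by blast
  have lower: "epow (?L u \<psi>) (1 / q) \<le> ennreal C2 * fs_opnorm m \<alpha> p q (wcomp u \<psi>)"
    and Lp: "in_Lr (p / (p - q)) (?B u \<psi>)"
    if u: "entire u" and \<psi>: "entire_map \<psi>" and bd: "fs_bounded m \<alpha> p q (wcomp u \<psi>)" for u :: "complex^'n \<Rightarrow> complex" and \<psi>
  proof -
    obtain N where N: "fs_opnorm m \<alpha> p q (wcomp u \<psi>) = ennreal N" "0 \<le> N"
      using fs_opnorm_bound(1)[OF q p0 \<alpha> u \<psi> bd] by (cases "fs_opnorm m \<alpha> p q (wcomp u \<psi>)") auto
    have le: "epow (?L u \<psi>) (1 / q) \<le> ennreal (C2 * N)"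
      by (rule C2(2)[OF u \<psi> N(2)]) (use fs_opnorm_bound(2)[OF q p0 \<alpha> u \<psi> bd] N in simp)
    then show "epow (?L u \<psi>) (1 / q) \<le> ennreal C2 * fs_opnorm m \<alpha> p q (wcomp u \<psi>)"
      using N C2(1) by (simp add: ennreal_mult)
    have "epow (?L u \<psi>) (1 / q) < top" using le_less_trans[OF le] by simp
    then show "in_Lr (p / (p - q)) (?B u \<psi>)"
      using fs_berezin_measurable[OF u \<psi> q] by (simp add: in_Lr_def epow_less_top_iff)
  qed
  have upper: "fs_opnorm m \<alpha> p q (wcomp u \<psi>) \<le> ennreal C1 * epow (?L u \<psi>) (1 / q)"
    if u: "entire u" and \<psi>: "entire_map \<psi>" for u :: "complex^'n \<Rightarrow> complex" and \<psi>
    unfolding fs_opnorm_def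
  proof (rule SUP_least)
    fix f :: "complex^'n \<Rightarrow> complex" assume "f \<in> {f \<in> fock_sobolev m \<alpha> p. fs_norm m \<alpha> p f \<le> 1}"
    then have f: "entire f" "fs_norm m \<alpha> p f \<le> 1" using fock_sobolev_iff_norm[where 'n = 'n, OF p0 \<alpha>] by auto
    have "fs_norm m \<alpha> q (wcomp u \<psi> f) \<le> ennreal C1 * epow (?L u \<psi>) (1 / q) * 1"
      by (rule order_trans[OF C1(2)[OF u \<psi> f(1)] mult_left_mono]) (use f in auto)
    then show "fs_norm m \<alpha> q (wcomp u \<psi> f) \<le> ennreal C1 * epow (?L u \<psi>) (1 / q)" by simp
  qed
  show ?thesis
  proof (intro conjI)
    show "\<forall>(u :: complex ^ 'n \<Rightarrow> complex) \<psi>. entire u \<and> entire_map \<psi> \<longrightarrow>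
        (fs_bounded m \<alpha> p q (wcomp u \<psi>) \<longleftrightarrow> fs_compact m \<alpha> p q (wcomp u \<psi>)) \<and>
        (fs_compact m \<alpha> p q (wcomp u \<psi>) \<longleftrightarrow> in_Lr (p / (p - q)) (?B u \<psi>))"
      using Lp fs_compact_if_in_Lr[OF q p \<alpha>] fs_bounded_if_compact[OF q p0 \<alpha>] by blast
    have "ennreal C1 * x \<le> ennreal (max C1 C2) * x" "ennreal C2 * x \<le> ennreal (max C1 C2) * x" for x
      by (auto intro!: mult_right_mono ennreal_leI)
    then show "\<exists>C>0. \<forall>(u :: complex ^ 'n \<Rightarrow> complex) \<psi>. entire u \<and> entire_map \<psi> \<longrightarrow>
        fs_bounded m \<alpha> p q (wcomp u \<psi>) \<longrightarrow>
        fs_opnorm m \<alpha> p q (wcomp u \<psi>) \<le> ennreal C * epow (?L u \<psi>) (1 / q) \<and>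
        epow (?L u \<psi>) (1 / q) \<le> ennreal C * fs_opnorm m \<alpha> p q (wcomp u \<psi>)"
      using C1(1) upper lower by (intro exI[of _ "max C1 C2"]) (meson less_max_iff_disj order_trans)
  qed
qed

end
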